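(* Let $d\geqslant 3$, $n\in\{2d,2d+1\}$, let $\ell$ be a prime power, let $\Delta$ be the (bipartite) dual polar graph on $[D_n(\ell)]$ with vertex set $V\Delta$, and let $\Gamma=D_{n,n}(\ell)$ be a halved graph of $\Delta$, with vertex set $X\subset V\Delta$. Let $Y$ be a nontrivial descendent of $\Gamma$ (with respect to the standard $Q$-polynomial ordering) with width $w$. Then $n=2d$ and one of the following holds: (i) $w=1$ and $Y=\Delta(z)$, the set of neighbours of $z$ in $\Delta$, for some $z\in V\Delta\setminus X$; (ii) $w=d-1$ and $Y=\{x\in X:u\subseteq x\}$ for some isotropic subspace $u$ of $[D_{2d}(\ell)]$ with $\dim u=1$.
   Context: All graphs are finite, simple and undirected. Let $\Gamma$ be a connected graph with vertex set $X$, path-length distance $\partial$ and diameter $d$; let $A_i\in\mathbb{C}^{X\times X}$ be the adjacency matrix of the distance-$i$ graph ($A_0=I$). $\Gamma$ is distance-regular if there are integers $b_i,c_i$ such that whenever $\partial(x,y)=i$, $y$ has exactly $b_i$ (resp. $c_i$) neighbours at distance $i+1$ (resp. $i-1$) from $x$. Then the Bose--Mesner algebra $\langle A_0,\dots,A_d\rangle$ (complex span) is a commutative semisimple algebra with a basis of primitive idempotents $E_0=|X|^{-1}J,E_1,\dots,E_d$. $\Gamma$ is $Q$-polynomial with respect to the ordering $\{E_i\}_{i=0}^d$ if there are scalars $a_i^*,b_i^*,c_i^*$ with $b_d^*=c_0^*=0$, $b_{i-1}^*c_i^*\neq 0$ $(1\leqslant i\leqslant d)$ and $E_1\circ E_i=|X|^{-1}(b_{i-1}^*E_{i-1}+a_i^*E_i+c_{i+1}^*E_{i+1})$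 $(0\leqslant i\leqslant d)$, where $\circ$ is the entrywise product, $E_{-1}=E_{d+1}=0$, $b_{-1}^*=c_{d+1}^*=0$. Write $|X|E_1=\sum_{i=0}^d\theta_i^*A_i$. For a nonempty $Y\subseteq X$ with characteristic vector $\hat Y$, the width is $w=\max\{i:\hat Y^{\mathsf T}A_i\hat Y\neq 0\}$ and the dual width is $w^*=\max\{i:\hat Y^{\mathsf T}E_i\hat Y\neq 0\}$. One always has $w+w^*\geqslant d$; $Y$ is a descendent of $\Gamma$ if $w+w^*=d$; it is trivial if moreover $w=0$ or $w=d$ (a singleton or $X$), nontrivial otherwise. Put $[i]_q=1+q+\dots+q^{i-1}$. $\Gamma$ has classical parameters $(d,q,\alpha,\beta)$ if $b_i=([d]_q-[i]_q)(\beta-\alpha[i]_q)$ and $c_i=[i]_q(1+\alpha[i-1]_q)$ for $0\leqslant i\leqslant d$. Then $\Gamma$ has a $Q$-polynomial ordering, called standard, for which $\theta_i^*=\xi^*[d-i]_q+\zeta^*$ for some scalars $\xi^*\neq 0$, $\zeta^*$. $[D_n(\ell)]$ is $\mathbb{F}_\ell^{2n}$ with a nondegenerate quadratic form of Witt index $n$; a subspace is isotropic if the quadratic form vanishes on it. $\Delta$ has as vertices the maximal isotropic subspaces (dimension $n$), adjacent when their intersection has dimension $n-1$; it is bipartite, with halves $X^+$, $X^-$. $D_{n,n}(\ell)$ is the graph on $X=X^{\varepsilon}$ ($\varepsilon\in\{+,-\}$) in which two vertices are adjacent when they are at distance $2$ in $\Delta$. It is distance-regular with diameter $d$ and classical parameters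 $(d,\ell^2,\alpha,\beta)$, where $\alpha+1=[3]_\ell$ and $\beta+1=[m+1]_\ell$, with $m=2d-1$ if $n=2d$ and $m=2d+1$ if $n=2d+1$. *)

theory Defs
  imports "HOL-Analysis.Analysis"
begin

section \<open>Distance-regular graphs\<close>

text \<open>
  A graph is given by a vertex set \<open>X\<close> and a symmetric irreflexive set \<open>R\<close> of ordered pairs of
  adjacent vertices.
\<close>

definition simple_graph :: "'v set \<Rightarrow> ('v \<times> 'v) set \<Rightarrow> bool" where
  "simple_graph X R \<longleftrightarrow> finite X \<and> R \<subseteq> X \<times> X \<and> sym R \<and> irrefl R"

definition connected_graph :: "'v set \<Rightarrow> ('v \<times> 'v) set \<Rightarrow> bool" where
  "connected_graph X R \<longleftrightarrow> X \<noteq> {} \<and> (\<forall>x\<in>X. \<forall>y\<in>X. (x, y) \<in> R\<^sup>*)"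

text \<open>Path-length distance; meaningful only for vertices in the same connected component.\<close>

definition gdist :: "('v \<times> 'v) set \<Rightarrow> 'v \<Rightarrow> 'v \<Rightarrow> nat" where
  "gdist R x y = (LEAST k. (x, y) \<in> R ^^ k)"

definition gdiam :: "'v set \<Rightarrow> ('v \<times> 'v) set \<Rightarrow> nat" where
  "gdiam X R = Max {gdist R x y | x y. x \<in> X \<and> y \<in> X}"

definition distance_regular :: "'v set \<Rightarrow> ('v \<times> 'v) set \<Rightarrow> bool" where
  "distance_regular X R \<longleftrightarrow> simple_graph X R \<and> connected_graph X R \<and>
     (\<exists>b c :: nat \<Rightarrow> nat. \<forall>x\<in>X. \<forall>y\<in>X.
        card {z\<in>X. (y, z) \<in> R \<and> gdist R x z = gdist R x y + 1} = b (gdist R x y) \<and>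
        card {z\<in>X. (y, z) \<in> R \<and> gdist R x z + 1 = gdist R x y} = c (gdist R x y))"

section \<open>Bose--Mesner algebra and Q-polynomial orderings\<close>

text \<open>
  A complex matrix with rows and columns indexed by \<open>X\<close> is a function of two arguments that
  vanishes off \<open>X \<times> X\<close>.
\<close>

type_synonym 'v cmatrix = "'v \<Rightarrow> 'v \<Rightarrow> complex"

definition mat_mult :: "'v set \<Rightarrow> 'v cmatrix \<Rightarrow> 'v cmatrix \<Rightarrow> 'v cmatrix" where
  "mat_mult X M N = (\<lambda>x y. \<Sum>z\<in>X. M x z * N z y)"

definition dist_matrix :: "'v set \<Rightarrow> ('v \<times> 'v) set \<Rightarrow> nat \<Rightarrow> 'v cmatrix" where
  "dist_matrix X R i = (\<lambda>x y. if x \<in> X \<and> y \<in> X \<and> gdist R x y = i then 1 else 0)"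

definition bose_mesner :: "'v set \<Rightarrow> ('v \<times> 'v) set \<Rightarrow> 'v cmatrix set" where
  "bose_mesner X R =
     {M. \<exists>t :: nat \<Rightarrow> complex. M = (\<lambda>x y. \<Sum>i\<le>gdiam X R. t i * dist_matrix X R i x y)}"

definition bm_idempotent :: "'v set \<Rightarrow> ('v \<times> 'v) set \<Rightarrow> 'v cmatrix \<Rightarrow> bool" where
  "bm_idempotent X R M \<longleftrightarrow> M \<in> bose_mesner X R \<and> mat_mult X M M = M"

definition primitive_idempotent :: "'v set \<Rightarrow> ('v \<times> 'v) set \<Rightarrow> 'v cmatrix \<Rightarrow> bool" where
  "primitive_idempotent X R M \<longleftrightarrow> bm_idempotent X R M \<and> M \<noteq> (\<lambda>x y. 0) \<and>
     (\<forall>F G. bm_idempotent X R F \<and> bm_idempotent X R G \<and>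
        mat_mult X F G = (\<lambda>x y. 0) \<and> mat_mult X G F = (\<lambda>x y. 0) \<and>
        M = (\<lambda>x y. F x y + G x y) \<longrightarrow> F = (\<lambda>x y. 0) \<or> G = (\<lambda>x y. 0))"

text \<open>
  \<open>E 0, \<dots>, E d\<close> (with \<open>d\<close> the diameter) is the ordering of the primitive idempotents;
  the values of \<open>E\<close> beyond \<open>d\<close> are irrelevant, and the terms with \<open>E\<close> at \<open>-1\<close> and \<open>d + 1\<close>
  are zero.
\<close>

definition Q_polynomial :: "'v set \<Rightarrow> ('v \<times> 'v) set \<Rightarrow> (nat \<Rightarrow> 'v cmatrix) \<Rightarrow> bool" where
  "Q_polynomial X R E \<longleftrightarrow> distance_regular X R \<and>
     bij_betw E {0..gdiam X R} {M. primitive_idempotent X R M} \<and>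
     E 0 = (\<lambda>x y. if x \<in> X \<and> y \<in> X then 1 / of_nat (card X) else 0) \<and>
     (\<exists>a b c :: nat \<Rightarrow> complex.
        b (gdiam X R) = 0 \<and> c 0 = 0 \<and>
        (\<forall>i\<in>{1..gdiam X R}. b (i - 1) * c i \<noteq> 0) \<and>
        (\<forall>i\<in>{0..gdiam X R}. \<forall>x\<in>X. \<forall>y\<in>X.
           E 1 x y * E i x y = 1 / of_nat (card X) *
             ((if i = 0 then 0 else b (i - 1) * E (i - 1) x y) + a i * E i x y +
              (if i = gdiam X R then 0 else c (i + 1) * E (i + 1) x y))))"

definition qnum :: "'a::comm_semiring_1 \<Rightarrow> nat \<Rightarrow> 'a" where
  "qnum q i = (\<Sum>j<i. q ^ j)"

text \<open>
  The standard ordering of a graph with classical parameters \<open>(d, q, \<alpha>, \<beta>)\<close>; it depends on the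
  parameters only through \<open>d\<close> and \<open>q\<close>. The scalars \<open>\<theta> i\<close> are the dual eigenvalues.
\<close>

definition standard_ordering ::
    "'v set \<Rightarrow> ('v \<times> 'v) set \<Rightarrow> complex \<Rightarrow> (nat \<Rightarrow> 'v cmatrix) \<Rightarrow> bool" where
  "standard_ordering X R q E \<longleftrightarrow> Q_polynomial X R E \<and>
     (\<exists>\<theta> :: nat \<Rightarrow> complex.
        (\<forall>x\<in>X. \<forall>y\<in>X. of_nat (card X) * E 1 x y =
           (\<Sum>i\<le>gdiam X R. \<theta> i * dist_matrix X R i x y)) \<and>
        (\<exists>\<xi> \<zeta>. \<xi> \<noteq> 0 \<and> (\<forall>i\<le>gdiam X R. \<theta> i = \<xi> * qnum q (gdiam X R - i) + \<zeta>)))"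

section \<open>Width, dual width and descendents\<close>

definition char_form :: "'v set \<Rightarrow> 'v cmatrix \<Rightarrow> 'v set \<Rightarrow> complex" where
  "char_form X M Y = (\<Sum>x\<in>X. \<Sum>y\<in>X. of_bool (x \<in> Y) * M x y * of_bool (y \<in> Y))"

definition width :: "'v set \<Rightarrow> ('v \<times> 'v) set \<Rightarrow> 'v set \<Rightarrow> nat" where
  "width X R Y = Max {i \<in> {0..gdiam X R}. char_form X (dist_matrix X R i) Y \<noteq> 0}"

definition dual_width ::
    "'v set \<Rightarrow> ('v \<times> 'v) set \<Rightarrow> (nat \<Rightarrow> 'v cmatrix) \<Rightarrow> 'v set \<Rightarrow> nat" where
  "dual_width X R E Y = Max {i \<in> {0..gdiam X R}. char_form X (E i) Y \<noteq> 0}"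

definition descendent ::
    "'v set \<Rightarrow> ('v \<times> 'v) set \<Rightarrow> (nat \<Rightarrow> 'v cmatrix) \<Rightarrow> 'v set \<Rightarrow> bool" where
  "descendent X R E Y \<longleftrightarrow> Y \<noteq> {} \<and> Y \<subseteq> X \<and> width X R Y + dual_width X R E Y = gdiam X R"

definition nontrivial_descendent ::
    "'v set \<Rightarrow> ('v \<times> 'v) set \<Rightarrow> (nat \<Rightarrow> 'v cmatrix) \<Rightarrow> 'v set \<Rightarrow> bool" where
  "nontrivial_descendent X R E Y \<longleftrightarrow>
     descendent X R E Y \<and> width X R Y \<noteq> 0 \<and> width X R Y \<noteq> gdiam X R"

section \<open>Quadratic forms and the dual polar graph\<close>

definition polar_form :: "('a::field ^ 'm \<Rightarrow> 'a) \<Rightarrow> 'a ^ 'm \<Rightarrow> 'a ^ 'm \<Rightarrow> 'a" where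
  "polar_form Q x y = Q (x + y) - Q x - Q y"

text \<open>The polar form is symmetric, so linearity in one argument gives bilinearity.\<close>

definition quadratic_form :: "('a::field ^ 'm \<Rightarrow> 'a) \<Rightarrow> bool" where
  "quadratic_form Q \<longleftrightarrow> (\<forall>c x. Q (c *s x) = c ^ 2 * Q x) \<and>
     (\<forall>y. Vector_Spaces.linear (*s) (*) (\<lambda>x. polar_form Q x y))"

text \<open>
  This is the usual notion in every characteristic: the form has no nonzero zero in the radical
  of its polar form.
\<close>

definition nondegenerate :: "('a::field ^ 'm \<Rightarrow> 'a) \<Rightarrow> bool" where
  "nondegenerate Q \<longleftrightarrow> (\<forall>x. Q x = 0 \<and> (\<forall>y. polar_form Q x y = 0) \<longrightarrow> x = 0)"

definition isotropic :: "('a::field ^ 'm \<Rightarrow> 'a) \<Rightarrow> ('a ^ 'm) set \<Rightarrow> bool" where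
  "isotropic Q U \<longleftrightarrow> vec.subspace U \<and> (\<forall>x\<in>U. Q x = 0)"

definition witt_index :: "('a::field ^ 'm \<Rightarrow> 'a) \<Rightarrow> nat" where
  "witt_index Q = Max {vec.dim U | U. isotropic Q U}"

text \<open>
  The polar space \<open>[D\<^sub>n]\<close>, as a property of a form \<open>Q\<close> on \<open>'a ^ 'm\<close>.
\<close>

definition polar_space_D :: "nat \<Rightarrow> ('a::field ^ 'm \<Rightarrow> 'a) \<Rightarrow> bool" where
  "polar_space_D n Q \<longleftrightarrow> CARD('m) = 2 * n \<and> quadratic_form Q \<and> nondegenerate Q \<and> witt_index Q = n"

text \<open>
  Maximal isotropic subspaces. The dimension condition is redundant, since all maximal isotropic
  subspaces have dimension equal to the Witt index.
\<close>

definition dp_vertices :: "('a::field ^ 'm \<Rightarrow> 'a) \<Rightarrow> ('a ^ 'm) set set" where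
  "dp_vertices Q = {U. isotropic Q U \<and> vec.dim U = witt_index Q \<and>
     (\<forall>W. isotropic Q W \<and> U \<subseteq> W \<longrightarrow> W = U)}"

definition dp_adj :: "('a::field ^ 'm \<Rightarrow> 'a) \<Rightarrow> (('a ^ 'm) set \<times> ('a ^ 'm) set) set" where
  "dp_adj Q = {(U, W). U \<in> dp_vertices Q \<and> W \<in> dp_vertices Q \<and>
     vec.dim (U \<inter> W) + 1 = witt_index Q}"

text \<open>
  \<open>X\<close> is one of the two colour classes of a proper 2-colouring of the graph \<open>(V, R)\<close>; for a
  connected bipartite graph these are exactly its two halves.
\<close>

definition bipartite_half :: "'v set \<Rightarrow> ('v \<times> 'v) set \<Rightarrow> 'v set \<Rightarrow> bool" where
  "bipartite_half V R X \<longleftrightarrow> X \<subseteq> V \<and> (\<forall>(x, y)\<in>R. x \<in> X \<longleftrightarrow> y \<notin> X)"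

definition halved_adj :: "('v \<times> 'v) set \<Rightarrow> 'v set \<Rightarrow> ('v \<times> 'v) set" where
  "halved_adj R X = {(x, y). x \<in> X \<and> y \<in> X \<and> (x, y) \<in> R\<^sup>* \<and> gdist R x y = 2}"

end

theory Submission
  imports Defs
begin

text \<open>
  Let \<open>\<sigma>\<close> be the cosine sequence of the last idempotent \<open>E d\<close>. Multiplying the characteristic
  vector of \<open>Y\<close>, which is orthogonal to \<open>E j\<close> for \<open>j > d - w\<close>, by \<open>w - 1\<close> factors that are affine
  in \<open>E 1 x\<close> keeps it orthogonal to \<open>E d\<close>. Choosing the factors to vanish at the distances
  \<open>2, \<dots>, w\<close> gives, for \<open>x \<in> Y\<close> and every vertex \<open>y\<close>, that the sum of \<open>\<sigma> (\<partial> y z)\<close> over the neighbours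
  \<open>z\<close> of \<open>x\<close> in \<open>Y\<close> equals \<open>- [w] \<sigma> (\<partial> y x)\<close>, with \<open>[w]\<close> the \<open>q\<close>-number.

  Neighbours of \<open>x\<close> in the half lie \<open>\<ell>\<close> on each line of the projective space on the quotient by
  \<open>x\<close>. The identity for \<open>y\<close> adjacent to \<open>x\<close> shows that \<open>Y\<close> contains all or none of the neighbours on a
  line, and that the set \<open>T\<close> of lines so obtained meets all lines outside \<open>T\<close> equally often, and
  likewise all lines in \<open>T\<close> (a Cameron--Liebler line class). For odd \<open>n\<close> the numbers do not fit an
  eigenvalue of the Grassmann graph. For even \<open>n\<close>, the identity for \<open>y\<close> at distance \<open>w\<close> shows that \<open>T\<close>
  contains all lines of a subspace of rank \<open>2w\<close>; if \<open>w \<ge> 2\<close>, this forces \<open>w = d - 1\<close> and \<open>T\<close> to be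
  the set of lines of a hyperplane, which is then the same for all \<open>x \<in> Y\<close>. If \<open>w = 1\<close>, the lines in \<open>T\<close>
  meet pairwise and are too many for a plane, so they share a point.
\<close>

section \<open>Bose--Mesner algebra of a distance-regular graph\<close>

text \<open>The neighbour identity also holds for \<open>X\<close> itself, with [d] in place of [w].
  That instance supplies the first cosine, and comparing it with the instance for \<open>Y\<close>
  at adjacent x and y eliminates the unknown second cosine. The information on \<open>Y\<close>
  depends on the choice of y: y = x gives the number of neighbours, y adjacent to x the number of
  common neighbours, and y at locally maximal distance the lines inside x + y.

  The parity of n enters through one coefficient. For a point P let \<tau> be the number of lines of
  T through P. Adding up these numbers along all lines through one point gives a linear equation in
  which \<tau> has coefficient m - [n - 1], where l m is the classical parameter \<beta>. It is
  nonzero for odd n, so that \<tau> would be constant, and it vanishes for even n.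

  The graph induced on \<open>Y\<close> is not known to be connected, so a hyperplane found at one
  vertex is at first constant only on a component. Choosing in this component a vertex farthest from
  an arbitrary y in \<open>Y\<close> extends the conclusion to all of \<open>Y\<close>.\<close>

lemma relpow_gdist: "(x, y) \<in> R\<^sup>* \<Longrightarrow> (x, y) \<in> R ^^ gdist R x y"
  unfolding gdist_def by (metis LeastI_ex rtrancl_imp_relpow)

lemma gdist_le: "(x, y) \<in> R ^^ k \<Longrightarrow> gdist R x y \<le> k"
  by (simp add: gdist_def Least_le)

lemma gdist_self [simp]: "gdist R x x = 0"
  using gdist_le[of x x 0 R] by simp

lemma sym_relpow: "sym R \<Longrightarrow> (x, y) \<in> R ^^ k \<longleftrightarrow> (y, x) \<in> R ^^ k"
proof -
  assume s: "sym R"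
  have "(x, y) \<in> R ^^ k \<Longrightarrow> (y, x) \<in> R ^^ k" for x y
  proof (induction k arbitrary: y)
    case (Suc k)
    then obtain z where "(x, z) \<in> R ^^ k" "(z, y) \<in> R" by auto
    then have "(z, x) \<in> R ^^ k" "(y, z) \<in> R" using Suc.IH s by (auto dest: symD)
    then show ?case by (rule relpow_Suc_I2[rotated])
  qed simp
  then show ?thesis by blast
qed

lemma gdist_commute: "sym R \<Longrightarrow> gdist R x y = gdist R y x"
  unfolding gdist_def using sym_relpow by metis

lemma mat_mult_assoc: "mat_mult X (mat_mult X F G) H = mat_mult X F (mat_mult X G H)"
proof (intro ext)
  fix x y
  have "mat_mult X (mat_mult X F G) H x y = (\<Sum>z\<in>X. \<Sum>v\<in>X. F x v * G v z * H z y)"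
    by (simp add: mat_mult_def sum_distrib_right)
  also have "\<dots> = (\<Sum>v\<in>X. \<Sum>z\<in>X. F x v * G v z * H z y)" by (rule sum.swap)
  also have "\<dots> = mat_mult X F (mat_mult X G H) x y"
    by (simp add: mat_mult_def sum_distrib_left mult.assoc)
  finally show "mat_mult X (mat_mult X F G) H x y = mat_mult X F (mat_mult X G H) x y" .
qed

lemma mat_mult_diff_right:
  "mat_mult X F (\<lambda>x y. G x y - H x y) = (\<lambda>x y. mat_mult X F G x y - mat_mult X F H x y)"
  by (simp add: mat_mult_def right_diff_distrib sum_subtractf)

lemma mat_mult_diff_left:
  "mat_mult X (\<lambda>x y. G x y - H x y) F = (\<lambda>x y. mat_mult X G F x y - mat_mult X H F x y)"
  by (simp add: mat_mult_def left_diff_distrib sum_subtractf)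

text \<open>Positivity of squared moduli. The vanishing results on idempotents below are obtained by
  writing a quantity as such a sum.\<close>

lemma sum_mult_cnj_eq_0:
  assumes "finite A" "(\<Sum>z\<in>A. f z * cnj (f z)) = 0" "z \<in> A" shows "f z = 0"
proof -
  have "complex_of_real (\<Sum>z\<in>A. (cmod (f z))\<^sup>2) = 0"
    using assms(2) by (simp only: of_real_sum complex_norm_square)
  then have "(\<Sum>z\<in>A. (cmod (f z))\<^sup>2) = 0" by (simp only: of_real_eq_0_iff)
  then show ?thesis using assms by (simp add: sum_nonneg_eq_0_iff)
qed

lemma char_form_subset:
  assumes "finite X" "Y \<subseteq> X" shows "char_form X M Y = (\<Sum>x\<in>Y. \<Sum>y\<in>Y. M x y)"
proof -
  have "char_form X M Y = (\<Sum>x\<in>X. of_bool (x \<in> Y) * (\<Sum>y\<in>X. M x y * of_bool (y \<in> Y)))"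
    unfolding char_form_def sum_distrib_left by (simp add: mult.assoc)
  then show ?thesis using assms by (simp add: Int_absorb1)
qed

section \<open>Distance-regular graphs and the matrices that depend only on the distance\<close>

locale drg =
  fixes X :: "'v set" and R :: "('v \<times> 'v) set"
  assumes distance_regular: "distance_regular X R"
begin

abbreviation D :: nat where "D \<equiv> gdiam X R"
abbreviation dst :: "'v \<Rightarrow> 'v \<Rightarrow> nat" where "dst \<equiv> gdist R"

lemma finite_X [simp]: "finite X" and R_sub: "R \<subseteq> X \<times> X" and sym_R: "sym R"
  and irrefl_R: "irrefl R" and X_ne: "X \<noteq> {}"
  and conn: "x \<in> X \<Longrightarrow> y \<in> X \<Longrightarrow> (x, y) \<in> R\<^sup>*"
  using distance_regular
  by (auto simp: distance_regular_def simple_graph_def connected_graph_def)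

lemma dst_commute: "dst x y = dst y x"
  by (rule gdist_commute[OF sym_R])

lemma R_commute: "(x, y) \<in> R \<longleftrightarrow> (y, x) \<in> R"
  using sym_R by (meson symE)

lemma dst_eq_0_iff: "x \<in> X \<Longrightarrow> y \<in> X \<Longrightarrow> dst x y = 0 \<longleftrightarrow> x = y"
  using relpow_gdist[OF conn, of x y] by auto

lemma dst_triangle:
  assumes "x \<in> X" "y \<in> X" "z \<in> X" shows "dst x z \<le> dst x y + dst y z"
proof (rule gdist_le)
  show "(x, z) \<in> R ^^ (dst x y + dst y z)"
    using relpow_gdist[OF conn, of x y] relpow_gdist[OF conn, of y z] assms
    by (auto simp: relpow_add)
qed

lemma dst_R: "(x, y) \<in> R \<Longrightarrow> dst x y = 1"
proof -
  assume r: "(x, y) \<in> R"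
  then have "dst x y \<le> 1" using gdist_le[of x y 1 R] by simp
  moreover have "dst x y \<noteq> 0" using r R_sub irrefl_R dst_eq_0_iff[of x y] by (auto simp: irrefl_def)
  ultimately show ?thesis by simp
qed

lemma R_iff_dst: "x \<in> X \<Longrightarrow> y \<in> X \<Longrightarrow> (x, y) \<in> R \<longleftrightarrow> dst x y = 1"
  using dst_R relpow_gdist[OF conn, of x y] by fastforce

lemma dst_le_D: "x \<in> X \<Longrightarrow> y \<in> X \<Longrightarrow> dst x y \<le> D"
  unfolding gdiam_def
proof (rule Max_ge)
  have "{gdist R x y |x y. x \<in> X \<and> y \<in> X} = (\<lambda>(x, y). gdist R x y) ` (X \<times> X)" by auto
  then show "finite {gdist R x y |x y. x \<in> X \<and> y \<in> X}" by simp
qed auto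

text \<open>Cut a geodesic of length \<open>D\<close> after k steps.\<close>

lemma dst_exists:
  assumes "k \<le> D" obtains x y where "x \<in> X" "y \<in> X" "dst x y = k"
proof -
  have eq: "{gdist R x y |x y. x \<in> X \<and> y \<in> X} = (\<lambda>(x, y). gdist R x y) ` (X \<times> X)" by auto
  have "D \<in> {gdist R x y |x y. x \<in> X \<and> y \<in> X}"
    unfolding gdiam_def by (rule Max_in) (use X_ne in \<open>auto simp: eq\<close>)
  then obtain x y where xy: "x \<in> X" "y \<in> X" "dst x y = D" by auto
  have "(x, y) \<in> R ^^ (k + (D - k))" using relpow_gdist[OF conn, of x y] xy assms by simp
  then obtain z where z: "(x, z) \<in> R ^^ k" "(z, y) \<in> R ^^ (D - k)" by (auto simp: relpow_add)
  have zX: "z \<in> X"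
  proof (cases k)
    case 0 then show ?thesis using z xy by simp
  next
    case (Suc m) then show ?thesis using z R_sub by auto
  qed
  have "dst x z \<le> k" "dst z y \<le> D - k" using z by (auto intro: gdist_le)
  moreover have "D \<le> dst x z + dst z y" using dst_triangle[of x z y] xy zX by simp
  ultimately have "dst x z = k" using assms by simp
  then show ?thesis using that xy zX by blast
qed

text \<open>An element of the Bose--Mesner algebra is stored as a function of the distance instead
  of a coefficient vector, which makes differences and conjugates entrywise operations on f. Values
  of f beyond \<open>D\<close> have no influence.\<close>

definition bm :: "(nat \<Rightarrow> complex) \<Rightarrow> 'v cmatrix" where
  "bm f = (\<lambda>x y. if x \<in> X \<and> y \<in> X then f (dst x y) else 0)"

lemma bose_mesner_iff: "M \<in> bose_mesner X R \<longleftrightarrow> (\<exists>f. M = bm f)"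
proof -
  have "(\<lambda>x y. \<Sum>i\<le>D. t i * dist_matrix X R i x y) = bm t" for t
  proof (intro ext)
    fix x y
    have "(\<Sum>i\<le>D. t i * dist_matrix X R i x y)
        = (\<Sum>i\<le>D. if i = dst x y then (if x \<in> X \<and> y \<in> X then t i else 0) else 0)"
      by (intro sum.cong) (auto simp: dist_matrix_def)
    also have "\<dots> = bm t x y" using dst_le_D[of x y] by (auto simp: bm_def)
    finally show "(\<Sum>i\<le>D. t i * dist_matrix X R i x y) = bm t x y" .
  qed
  then show ?thesis unfolding bose_mesner_def by simp
qed

text \<open>The intersection numbers as a three-term recurrence for sums over a neighbourhood. At
  distance 0 the truncated \<open>dst x y - 1\<close> is 0 again, which is harmless because c 0 = 0.
  Since c k is nonzero for 0 < k \<le> D, the recurrence can be solved upwards.\<close>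

lemma nbr_sum:
  obtains a b c :: "nat \<Rightarrow> complex"
  where "c 0 = 0" "\<And>k. 0 < k \<Longrightarrow> k \<le> D \<Longrightarrow> c k \<noteq> 0"
    "\<And>f x y. x \<in> X \<Longrightarrow> y \<in> X \<Longrightarrow> (\<Sum>z | z \<in> X \<and> (y, z) \<in> R. f (dst x z)) =
       c (dst x y) * f (dst x y - 1) + a (dst x y) * f (dst x y) + b (dst x y) * f (dst x y + 1)"
proof -
  have "\<exists>b c :: nat \<Rightarrow> nat. \<forall>x\<in>X. \<forall>y\<in>X.
        card {z\<in>X. (y, z) \<in> R \<and> dst x z = dst x y + 1} = b (dst x y) \<and>
        card {z\<in>X. (y, z) \<in> R \<and> dst x z + 1 = dst x y} = c (dst x y)"
    using distance_regular by (simp add: distance_regular_def)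
  then obtain b c :: "nat \<Rightarrow> nat" where bc: "\<forall>x\<in>X. \<forall>y\<in>X.
        card {z\<in>X. (y, z) \<in> R \<and> dst x z = dst x y + 1} = b (dst x y) \<and>
        card {z\<in>X. (y, z) \<in> R \<and> dst x z + 1 = dst x y} = c (dst x y)"
    by (elim exE)
  note bc = bc[rule_format]
  have cpos: "c k \<noteq> 0" if "0 < k" "k \<le> D" for k
  proof -
    obtain x y where xy: "x \<in> X" "y \<in> X" "dst x y = k" using dst_exists \<open>k \<le> D\<close> by blast
    then have "(x, y) \<in> R ^^ k" using relpow_gdist[OF conn, of x y] by simp
    then have "(x, y) \<in> R ^^ Suc (k - 1)" using \<open>0 < k\<close> by simp
    then obtain z where z: "(x, z) \<in> R ^^ (k - 1)" "(z, y) \<in> R" by (rule relpow_Suc_E)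
    have zX: "z \<in> X" using z R_sub by auto
    have "dst x z \<le> k - 1" using z gdist_le by auto
    moreover have "k \<le> dst x z + 1" using dst_triangle[of x z y] xy zX z dst_R[of z y] by simp
    ultimately have "z \<in> {z\<in>X. (y, z) \<in> R \<and> gdist R x z + 1 = gdist R x y}"
      using z(2)[unfolded R_commute[of z y]] zX xy that by auto
    then have "card {z\<in>X. (y, z) \<in> R \<and> dst x z + 1 = dst x y} \<noteq> 0" by auto
    then have "c (dst x y) \<noteq> 0" using bc[OF xy(1,2)] by metis
    then show ?thesis unfolding xy(3) .
  qed
  have deg: "card {z\<in>X. (y, z) \<in> R} = b 0" if "y \<in> X" for y
  proof -
    have "{z\<in>X. (y, z) \<in> R \<and> gdist R y z = gdist R y y + 1} = {z\<in>X. (y, z) \<in> R}"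
      using dst_R by auto
    then show ?thesis using bc[OF that that] by simp
  qed
  \<comment> \<open>What remains of the valency b 0; taken in the complex numbers so that no
    truncated subtraction occurs.\<close>
  define a :: "nat \<Rightarrow> complex" where "a k = of_nat (b 0) - of_nat (b k) - of_nat (c k)" for k
  have main: "(\<Sum>z | z \<in> X \<and> (y, z) \<in> R. f (dst x z)) =
       of_nat (c (dst x y)) * f (dst x y - 1) + a (dst x y) * f (dst x y) + of_nat (b (dst x y)) * f (dst x y + 1)"
    if "x \<in> X" "y \<in> X" for x y and f :: "nat \<Rightarrow> complex"
  proof -
    define k where "k = dst x y"
    let ?N = "{z \<in> X. (y, z) \<in> R}"
    let ?C = "{z\<in>X. (y, z) \<in> R \<and> dst x z + 1 = k}"
    let ?B = "{z\<in>X. (y, z) \<in> R \<and> dst x z = k + 1}"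
    let ?A = "{z\<in>X. (y, z) \<in> R \<and> dst x z = k}"
    have near: "dst x z \<le> k + 1 \<and> k \<le> dst x z + 1" if "z \<in> X" "(y, z) \<in> R" for z
      using dst_triangle[OF \<open>x \<in> X\<close> \<open>y \<in> X\<close> that(1)] dst_triangle[OF \<open>x \<in> X\<close> that(1) \<open>y \<in> X\<close>]
        dst_R[OF that(2)] dst_commute[of y z] unfolding k_def by simp
    have "dst x z + 1 = k \<or> dst x z = k \<or> dst x z = k + 1" if "z \<in> X" "(y, z) \<in> R" for z
      using near[OF that] by linarith
    then have N: "?N = ?C \<union> (?A \<union> ?B)" by (intro equalityI subsetI) auto
    have d: "?C \<inter> (?A \<union> ?B) = {}" "?A \<inter> ?B = {}" by auto
    have cards: "card ?N = card ?C + (card ?A + card ?B)"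
      unfolding N using d by (simp add: card_Un_disjoint)
    have "(\<Sum>z\<in>?N. f (dst x z)) = (\<Sum>z\<in>?C. f (dst x z)) + ((\<Sum>z\<in>?A. f (dst x z)) + (\<Sum>z\<in>?B. f (dst x z)))"
      unfolding N using d by (simp add: sum.union_disjoint)
    also have "(\<Sum>z\<in>?C. f (dst x z)) = (\<Sum>z\<in>?C. f (k - 1))" by (intro sum.cong) auto
    also have "(\<Sum>z\<in>?A. f (dst x z)) = (\<Sum>z\<in>?A. f k)" by (intro sum.cong) auto
    also have "(\<Sum>z\<in>?B. f (dst x z)) = (\<Sum>z\<in>?B. f (k + 1))" by (intro sum.cong) auto
    finally have s: "(\<Sum>z\<in>?N. f (dst x z)) = card ?C * f (k - 1) + (card ?A * f k + card ?B * f (k + 1))"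
      by simp
    have cB: "card ?B = b k" and cC: "card ?C = c k" using bc[OF that] by (auto simp: k_def)
    have "b 0 = c k + (card ?A + b k)" using cards deg[OF that(2)] unfolding cB cC by metis
    then have "of_nat (b 0) = (of_nat (c k + (card ?A + b k)) :: complex)" by (rule arg_cong)
    then have "of_nat (card ?A) = a k" unfolding a_def by (simp add: algebra_simps)
    then show ?thesis using s unfolding cB cC k_def[symmetric] by (simp add: algebra_simps)
  qed
  have "c 0 = 0"
  proof -
    obtain x where "x \<in> X" using X_ne by blast
    then show ?thesis using bc[of x x] by simp
  qed
  then have "of_nat (c 0) = (0 :: complex)" by simp
  moreover have "0 < k \<Longrightarrow> k \<le> D \<Longrightarrow> of_nat (c k) \<noteq> (0 :: complex)" for k using cpos by simp
  ultimately show thesis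
    using main by (rule that[of "\<lambda>k. of_nat (c k)" a "\<lambda>k. of_nat (b k)"])
qed

text \<open>The sum is an entry of F A_j. The relation c (i+1) A_(i+1) = A_i A - a i A_i - b (i-1)
  A_(i-1) expresses it by products with smaller indices and one more sum over neighbours, so
  induction on j applies.\<close>

lemma bose_mesner_mult_aux:
  "\<exists>h. \<forall>x\<in>X. \<forall>y\<in>X. (\<Sum>z\<in>X. f (dst x z) * of_bool (dst z y = j)) = (h (dst x y) :: complex)"
proof -
  obtain a b c :: "nat \<Rightarrow> complex" where
    c0: "c 0 = 0" and cpos: "\<And>k. 0 < k \<Longrightarrow> k \<le> D \<Longrightarrow> c k \<noteq> 0" and
    nb: "\<And>f x y. x \<in> X \<Longrightarrow> y \<in> X \<Longrightarrow> (\<Sum>z | z \<in> X \<and> (y, z) \<in> R. f (dst x z)) =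
       c (dst x y) * f (dst x y - 1) + a (dst x y) * f (dst x y) + b (dst x y) * f (dst x y + 1)"
    by (rule nbr_sum) (rule that; (assumption | blast))
  define S where "S f j x y = (\<Sum>z\<in>X. f (dst x z) * of_bool (dst z y = j))"
    for f :: "nat \<Rightarrow> complex" and j :: nat and x y
  have one: "\<exists>h. \<forall>x\<in>X. \<forall>y\<in>X. (\<Sum>v | v \<in> X \<and> (y, v) \<in> R. g (dst x v)) = (h (dst x y) :: complex)" for g
    by (intro exI[of _ "\<lambda>k. c k * g (k - 1) + a k * g k + b k * g (k + 1)"] ballI nb)
  have "\<exists>h. \<forall>x\<in>X. \<forall>y\<in>X. S f j x y = h (dst x y)" for f
  proof (induction j rule: less_induct)
    case (less j)
    \<comment> \<open>A_0 is the identity and A_j is zero for j > D. The recurrence is used only for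
      0 < j \<le> D, where division by c j is possible.\<close>
    show ?case
    proof (cases "j = 0 \<or> j > D")
      case True
      show ?thesis
      proof (cases "j = 0")
        case True
        have "S f j x y = f (dst x y)" if "x \<in> X" "y \<in> X" for x y
        proof -
          have "S f j x y = (\<Sum>z\<in>X. if z = y then f (dst x z) else 0)"
            unfolding S_def using that True by (intro sum.cong) (auto simp: dst_eq_0_iff)
          then show ?thesis using that by simp
        qed
        then show ?thesis by blast
      next
        case False
        then have "j > D" using True by simp
        then have "S f j x y = 0" if "x \<in> X" "y \<in> X" for x y
          unfolding S_def using that by (intro sum.neutral) (auto dest: dst_le_D[of _ y])
        then show ?thesis by (intro exI[of _ "\<lambda>_. 0"]) blast
      qed
    next
      case False
      then obtain i where j: "j = Suc i" "Suc i \<le> D" by (cases j) auto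
      obtain h where h: "\<And>x y. x \<in> X \<Longrightarrow> y \<in> X \<Longrightarrow> S f i x y = h (dst x y)" using less[of i] j by blast
      obtain h1 where h1: "\<And>x y. x \<in> X \<Longrightarrow> y \<in> X \<Longrightarrow> (\<Sum>v | v \<in> X \<and> (y, v) \<in> R. h (dst x v)) = h1 (dst x y)"
        using one[of h] by blast
      have "\<exists>h2. \<forall>x\<in>X. \<forall>y\<in>X. (if i = 0 then 0 else S f (i - 1) x y) = h2 (dst x y)"
      proof (cases "i = 0")
        case True then show ?thesis by (intro exI[of _ "\<lambda>_. 0"]) simp
      next
        case False then show ?thesis using less[of "i - 1"] j by simp
      qed
      then obtain h2 where h2: "\<And>x y. x \<in> X \<Longrightarrow> y \<in> X \<Longrightarrow> (if i = 0 then 0 else S f (i - 1) x y) = h2 (dst x y)"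
        by blast
      have "S f j x y = (h1 (dst x y) - a i * h (dst x y) - b (i - 1) * h2 (dst x y)) / c j"
        if xy: "x \<in> X" "y \<in> X" for x y
      proof -
        \<comment> \<open>The entry at (z, y) of A_i A = c (i+1) A_(i+1) + a i A_i + b (i-1)
          A_(i-1).\<close>
        have pt: "(\<Sum>v | v \<in> X \<and> (y, v) \<in> R. of_bool (dst z v = i)) =
             c j * of_bool (dst z y = j) + a i * of_bool (dst z y = i)
             + (if i = 0 then 0 else b (i - 1) * (of_bool (dst z y = i - 1) :: complex))"
          if "z \<in> X" for z
        proof -
          consider "dst z y = Suc i" | "dst z y = i" | "Suc (dst z y) = i"
            | "dst z y \<noteq> Suc i \<and> dst z y \<noteq> i \<and> Suc (dst z y) \<noteq> i" by argo
          then show ?thesis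
            unfolding nb[OF that xy(2), of "\<lambda>k. of_bool (k = i)"]
          proof cases
            case 2
            then show "c (dst z y) * of_bool (dst z y - 1 = i) + a (dst z y) * of_bool (dst z y = i)
                + b (dst z y) * of_bool (dst z y + 1 = i) = c j * of_bool (dst z y = j) + a i * of_bool (dst z y = i)
             + (if i = 0 then 0 else b (i - 1) * (of_bool (dst z y = i - 1) :: complex))"
              using c0 j by (cases i) auto
          next
            case 4
            then show "c (dst z y) * of_bool (dst z y - 1 = i) + a (dst z y) * of_bool (dst z y = i)
                + b (dst z y) * of_bool (dst z y + 1 = i) = c j * of_bool (dst z y = j) + a i * of_bool (dst z y = i)
             + (if i = 0 then 0 else b (i - 1) * (of_bool (dst z y = i - 1) :: complex))"
              using c0 j by (cases "dst z y") auto
          qed (use j in auto)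
        qed
        have "(\<Sum>v | v \<in> X \<and> (y, v) \<in> R. h (dst x v)) = (\<Sum>v | v \<in> X \<and> (y, v) \<in> R. S f i x v)"
          by (intro sum.cong) (use h xy in auto)
        also have "\<dots> = (\<Sum>z\<in>X. f (dst x z) * (\<Sum>v | v \<in> X \<and> (y, v) \<in> R. of_bool (dst z v = i)))"
          unfolding S_def sum_distrib_left by (rule sum.swap)
        also have "\<dots> = (\<Sum>z\<in>X. f (dst x z) * (c j * of_bool (dst z y = j) + a i * of_bool (dst z y = i)
             + (if i = 0 then 0 else b (i - 1) * of_bool (dst z y = i - 1))))"
          by (intro sum.cong) (use pt in auto)
        also have "\<dots> = c j * S f j x y + a i * S f i x y + b (i - 1) * (if i = 0 then 0 else S f (i - 1) x y)"
          unfolding S_def sum_distrib_left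
          by (cases "i = 0") (simp_all add: sum.distrib sum_distrib_left algebra_simps
              del: sum_of_bool_mult_eq sum_mult_of_bool_eq of_bool_eq_iff)
        finally have "h1 (dst x y) = c j * S f j x y + a i * h (dst x y) + b (i - 1) * h2 (dst x y)"
          using h h1 h2 xy by simp
        moreover have "c j \<noteq> 0" using cpos j by simp
        ultimately show ?thesis by (simp add: field_simps)
      qed
      then show ?thesis by (intro exI[of _ "\<lambda>k. (h1 k - a i * h k - b (i - 1) * h2 k) / c j"]) blast
    qed
  qed
  then show ?thesis unfolding S_def by blast
qed


lemma bose_mesner_mult:
  assumes "F \<in> bose_mesner X R" "G \<in> bose_mesner X R"
  shows "mat_mult X F G \<in> bose_mesner X R"
proof -
  obtain f g where F: "F = bm f" and G: "G = bm g" using assms bose_mesner_iff by auto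
  have "\<forall>j. \<exists>h. \<forall>x\<in>X. \<forall>y\<in>X. (\<Sum>z\<in>X. f (dst x z) * of_bool (dst z y = j)) = h (dst x y)"
    using bose_mesner_mult_aux by blast
  then obtain h where h: "\<forall>j. \<forall>x\<in>X. \<forall>y\<in>X. (\<Sum>z\<in>X. f (dst x z) * of_bool (dst z y = j)) = h j (dst x y)"
    by (rule choice[THEN exE])
  have "mat_mult X F G = bm (\<lambda>k. \<Sum>j\<le>D. g j * h j k)"
  proof (intro ext)
    fix x y
    show "mat_mult X F G x y = bm (\<lambda>k. \<Sum>j\<le>D. g j * h j k) x y"
    proof (cases "x \<in> X \<and> y \<in> X")
      case True
      have "mat_mult X F G x y = (\<Sum>z\<in>X. f (dst x z) * g (dst z y))"
        unfolding mat_mult_def F G bm_def using True by simp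
      also have "\<dots> = (\<Sum>z\<in>X. \<Sum>j\<le>D. g j * (f (dst x z) * of_bool (dst z y = j)))"
      proof (intro sum.cong refl)
        fix z assume "z \<in> X"
        then have "dst z y \<le> D" using dst_le_D True by blast
        moreover have "(\<Sum>j\<le>D. g j * (f (dst x z) * of_bool (dst z y = j)))
            = (\<Sum>j\<le>D. if j = dst z y then g j * f (dst x z) else 0)"
          by (intro sum.cong) auto
        ultimately show "f (dst x z) * g (dst z y) = (\<Sum>j\<le>D. g j * (f (dst x z) * of_bool (dst z y = j)))"
          by simp
      qed
      also have "\<dots> = (\<Sum>j\<le>D. g j * (\<Sum>z\<in>X. f (dst x z) * of_bool (dst z y = j)))"
        unfolding sum_distrib_left by (rule sum.swap)
      also have "\<dots> = (\<Sum>j\<le>D. g j * h j (dst x y))"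
        by (intro sum.cong refl arg_cong2[of _ _ _ _ "(*)"]) (use h True in blast)
      finally show ?thesis using True by (simp add: bm_def)
    next
      case False
      then show ?thesis unfolding mat_mult_def F G bm_def by auto
    qed
  qed
  then show ?thesis using bose_mesner_iff by blast
qed

lemma bose_mesner_sym: "F \<in> bose_mesner X R \<Longrightarrow> F x y = F y x"
  unfolding bose_mesner_iff bm_def by (auto simp: dst_commute[of x y])

text \<open>All elements of the algebra are symmetric, the product included, and transposing a
  product exchanges its factors.\<close>

lemma bose_mesner_commute:
  assumes "F \<in> bose_mesner X R" "G \<in> bose_mesner X R"
  shows "mat_mult X F G = mat_mult X G F"
proof (intro ext)
  fix x y
  have "mat_mult X F G x y = mat_mult X F G y x"
    using bose_mesner_sym bose_mesner_mult assms by blast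
  also have "\<dots> = (\<Sum>z\<in>X. F z y * G x z)"
    unfolding mat_mult_def
    by (intro sum.cong refl arg_cong2[of _ _ _ _ "(*)"] bose_mesner_sym assms)
  also have "\<dots> = mat_mult X G F x y" by (simp add: mat_mult_def mult.commute)
  finally show "mat_mult X F G x y = mat_mult X G F x y" .
qed

section \<open>Primitive idempotents: orthogonality and real entries\<close>

lemma bose_mesner_diff:
  assumes "F \<in> bose_mesner X R" "G \<in> bose_mesner X R"
  shows "(\<lambda>x y. F x y - G x y) \<in> bose_mesner X R"
proof -
  obtain f g where F: "F = bm f" and G: "G = bm g" using assms bose_mesner_iff by auto
  have "(\<lambda>x y. F x y - G x y) = bm (\<lambda>k. f k - g k)" unfolding F G bm_def by (intro ext) auto
  then show ?thesis using bose_mesner_iff by blast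
qed

text \<open>Put P = FG. It is idempotent with FP = P = GP, so F = P + (F - P) and G = P + (G - P)
  are orthogonal decompositions. If P were nonzero, primitivity would give F = P = G.\<close>

lemma primitive_orthogonal:
  assumes F: "primitive_idempotent X R F" and G: "primitive_idempotent X R G" and ne: "F \<noteq> G"
  shows "mat_mult X F G = (\<lambda>x y. 0)"
proof -
  let ?P = "mat_mult X F G"
  have BM: "F \<in> bose_mesner X R" "G \<in> bose_mesner X R" and FF: "mat_mult X F F = F" and GG: "mat_mult X G G = G"
    using F G unfolding primitive_idempotent_def bm_idempotent_def by auto
  have PB: "?P \<in> bose_mesner X R" using BM bose_mesner_mult by blast
  have key: "?P = (\<lambda>x y. 0) \<or> H = ?P"
    if H: "primitive_idempotent X R H" and HP: "mat_mult X H ?P = ?P" for H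
  proof -
    have HB: "H \<in> bose_mesner X R" and HH: "mat_mult X H H = H"
      using H unfolding primitive_idempotent_def bm_idempotent_def by auto
    have PH: "mat_mult X ?P H = ?P" using bose_mesner_commute[OF HB PB] HP by simp
    have PP: "mat_mult X ?P ?P = ?P"
    proof -
      have "mat_mult X ?P ?P = mat_mult X F (mat_mult X (mat_mult X G F) G)" by (simp add: mat_mult_assoc)
      also have "\<dots> = mat_mult X F (mat_mult X (mat_mult X F G) G)" using bose_mesner_commute[OF BM] by simp
      also have "\<dots> = mat_mult X (mat_mult X F F) (mat_mult X G G)" by (simp add: mat_mult_assoc)
      finally show ?thesis using FF GG by simp
    qed
    let ?C = "\<lambda>x y. H x y - ?P x y"
    have C: "bm_idempotent X R ?C" unfolding bm_idempotent_def
      using bose_mesner_diff[OF HB PB] by (simp add: mat_mult_diff_right mat_mult_diff_left HH HP PH PP)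
    have "bm_idempotent X R ?P" using PB PP unfolding bm_idempotent_def by simp
    moreover have "mat_mult X ?P ?C = (\<lambda>x y. 0)" "mat_mult X ?C ?P = (\<lambda>x y. 0)"
      by (simp_all add: mat_mult_diff_right mat_mult_diff_left HP PH PP)
    moreover have "H = (\<lambda>x y. ?P x y + ?C x y)" by auto
    ultimately have "?P = (\<lambda>x y. 0) \<or> ?C = (\<lambda>x y. 0)"
      using H C unfolding primitive_idempotent_def by blast
    moreover have "H = ?P" if "?C = (\<lambda>x y. 0)"
      using that by (intro ext) (metis eq_iff_diff_eq_0)
    ultimately show ?thesis by blast
  qed
  have "mat_mult X F ?P = ?P" using FF by (simp add: mat_mult_assoc[symmetric])
  moreover have "mat_mult X G ?P = ?P"
    using bose_mesner_commute[OF BM] GG by (simp add: mat_mult_assoc[symmetric])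
  ultimately show ?thesis using key[OF F] key[OF G] ne by metis
qed

text \<open>Entrywise conjugation is a ring automorphism of the algebra, so it permutes the
  primitive idempotents.\<close>

lemma primitive_cnj:
  assumes F: "primitive_idempotent X R F" shows "primitive_idempotent X R (\<lambda>x y. cnj (F x y))"
proof -
  have BMc: "(\<lambda>x y. cnj (G x y)) \<in> bose_mesner X R" if GB: "G \<in> bose_mesner X R" for G
  proof -
    obtain g where G: "G = bm g" using GB unfolding bose_mesner_iff by blast
    have "(\<lambda>x y. cnj (G x y)) = bm (\<lambda>k. cnj (g k))" unfolding G bm_def by (intro ext) auto
    then show ?thesis using bose_mesner_iff by blast
  qed
  have mc: "mat_mult X (\<lambda>x y. cnj (G x y)) (\<lambda>x y. cnj (H x y)) = (\<lambda>x y. cnj (mat_mult X G H x y))" for G H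
    by (simp add: mat_mult_def)
  have Ic: "bm_idempotent X R (\<lambda>x y. cnj (G x y))" if "bm_idempotent X R G" for G
    using that BMc[of G] unfolding bm_idempotent_def mc by metis
  have zero: "(\<lambda>x y. cnj (G x y)) = (\<lambda>x y. 0) \<longleftrightarrow> G = (\<lambda>x y. 0)" for G :: "'v cmatrix"
    unfolding fun_eq_iff by simp
  show ?thesis unfolding primitive_idempotent_def
  proof (intro conjI allI impI)
    show "bm_idempotent X R (\<lambda>x y. cnj (F x y))" "(\<lambda>x y. cnj (F x y)) \<noteq> (\<lambda>x y. 0)"
      using F Ic zero unfolding primitive_idempotent_def by blast+
    fix G H assume *: "bm_idempotent X R G \<and> bm_idempotent X R H \<and>
        mat_mult X G H = (\<lambda>x y. 0) \<and> mat_mult X H G = (\<lambda>x y. 0) \<and>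
        (\<lambda>x y. cnj (F x y)) = (\<lambda>x y. G x y + H x y)"
    have "F = (\<lambda>x y. cnj (G x y) + cnj (H x y))"
    proof (intro ext)
      fix x y
      have "cnj (F x y) = G x y + H x y" using * by metis
      then show "F x y = cnj (G x y) + cnj (H x y)" by (metis complex_cnj_add complex_cnj_cnj)
    qed
    moreover have "mat_mult X (\<lambda>x y. cnj (G x y)) (\<lambda>x y. cnj (H x y)) = (\<lambda>x y. 0)"
      "mat_mult X (\<lambda>x y. cnj (H x y)) (\<lambda>x y. cnj (G x y)) = (\<lambda>x y. 0)"
      using * unfolding mc by simp_all
    ultimately have "(\<lambda>x y. cnj (G x y)) = (\<lambda>x y. 0) \<or> (\<lambda>x y. cnj (H x y)) = (\<lambda>x y. 0)"
      using F Ic * unfolding primitive_idempotent_def by blast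
    then show "G = (\<lambda>x y. 0) \<or> H = (\<lambda>x y. 0)" using zero by blast
  qed
qed

text \<open>F times its conjugate lies in the algebra and therefore has constant diagonal, whose
  entries are the squared norms of the rows. One zero row would make all rows zero.\<close>

lemma primitive_nonzero_diag:
  assumes "primitive_idempotent X R F" and "x \<in> X"
  shows "(\<Sum>z\<in>X. F x z * cnj (F x z)) \<noteq> 0"
proof
  obtain f where F: "F = bm f"
    using assms bose_mesner_iff unfolding primitive_idempotent_def bm_idempotent_def by auto
  assume "(\<Sum>z\<in>X. F x z * cnj (F x z)) = 0"
  then have z: "F x z = 0" if "z \<in> X" for z using that by (rule sum_mult_cnj_eq_0[OF finite_X])
  have BM: "F \<in> bose_mesner X R" and FF: "mat_mult X F F = F" and nz: "F \<noteq> (\<lambda>x y. 0)"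
    using assms unfolding primitive_idempotent_def bm_idempotent_def by auto
  obtain g where g: "mat_mult X F (\<lambda>x y. cnj (F x y)) = bm g"
    using bose_mesner_mult[OF BM] primitive_cnj[OF assms(1)] bose_mesner_iff
    unfolding primitive_idempotent_def bm_idempotent_def by blast
  have "mat_mult X F (\<lambda>x y. cnj (F x y)) x x = 0"
    unfolding mat_mult_def using z by simp
  then have g0: "g 0 = 0" using assms(2) unfolding g bm_def by simp
  have "F u v = 0" if "u \<in> X" "v \<in> X" for u v
  proof -
    have "(\<Sum>z\<in>X. F u z * cnj (F u z)) = mat_mult X F (\<lambda>x y. cnj (F x y)) u u"
      unfolding mat_mult_def
      by (intro sum.cong refl arg_cong2[of _ _ _ _ "(*)"] arg_cong[of _ _ cnj] bose_mesner_sym[OF BM])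
    also have "\<dots> = 0" unfolding g bm_def using g0 by simp
    finally have "(\<Sum>z\<in>X. F u z * cnj (F u z)) = 0" .
    then show ?thesis using that(2) by (rule sum_mult_cnj_eq_0[OF finite_X])
  qed
  then have "F = (\<lambda>x y. 0)" unfolding F bm_def by (intro ext) auto
  then show False using nz by blast
qed

text \<open>Otherwise F and its conjugate would be distinct primitive idempotents, hence orthogonal,
  although the diagonal of their product consists of squared row norms.\<close>

lemma primitive_real:
  assumes F: "primitive_idempotent X R F" shows "cnj (F x y) = F x y"
proof -
  have BM: "F \<in> bose_mesner X R" using F unfolding primitive_idempotent_def bm_idempotent_def by auto
  have "F = (\<lambda>x y. cnj (F x y))"
  proof (rule ccontr)
    assume "F \<noteq> (\<lambda>x y. cnj (F x y))"
    then have z: "mat_mult X F (\<lambda>x y. cnj (F x y)) = (\<lambda>x y. 0)"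
      by (rule primitive_orthogonal[OF F primitive_cnj[OF F]])
    obtain x where x: "x \<in> X" using X_ne by blast
    have "(\<Sum>z\<in>X. F x z * cnj (F x z)) = mat_mult X F (\<lambda>x y. cnj (F x y)) x x"
      unfolding mat_mult_def
      by (intro sum.cong refl arg_cong2[of _ _ _ _ "(*)"] arg_cong[of _ _ cnj] bose_mesner_sym[OF BM])
    then show False using primitive_nonzero_diag[OF F x] z by simp
  qed
  then show ?thesis by metis
qed

end

section \<open>Standard orderings\<close>

lemma qnum_of_nat: "qnum (of_nat l) k = of_nat (qnum l k)"
  by (simp add: qnum_def)

lemma qnum_0 [simp]: "qnum q 0 = 0" and qnum_Suc: "qnum q (Suc k) = qnum q k + q ^ k"
  by (simp_all add: qnum_def)

lemma qnum_add: "qnum q (i + j) = qnum q i + q ^ i * qnum q j"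
  by (induction j) (simp_all add: qnum_Suc power_add algebra_simps)

lemma qnum_pos: "0 < l \<Longrightarrow> 0 < k \<Longrightarrow> 0 < qnum (l :: nat) k"
  by (cases k) (simp_all add: qnum_Suc)

locale std_ordering = drg X R for X :: "'v set" and R +
  fixes E :: "nat \<Rightarrow> 'v cmatrix" and N :: nat
  assumes standard: "standard_ordering X R (of_nat N) E" and N_pos: "0 < N" and D_pos: "0 < gdiam X R"
begin

lemma E_primitive: "i \<le> D \<Longrightarrow> primitive_idempotent X R (E i)"
  and E_inj: "i \<le> D \<Longrightarrow> j \<le> D \<Longrightarrow> E i = E j \<Longrightarrow> i = j"
  and E_0: "E 0 = (\<lambda>x y. if x \<in> X \<and> y \<in> X then 1 / of_nat (card X) else 0)"
proof -
  have "bij_betw E {0..D} {M. primitive_idempotent X R M}"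
    using standard unfolding standard_ordering_def Q_polynomial_def by blast
  then have "inj_on E {0..D}" "E ` {0..D} = {M. primitive_idempotent X R M}"
    by (auto simp: bij_betw_def)
  then show "i \<le> D \<Longrightarrow> primitive_idempotent X R (E i)" "i \<le> D \<Longrightarrow> j \<le> D \<Longrightarrow> E i = E j \<Longrightarrow> i = j"
    by (auto simp: inj_on_def)
  show "E 0 = (\<lambda>x y. if x \<in> X \<and> y \<in> X then 1 / of_nat (card X) else 0)"
    using standard unfolding standard_ordering_def Q_polynomial_def by blast
qed

lemma E_BM: "i \<le> D \<Longrightarrow> E i \<in> bose_mesner X R"
  using E_primitive unfolding primitive_idempotent_def bm_idempotent_def by blast

lemma E_sym: "i \<le> D \<Longrightarrow> E i x y = E i y x"
  by (rule bose_mesner_sym[OF E_BM])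

lemma E_real: "i \<le> D \<Longrightarrow> cnj (E i x y) = E i x y"
  by (rule primitive_real[OF E_primitive])

lemma E_mult:
  assumes "i \<le> D" "j \<le> D"
  shows "(\<Sum>z\<in>X. E i x z * E j z y) = (if i = j then E i x y else 0)"
proof (cases "i = j")
  case True
  have "mat_mult X (E i) (E i) = E i"
    using E_primitive[OF assms(1)] unfolding primitive_idempotent_def bm_idempotent_def by blast
  from fun_cong[OF fun_cong[OF this, of x], of y] show ?thesis using True by (simp add: mat_mult_def)
next
  case False
  then have "mat_mult X (E i) (E j) = (\<lambda>x y. 0)"
    using primitive_orthogonal[OF E_primitive E_primitive] assms E_inj by blast
  from fun_cong[OF fun_cong[OF this, of x], of y] show ?thesis using False by (simp add: mat_mult_def)
qed

text \<open>The Q-polynomial relation in a form that treats the ends of the ordering like the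
  middle: the sum runs over those of i - 1, i, i + 1 that lie between 0 and
  \<open>D\<close>.\<close>

lemma E_recurrence:
  assumes "i \<le> D"
  obtains g where "\<And>x y. x \<in> X \<Longrightarrow> y \<in> X \<Longrightarrow>
    E 1 x y * E i x y = (\<Sum>k | k \<le> D \<and> k \<le> i + 1 \<and> i \<le> k + 1. g k * E k x y)"
proof -
  have "\<exists>a b c :: nat \<Rightarrow> complex.
        b D = 0 \<and> c 0 = 0 \<and>
        (\<forall>i\<in>{1..D}. b (i - 1) * c i \<noteq> 0) \<and>
        (\<forall>i\<in>{0..D}. \<forall>x\<in>X. \<forall>y\<in>X.
           E 1 x y * E i x y = 1 / of_nat (card X) *
             ((if i = 0 then 0 else b (i - 1) * E (i - 1) x y) + a i * E i x y +
              (if i = D then 0 else c (i + 1) * E (i + 1) x y)))"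
    using standard unfolding standard_ordering_def Q_polynomial_def by (elim conjE)
  then obtain a b c :: "nat \<Rightarrow> complex" where
    *: "\<forall>i\<in>{0..D}. \<forall>x\<in>X. \<forall>y\<in>X.
           E 1 x y * E i x y = 1 / of_nat (card X) *
             ((if i = 0 then 0 else b (i - 1) * E (i - 1) x y) + a i * E i x y +
              (if i = D then 0 else c (i + 1) * E (i + 1) x y))"
    by (elim exE conjE)
  define g where "g k = 1 / of_nat (card X) * (if k + 1 = i then b k else if k = i then a k else c k)" for k
  have S: "{k. k \<le> D \<and> k \<le> i + 1 \<and> i \<le> k + 1} =
     (if i = 0 then {} else {i - 1}) \<union> {i} \<union> (if i = D then {} else {i + 1})"
    using assms by auto
  show thesis
  proof (rule that)
    fix x y assume "x \<in> X" "y \<in> X"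
    then have e: "E 1 x y * E i x y = 1 / of_nat (card X) *
             ((if i = 0 then 0 else b (i - 1) * E (i - 1) x y) + a i * E i x y +
              (if i = D then 0 else c (i + 1) * E (i + 1) x y))" using * assms by simp
    show "E 1 x y * E i x y = (\<Sum>k | k \<le> D \<and> k \<le> i + 1 \<and> i \<le> k + 1. g k * E k x y)"
      unfolding S e
      by (cases "i = 0"; cases "i = D") (auto simp: g_def algebra_simps add_divide_distrib)
  qed
qed

definition \<theta> :: "nat \<Rightarrow> complex" where
  "\<theta> = (SOME \<theta>. (\<forall>x\<in>X. \<forall>y\<in>X. of_nat (card X) * E 1 x y = \<theta> (dst x y)) \<and>
        (\<exists>\<xi> \<zeta>. \<xi> \<noteq> 0 \<and> (\<forall>i\<le>D. \<theta> i = \<xi> * qnum (of_nat N) (D - i) + \<zeta>)))"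

lemma \<theta>_spec: "(\<forall>x\<in>X. \<forall>y\<in>X. of_nat (card X) * E 1 x y = \<theta> (dst x y)) \<and>
        (\<exists>\<xi> \<zeta>. \<xi> \<noteq> 0 \<and> (\<forall>i\<le>D. \<theta> i = \<xi> * qnum (of_nat N) (D - i) + \<zeta>))"
proof -
  from standard[unfolded standard_ordering_def, THEN conjunct2] obtain t where
    t: "(\<forall>x\<in>X. \<forall>y\<in>X. of_nat (card X) * E 1 x y = (\<Sum>i\<le>D. t i * dist_matrix X R i x y)) \<and>
     (\<exists>\<xi> \<zeta>. \<xi> \<noteq> 0 \<and> (\<forall>i\<le>D. t i = \<xi> * qnum (of_nat N) (D - i) + \<zeta>))"
    by (rule exE)
  have "(\<Sum>i\<le>D. t i * dist_matrix X R i x y) = t (dst x y)" if "x \<in> X" "y \<in> X" for x y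
  proof -
    have "(\<Sum>i\<le>D. t i * dist_matrix X R i x y) = (\<Sum>i\<le>D. if i = dst x y then t i else 0)"
      using that by (intro sum.cong) (auto simp: dist_matrix_def)
    then show ?thesis using dst_le_D[OF that] by simp
  qed
  then have "\<exists>t. (\<forall>x\<in>X. \<forall>y\<in>X. of_nat (card X) * E 1 x y = t (dst x y)) \<and>
        (\<exists>\<xi> \<zeta>. \<xi> \<noteq> 0 \<and> (\<forall>i\<le>D. t i = \<xi> * qnum (of_nat N) (D - i) + \<zeta>))"
    using t by (intro exI[of _ t]) simp
  from someI_ex[OF this] show ?thesis unfolding \<theta>_def .
qed

text \<open>Splitting [D - i] as [D - j] + N^(D-j) [j - i] cancels the additive constant of the
  standard ordering; \<xi> drops out of the ratios used later.\<close>

lemma \<theta>_diff: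
  obtains \<xi> where "\<xi> \<noteq> 0" "\<And>i j. i \<le> j \<Longrightarrow> j \<le> D \<Longrightarrow> \<theta> i - \<theta> j = \<xi> * of_nat (N ^ (D - j) * qnum N (j - i))"
proof -
  obtain \<xi> \<zeta> where *: "\<xi> \<noteq> 0" "\<forall>i\<le>D. \<theta> i = \<xi> * qnum (of_nat N) (D - i) + \<zeta>" using \<theta>_spec by blast
  have "\<theta> i - \<theta> j = \<xi> * of_nat (N ^ (D - j) * qnum N (j - i))" if "i \<le> j" "j \<le> D" for i j
  proof -
    have "D - i = (D - j) + (j - i)" using that by simp
    then have "qnum (of_nat N :: complex) (D - i) = qnum (of_nat N) (D - j) + of_nat N ^ (D - j) * qnum (of_nat N) (j - i)"
      by (simp only: qnum_add)
    then show ?thesis using *(2) that by (simp add: qnum_of_nat algebra_simps)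
  qed
  then show thesis using that *(1) by blast
qed

lemma \<theta>_ne: "i < j \<Longrightarrow> j \<le> D \<Longrightarrow> \<theta> i - \<theta> j \<noteq> 0"
proof -
  assume ij: "i < j" "j \<le> D"
  obtain \<xi> where "\<xi> \<noteq> 0" "\<And>i j. i \<le> j \<Longrightarrow> j \<le> D \<Longrightarrow> \<theta> i - \<theta> j = \<xi> * of_nat (N ^ (D - j) * qnum N (j - i))"
    using \<theta>_diff by blast
  moreover have "0 < N ^ (D - j) * qnum N (j - i)" using ij N_pos qnum_pos by simp
  ultimately show ?thesis using ij N_pos by simp
qed

section \<open>Entrywise polynomials in the first idempotent\<close>

definition in_span :: "nat \<Rightarrow> 'v cmatrix \<Rightarrow> bool" where
  "in_span m f \<longleftrightarrow> (\<exists>c. \<forall>x\<in>X. \<forall>y\<in>X. f x y = (\<Sum>k\<le>m. c k * E k x y))"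

lemma in_span_add: "in_span m f \<Longrightarrow> in_span m g \<Longrightarrow> in_span m (\<lambda>x y. f x y + g x y)"
proof -
  assume "in_span m f" "in_span m g"
  then obtain c d where "\<forall>x\<in>X. \<forall>y\<in>X. f x y = (\<Sum>k\<le>m. c k * E k x y)"
    "\<forall>x\<in>X. \<forall>y\<in>X. g x y = (\<Sum>k\<le>m. d k * E k x y)" unfolding in_span_def by blast
  then show ?thesis unfolding in_span_def
    by (intro exI[of _ "\<lambda>k. c k + d k"]) (simp add: algebra_simps sum.distrib)
qed

lemma in_span_scale: "in_span m f \<Longrightarrow> in_span m (\<lambda>x y. t * f x y)"
proof -
  assume "in_span m f"
  then obtain c where "\<forall>x\<in>X. \<forall>y\<in>X. f x y = (\<Sum>k\<le>m. c k * E k x y)" unfolding in_span_def by blast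
  then show ?thesis unfolding in_span_def
    by (intro exI[of _ "\<lambda>k. t * c k"]) (simp add: algebra_simps sum_distrib_left)
qed

lemma in_span_sum: "finite A \<Longrightarrow> (\<And>a. a \<in> A \<Longrightarrow> in_span m (f a)) \<Longrightarrow> in_span m (\<lambda>x y. \<Sum>a\<in>A. f a x y)"
proof (induction A rule: finite_induct)
  case empty
  show ?case unfolding in_span_def by (intro exI[of _ "\<lambda>_. 0"]) simp
next
  case (insert a A)
  then show ?case using in_span_add[of m "f a" "\<lambda>x y. \<Sum>a\<in>A. f a x y"] by simp
qed

lemma in_span_E: "k \<le> m \<Longrightarrow> in_span m (E k)"
  unfolding in_span_def
  by (intro exI[of _ "\<lambda>j. of_bool (j = k)"]) (simp add: Collect_conv_if lessThan_def atMost_def)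

lemma in_span_mono: assumes "in_span m f" "m \<le> n" shows "in_span n f"
proof -
  obtain c where c: "\<forall>x\<in>X. \<forall>y\<in>X. f x y = (\<Sum>k\<le>m. c k * E k x y)" using assms unfolding in_span_def by blast
  have "in_span n (\<lambda>x y. \<Sum>k\<le>m. c k * E k x y)"
    by (intro in_span_sum in_span_scale in_span_E) (use assms in auto)
  then show ?thesis using c unfolding in_span_def by simp
qed

lemma in_span_cong: "(\<And>x y. x \<in> X \<Longrightarrow> y \<in> X \<Longrightarrow> f x y = g x y) \<Longrightarrow> in_span m f \<longleftrightarrow> in_span m g"
  unfolding in_span_def by simp

lemma in_span_E1: assumes "in_span m f" "m < D" shows "in_span (m + 1) (\<lambda>x y. E 1 x y * f x y)"
proof -
  obtain c where c: "\<forall>x\<in>X. \<forall>y\<in>X. f x y = (\<Sum>k\<le>m. c k * E k x y)" using assms unfolding in_span_def by blast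
  have "in_span (m + 1) (\<lambda>x y. E 1 x y * E k x y)" if km: "k \<le> m" for k
  proof -
    obtain g where g: "\<And>x y. x \<in> X \<Longrightarrow> y \<in> X \<Longrightarrow>
      E 1 x y * E k x y = (\<Sum>j | j \<le> D \<and> j \<le> k + 1 \<and> k \<le> j + 1. g j * E j x y)"
      by (rule E_recurrence[of k]) (use km assms in auto)
    have "in_span (m + 1) (\<lambda>x y. \<Sum>j | j \<le> D \<and> j \<le> k + 1 \<and> k \<le> j + 1. g j * E j x y)"
      by (intro in_span_sum in_span_scale in_span_E) (use km in auto)
    then show ?thesis by (rule iffD1[OF in_span_cong, rotated]) (rule g[symmetric])
  qed
  then have "in_span (m + 1) (\<lambda>x y. \<Sum>k\<le>m. c k * (E 1 x y * E k x y))"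
    by (intro in_span_sum in_span_scale) auto
  then show ?thesis
    by (rule iffD1[OF in_span_cong, rotated]) (simp add: c sum_distrib_left algebra_simps)
qed

text \<open>By the three-term recurrence each factor raises the top index by at most one. The empty
  product starts the induction because \<open>E 0\<close> is a multiple of the all-ones
  matrix.\<close>

lemma in_span_prod: "m \<le> D \<Longrightarrow> in_span m (\<lambda>x y. \<Prod>j\<in>{1..m}. \<theta> (dst x y) - \<theta> j)"
proof (induction m)
  case 0
  have "in_span 0 (\<lambda>x y. of_nat (card X) * E 0 x y)" by (intro in_span_scale in_span_E) simp
  then show ?case by (rule iffD1[OF in_span_cong, rotated]) (simp add: E_0 X_ne)
next
  case (Suc m)
  let ?f = "\<lambda>x y. \<Prod>j\<in>{1..m}. \<theta> (dst x y) - \<theta> j"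
  have IH: "in_span m ?f" using Suc by simp
  have "in_span (m + 1) (\<lambda>x y. E 1 x y * ?f x y)" by (rule in_span_E1[OF IH]) (use Suc in simp)
  then have "in_span (m + 1) (\<lambda>x y. of_nat (card X) * (E 1 x y * ?f x y))" by (rule in_span_scale)
  moreover have "in_span (m + 1) (\<lambda>x y. - \<theta> (Suc m) * ?f x y)"
    by (intro in_span_scale in_span_mono[OF IH]) simp
  ultimately have "in_span (m + 1) (\<lambda>x y. of_nat (card X) * (E 1 x y * ?f x y) + - \<theta> (Suc m) * ?f x y)"
    by (rule in_span_add)
  then show ?case unfolding Suc_eq_plus1[symmetric]
  proof (rule iffD1[OF in_span_cong, rotated])
    fix x y assume "x \<in> X" "y \<in> X"
    then have "of_nat (card X) * E 1 x y = \<theta> (dst x y)" using \<theta>_spec by blast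
    then show "of_nat (card X) * (E 1 x y * ?f x y) + - \<theta> (Suc m) * ?f x y
        = (\<Prod>j\<in>{1..Suc m}. \<theta> (dst x y) - \<theta> j)"
      by (simp add: algebra_simps)
  qed
qed

text \<open>The definition of a Q-polynomial ordering lists the primitive idempotents without saying
  that they add up to the identity. The polynomial vanishing at \<theta> 1, ..., \<theta> D but not
  at \<theta> 0 writes the identity as a combination of the \<open>E k\<close>, and multiplying by
  \<open>E i\<close> shows that each coefficient is 1.\<close>

lemma E_complete: "x \<in> X \<Longrightarrow> y \<in> X \<Longrightarrow> (\<Sum>k\<le>D. E k x y) = of_bool (x = y)"
proof -
  define p where "p i = (\<Prod>j\<in>{1..D}. \<theta> i - \<theta> j)" for i
  have p0: "p 0 \<noteq> 0" unfolding p_def using \<theta>_ne[of 0] by simp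
  have pk: "p k = 0" if "0 < k" "k \<le> D" for k
    unfolding p_def using that by (intro prod_zero) auto
  have "in_span D (\<lambda>x y. 1 / p 0 * p (dst x y))" unfolding p_def by (intro in_span_scale in_span_prod) simp
  then obtain c where c: "\<forall>x\<in>X. \<forall>y\<in>X. 1 / p 0 * p (dst x y) = (\<Sum>k\<le>D. c k * E k x y)"
    unfolding in_span_def by blast
  have id: "(\<Sum>k\<le>D. c k * E k x y) = of_bool (x = y)" if "x \<in> X" "y \<in> X" for x y
  proof -
    have "1 / p 0 * p (dst x y) = of_bool (x = y)"
      using p0 pk[of "dst x y"] dst_le_D[OF that] dst_eq_0_iff[OF that] by (cases "x = y") auto
    then show ?thesis using c that by simp
  qed
  have "c i = 1" if i: "i \<le> D" for i
  proof -
    have "c i * E i x y = E i x y" if xy: "x \<in> X" "y \<in> X" for x y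
    proof -
      have "E i x y = (\<Sum>z\<in>X. E i x z * of_bool (z = y))" using xy by (simp add: if_distrib)
      also have "\<dots> = (\<Sum>z\<in>X. E i x z * (\<Sum>k\<le>D. c k * E k z y))" using id xy by simp
      also have "\<dots> = (\<Sum>z\<in>X. \<Sum>k\<le>D. c k * (E i x z * E k z y))" by (simp add: sum_distrib_left algebra_simps)
      also have "\<dots> = (\<Sum>k\<le>D. \<Sum>z\<in>X. c k * (E i x z * E k z y))" by (rule sum.swap)
      also have "\<dots> = (\<Sum>k\<le>D. c k * (if i = k then E i x y else 0))"
        by (intro sum.cong refl) (simp add: sum_distrib_left[symmetric] E_mult i)
      also have "\<dots> = c i * E i x y" using i by (simp add: if_distrib cong: if_cong)
      finally show ?thesis by simp
    qed
    moreover have "\<exists>x\<in>X. \<exists>y\<in>X. E i x y \<noteq> 0"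
    proof -
      obtain x where "x \<in> X" using X_ne by blast
      then have "(\<Sum>z\<in>X. E i x z * cnj (E i x z)) \<noteq> 0" using primitive_nonzero_diag E_primitive i by blast
      then obtain z where "z \<in> X" "E i x z * cnj (E i x z) \<noteq> 0" by (rule sum.not_neutral_contains_not_neutral)
      then show ?thesis using \<open>x \<in> X\<close> by auto
    qed
    ultimately show ?thesis by auto
  qed
  then show "x \<in> X \<Longrightarrow> y \<in> X \<Longrightarrow> (\<Sum>k\<le>D. E k x y) = of_bool (x = y)" using id by simp
qed


text \<open>The triple products are real, and their squares add up to the trace of the matrix product of
  \<open>E j\<close> with the entrywise product of \<open>E 1\<close> and \<open>E i\<close>, which is zero by the recurrence.\<close>

lemma E_triple_zero:
  assumes ij: "i \<le> D" "j \<le> D" "i + 1 < j" and xs: "a \<in> X" "x \<in> X" "y \<in> X"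
  shows "(\<Sum>z\<in>X. E j a z * E 1 x z * E i z y) = 0"
proof -
  define T where "T a x y = (\<Sum>z\<in>X. E j a z * E 1 x z * E i z y)" for a x y
  have one: "1 \<le> D" using D_pos by simp
  have Tr: "cnj (T a x y) = T a x y" for a x y
    unfolding T_def using E_real ij one by simp
  have col: "(\<Sum>u\<in>X. E k u z * E k u v) = E k z v" if "k \<le> D" for k z v
    using E_mult[OF that that, of z v] E_sym[OF that] by (metis (no_types, lifting) sum.cong)
  have col': "(\<Sum>u\<in>X. E k z u * E k v u) = E k z v" if "k \<le> D" for k z v
    using E_mult[OF that that, of z v] E_sym[OF that] by (metis (no_types, lifting) sum.cong)
  \<comment> \<open>The sums are reordered so that y, x and a are summed out in turn, each by
    idempotence. An entrywise triple product summed over z and v is left.\<close>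
  have "(\<Sum>a\<in>X. \<Sum>x\<in>X. \<Sum>y\<in>X. T a x y * T a x y)
     = (\<Sum>a\<in>X. \<Sum>x\<in>X. \<Sum>y\<in>X. \<Sum>z\<in>X. \<Sum>v\<in>X. (E j a z * E j a v) * (E 1 x z * E 1 x v) * (E i z y * E i v y))"
    unfolding T_def sum_product by (intro sum.cong refl) (simp add: algebra_simps)
  also have "\<dots> = (\<Sum>a\<in>X. \<Sum>x\<in>X. \<Sum>z\<in>X. \<Sum>y\<in>X. \<Sum>v\<in>X. (E j a z * E j a v) * (E 1 x z * E 1 x v) * (E i z y * E i v y))"
    by (rule sum.cong[OF refl], rule sum.cong[OF refl], rule sum.swap)
  also have "\<dots> = (\<Sum>a\<in>X. \<Sum>x\<in>X. \<Sum>z\<in>X. \<Sum>v\<in>X. \<Sum>y\<in>X. (E j a z * E j a v) * (E 1 x z * E 1 x v) * (E i z y * E i v y))"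
    by (rule sum.cong[OF refl], rule sum.cong[OF refl], rule sum.cong[OF refl], rule sum.swap)
  also have "\<dots> = (\<Sum>a\<in>X. \<Sum>x\<in>X. \<Sum>z\<in>X. \<Sum>v\<in>X. (E j a z * E j a v) * (E 1 x z * E 1 x v) * E i z v)"
    by (simp only: sum_distrib_left[symmetric] col'[OF ij(1)])
  also have "\<dots> = (\<Sum>a\<in>X. \<Sum>z\<in>X. \<Sum>x\<in>X. \<Sum>v\<in>X. (E j a z * E j a v) * (E 1 x z * E 1 x v) * E i z v)"
    by (rule sum.cong[OF refl], rule sum.swap)
  also have "\<dots> = (\<Sum>a\<in>X. \<Sum>z\<in>X. \<Sum>v\<in>X. \<Sum>x\<in>X. (E j a z * E j a v) * (E 1 x z * E 1 x v) * E i z v)"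
    by (rule sum.cong[OF refl], rule sum.cong[OF refl], rule sum.swap)
  also have "\<dots> = (\<Sum>a\<in>X. \<Sum>z\<in>X. \<Sum>v\<in>X. (E j a z * E j a v) * E 1 z v * E i z v)"
    by (simp only: sum_distrib_left[symmetric] sum_distrib_right[symmetric] col[OF one])
  also have "\<dots> = (\<Sum>z\<in>X. \<Sum>a\<in>X. \<Sum>v\<in>X. (E j a z * E j a v) * E 1 z v * E i z v)"
    by (rule sum.swap)
  also have "\<dots> = (\<Sum>z\<in>X. \<Sum>v\<in>X. \<Sum>a\<in>X. (E j a z * E j a v) * E 1 z v * E i z v)"
    by (rule sum.cong[OF refl], rule sum.swap)
  also have "\<dots> = (\<Sum>z\<in>X. \<Sum>v\<in>X. E j z v * E 1 z v * E i z v)"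
    by (simp only: sum_distrib_right[symmetric] col[OF ij(2)])
  also have "\<dots> = 0"
  proof (rule sum.neutral, rule ballI)
    fix z assume z: "z \<in> X"
    obtain g where g: "\<And>x y. x \<in> X \<Longrightarrow> y \<in> X \<Longrightarrow>
      E 1 x y * E i x y = (\<Sum>k | k \<le> D \<and> k \<le> i + 1 \<and> i \<le> k + 1. g k * E k x y)"
      by (rule E_recurrence[OF ij(1)]) (rule that; (assumption | blast))
    have "(\<Sum>v\<in>X. E j z v * E 1 z v * E i z v)
       = (\<Sum>v\<in>X. \<Sum>k | k \<le> D \<and> k \<le> i + 1 \<and> i \<le> k + 1. g k * (E j z v * E k v z))"
    proof (intro sum.cong refl)
      fix v assume "v \<in> X"
      have "E j z v * E 1 z v * E i z v = E j z v * (\<Sum>k | k \<le> D \<and> k \<le> i + 1 \<and> i \<le> k + 1. g k * E k z v)"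
        using g[OF z \<open>v \<in> X\<close>] by simp
      also have "\<dots> = (\<Sum>k | k \<le> D \<and> k \<le> i + 1 \<and> i \<le> k + 1. g k * (E j z v * E k v z))"
        unfolding sum_distrib_left by (intro sum.cong refl) (simp add: E_sym[of _ z v])
      finally show "E j z v * E 1 z v * E i z v = (\<Sum>k | k \<le> D \<and> k \<le> i + 1 \<and> i \<le> k + 1. g k * (E j z v * E k v z))" .
    qed
    also have "\<dots> = (\<Sum>k | k \<le> D \<and> k \<le> i + 1 \<and> i \<le> k + 1. \<Sum>v\<in>X. g k * (E j z v * E k v z))"
      by (rule sum.swap)
    also have "\<dots> = 0"
      by (rule sum.neutral) (use ij in \<open>auto simp: sum_distrib_left[symmetric] E_mult\<close>)
    finally show "(\<Sum>v\<in>X. E j z v * E 1 z v * E i z v) = 0" .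
  qed
  finally have "(\<Sum>p\<in>X \<times> X \<times> X. T (fst p) (fst (snd p)) (snd (snd p)) * cnj (T (fst p) (fst (snd p)) (snd (snd p)))) = 0"
    by (simp add: sum.cartesian_product' Tr)
  then have "T (fst (a, x, y)) (fst (snd (a, x, y))) (snd (snd (a, x, y))) = 0"
    by (rule sum_mult_cnj_eq_0[rotated]) (use xs in auto)
  then show ?thesis unfolding T_def by simp
qed

text \<open>By \<open>E_complete\<close>, f is a combination of columns of the \<open>E i\<close>
  with i \<le> k. Multiplication by \<open>\<theta> (dst x z)\<close>, a multiple of
  \<open>E 1 x z\<close>, turns every term into a triple product to which
  \<open>E_triple_zero\<close> applies.\<close>

lemma E_shift:
  assumes f: "\<And>j a. k < j \<Longrightarrow> j \<le> D \<Longrightarrow> a \<in> X \<Longrightarrow> (\<Sum>z\<in>X. E j a z * f z) = 0"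
    and x: "x \<in> X" and j: "k + 1 < j" "j \<le> D" and a: "a \<in> X"
  shows "(\<Sum>z\<in>X. E j a z * ((\<theta> (dst x z) - t) * f z)) = 0"
proof -
  have fz: "f z = (\<Sum>i\<le>k. \<Sum>y\<in>X. E i z y * f y)" if z: "z \<in> X" for z
  proof -
    have "f z = (\<Sum>y\<in>X. of_bool (z = y) * f y)" using z by simp
    also have "\<dots> = (\<Sum>y\<in>X. (\<Sum>i\<le>D. E i z y) * f y)" using E_complete[OF z] by simp
    also have "\<dots> = (\<Sum>i\<le>D. \<Sum>y\<in>X. E i z y * f y)" unfolding sum_distrib_right by (rule sum.swap)
    also have "\<dots> = (\<Sum>i\<le>k. \<Sum>y\<in>X. E i z y * f y)"
      by (rule sum.mono_neutral_right) (use f z j in auto)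
    finally show ?thesis .
  qed
  have "(\<Sum>z\<in>X. E j a z * E 1 x z * f z) = (\<Sum>z\<in>X. \<Sum>i\<le>k. \<Sum>y\<in>X. (E j a z * E 1 x z * E i z y) * f y)"
  proof (intro sum.cong refl)
    fix z assume "z \<in> X"
    show "E j a z * E 1 x z * f z = (\<Sum>i\<le>k. \<Sum>y\<in>X. (E j a z * E 1 x z * E i z y) * f y)"
      by (subst fz[OF \<open>z \<in> X\<close>]) (simp add: sum_distrib_left mult.assoc)
  qed
  also have "\<dots> = (\<Sum>i\<le>k. \<Sum>z\<in>X. \<Sum>y\<in>X. (E j a z * E 1 x z * E i z y) * f y)" by (rule sum.swap)
  also have "\<dots> = (\<Sum>i\<le>k. \<Sum>y\<in>X. \<Sum>z\<in>X. (E j a z * E 1 x z * E i z y) * f y)"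
    by (rule sum.cong[OF refl], rule sum.swap)
  also have "\<dots> = 0"
  proof (rule sum.neutral, rule ballI, rule sum.neutral, rule ballI)
    fix i y assume "i \<in> {..k}" "y \<in> X"
    then have "(\<Sum>z\<in>X. E j a z * E 1 x z * E i z y) = 0" using j a x by (intro E_triple_zero) auto
    then show "(\<Sum>z\<in>X. E j a z * E 1 x z * E i z y * f y) = 0"
      by (simp only: sum_distrib_right[symmetric] mult_zero_left)
  qed
  finally have e1: "(\<Sum>z\<in>X. E j a z * E 1 x z * f z) = 0" .
  have "(\<Sum>z\<in>X. E j a z * ((\<theta> (dst x z) - t) * f z))
      = (\<Sum>z\<in>X. of_nat (card X) * (E j a z * E 1 x z * f z) - t * (E j a z * f z))"
  proof (intro sum.cong refl)
    fix z assume "z \<in> X"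
    then have "\<theta> (dst x z) = of_nat (card X) * E 1 x z" using \<theta>_spec x by simp
    then show "E j a z * ((\<theta> (dst x z) - t) * f z) = of_nat (card X) * (E j a z * E 1 x z * f z) - t * (E j a z * f z)"
      by (simp add: algebra_simps)
  qed
  also have "\<dots> = of_nat (card X) * (\<Sum>z\<in>X. E j a z * E 1 x z * f z) - t * (\<Sum>z\<in>X. E j a z * f z)"
    by (simp only: sum_subtractf sum_distrib_left)
  also have "\<dots> = 0" using e1 f[of j a] j a by simp
  finally show ?thesis .
qed

lemma E_shift_prod:
  assumes f: "\<And>j a. k < j \<Longrightarrow> j \<le> D \<Longrightarrow> a \<in> X \<Longrightarrow> (\<Sum>z\<in>X. E j a z * f z) = 0" and x: "x \<in> X"
  shows "k + m < j \<Longrightarrow> j \<le> D \<Longrightarrow> a \<in> X \<Longrightarrow>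
    (\<Sum>z\<in>X. E j a z * ((\<Prod>i\<in>{2..<2 + m}. \<theta> (dst x z) - \<theta> i) * f z)) = 0"
proof (induction m arbitrary: j a)
  case 0
  then show ?case using f by simp
next
  case (Suc m)
  have "(\<Sum>z\<in>X. E j a z * ((\<theta> (dst x z) - \<theta> (2 + m)) * ((\<Prod>i\<in>{2..<2 + m}. \<theta> (dst x z) - \<theta> i) * f z))) = 0"
    using Suc by (intro E_shift[of "k + m"]) (auto simp: x)
  then show ?case by (simp add: algebra_simps)
qed

text \<open>The quotient of the factors at i is [i] / [i - 1], and the product over i = 2, ..., w
  telescopes.\<close>

lemma \<theta>_prod_ratio:
  assumes "1 \<le> w" "w \<le> D"
  shows "(\<Prod>i\<in>{2..<w + 1}. \<theta> 0 - \<theta> i) = of_nat (qnum N w) * (\<Prod>i\<in>{2..<w + 1}. \<theta> 1 - \<theta> i)"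
proof -
  obtain \<xi> where *: "\<xi> \<noteq> 0" "\<And>i j. i \<le> j \<Longrightarrow> j \<le> D \<Longrightarrow> \<theta> i - \<theta> j = \<xi> * of_nat (N ^ (D - j) * qnum N (j - i))"
    using \<theta>_diff by blast
  show ?thesis using assms
  proof (induction w rule: nat_induct_at_least)
    case base
    show ?case by (simp add: qnum_def)
  next
    case (Suc w)
    have e: "of_nat (qnum N w) * (\<theta> 0 - \<theta> (Suc w)) = of_nat (qnum N (Suc w)) * (\<theta> 1 - \<theta> (Suc w))"
      using *(2)[of 0 "Suc w"] *(2)[of 1 "Suc w"] Suc by simp
    have IH: "(\<Prod>i\<in>{2..<w + 1}. \<theta> 0 - \<theta> i) = of_nat (qnum N w) * (\<Prod>i\<in>{2..<w + 1}. \<theta> 1 - \<theta> i)"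
      by (rule Suc.IH) (use Suc.prems in simp)
    have s: "{2..<Suc w + 1} = insert (Suc w) {2..<w + 1}" using Suc(1) by auto
    have "(\<Prod>i\<in>{2..<Suc w + 1}. \<theta> 0 - \<theta> i) = (\<theta> 0 - \<theta> (Suc w)) * (of_nat (qnum N w) * (\<Prod>i\<in>{2..<w + 1}. \<theta> 1 - \<theta> i))"
      unfolding s IH[symmetric] by (subst prod.insert) auto
    also have "\<dots> = (of_nat (qnum N w) * (\<theta> 0 - \<theta> (Suc w))) * (\<Prod>i\<in>{2..<w + 1}. \<theta> 1 - \<theta> i)" by (simp only: mult_ac)
    also have "\<dots> = of_nat (qnum N (Suc w)) * ((\<theta> 1 - \<theta> (Suc w)) * (\<Prod>i\<in>{2..<w + 1}. \<theta> 1 - \<theta> i))"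
      unfolding e by (simp only: mult_ac)
    also have "(\<theta> 1 - \<theta> (Suc w)) * (\<Prod>i\<in>{2..<w + 1}. \<theta> 1 - \<theta> i) = (\<Prod>i\<in>{2..<Suc w + 1}. \<theta> 1 - \<theta> i)"
      unfolding s by (subst prod.insert) auto
    finally show ?case .
  qed
qed

text \<open>\<open>E i\<close> is a real symmetric idempotent, so the form is the squared norm of
  \<open>E i\<close> applied to the characteristic vector. A vanishing form thus annihilates a whole
  vector.\<close>

lemma char_form_E:
  assumes i: "i \<le> D" and Y: "Y \<subseteq> X"
  shows "char_form X (E i) Y = (\<Sum>a\<in>X. (\<Sum>z\<in>Y. E i a z) * cnj (\<Sum>z\<in>Y. E i a z))"
proof -
  have "char_form X (E i) Y = (\<Sum>x\<in>Y. \<Sum>y\<in>Y. E i x y)" by (rule char_form_subset[OF finite_X Y])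
  also have "\<dots> = (\<Sum>x\<in>Y. \<Sum>y\<in>Y. \<Sum>a\<in>X. E i x a * E i a y)"
    by (simp add: E_mult i)
  also have "\<dots> = (\<Sum>x\<in>Y. \<Sum>a\<in>X. \<Sum>y\<in>Y. E i x a * E i a y)"
    by (rule sum.cong[OF refl], rule sum.swap)
  also have "\<dots> = (\<Sum>a\<in>X. \<Sum>x\<in>Y. \<Sum>y\<in>Y. E i x a * E i a y)" by (rule sum.swap)
  also have "\<dots> = (\<Sum>a\<in>X. (\<Sum>z\<in>Y. E i a z) * cnj (\<Sum>z\<in>Y. E i a z))"
    by (simp only: sum_product E_sym[OF i, of _ "_ :: 'v"] cnj_sum E_real[OF i])
  finally show ?thesis .
qed

lemma char_form_E_zero:
  assumes i: "i \<le> D" and Y: "Y \<subseteq> X" and z: "char_form X (E i) Y = 0" and a: "a \<in> X"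
  shows "(\<Sum>z\<in>Y. E i a z) = 0"
  using sum_mult_cnj_eq_0[OF finite_X z[unfolded char_form_E[OF i Y]] a] .

lemma E_neighbour_sum:
  assumes Y: "Y \<subseteq> X" and wd: "\<And>x y. x \<in> Y \<Longrightarrow> y \<in> Y \<Longrightarrow> dst x y \<le> w" and w: "1 \<le> w" "w \<le> D"
    and dual: "\<And>j. D - w < j \<Longrightarrow> j \<le> D \<Longrightarrow> char_form X (E j) Y = 0"
    and x: "x \<in> Y" and y: "y \<in> X"
  shows "(\<Sum>z | z \<in> Y \<and> (x, z) \<in> R. E D y z) = - of_nat (qnum N w) * E D y x"
proof -
  have fY: "finite Y" by (rule finite_subset[OF Y finite_X])
  have xX: "x \<in> X" using x Y by auto
  define f :: "'v \<Rightarrow> complex" where "f z = of_bool (z \<in> Y)" for z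
  \<comment> \<open>Orthogonality beyond D - w becomes orthogonality beyond D - w + (w - 1) = D - 1,
    so that \<open>E D\<close> is just kept; one more factor would lose it.\<close>
  define p where "p i = (\<Prod>j\<in>{2..<2 + (w - 1)}. \<theta> i - \<theta> j)" for i
  have "(\<Sum>z\<in>X. E D y z * (p (dst x z) * f z)) = 0" unfolding p_def
  proof (rule E_shift_prod[of "D - w"])
    fix j a assume "D - w < j" "j \<le> D" "a \<in> X"
    then show "(\<Sum>z\<in>X. E j a z * f z) = 0"
      using char_form_E_zero[OF _ Y dual] Y unfolding f_def by (simp add: Int_absorb1)
  qed (use xX y w in auto)
  moreover have "(\<Sum>z\<in>X. E D y z * (p (dst x z) * f z)) = (\<Sum>z\<in>Y. E D y z * p (dst x z))"
  proof -
    have "(\<Sum>z\<in>X. E D y z * (p (dst x z) * f z)) = (\<Sum>z\<in>X. (E D y z * p (dst x z)) * of_bool (z \<in> Y))"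
      unfolding f_def by (simp only: mult.assoc)
    then show ?thesis using Y by (simp add: Int_absorb1)
  qed
  ultimately have s0: "(\<Sum>z\<in>Y. E D y z * p (dst x z)) = 0" by simp
  have p0: "p i = 0" if "2 \<le> i" "i \<le> w" for i
    unfolding p_def by (rule prod_zero) (use that in auto)
  have "(\<Sum>z\<in>Y. E D y z * p (dst x z)) = (\<Sum>z\<in>insert x {z. z \<in> Y \<and> (x, z) \<in> R}. E D y z * p (dst x z))"
  proof (rule sum.mono_neutral_right)
    show "\<forall>z\<in>Y - insert x {z. z \<in> Y \<and> (x, z) \<in> R}. E D y z * p (dst x z) = 0"
    proof
      fix z assume z: "z \<in> Y - insert x {z. z \<in> Y \<and> (x, z) \<in> R}"
      then have "z \<in> X" "dst x z \<noteq> 0" "dst x z \<noteq> 1" "dst x z \<le> w"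
        using Y xX dst_eq_0_iff[of x z] R_iff_dst[of x z] wd x by auto
      then show "E D y z * p (dst x z) = 0" using p0[of "dst x z"] by simp
    qed
  qed (use fY x in auto)
  also have "\<dots> = E D y x * p 0 + (\<Sum>z | z \<in> Y \<and> (x, z) \<in> R. E D y z * p (dst x z))"
    using fY irrefl_R by (subst sum.insert) (auto simp: irrefl_def)
  also have "(\<Sum>z | z \<in> Y \<and> (x, z) \<in> R. E D y z * p (dst x z)) = (\<Sum>z | z \<in> Y \<and> (x, z) \<in> R. E D y z) * p 1"
    unfolding sum_distrib_right by (intro sum.cong refl) (auto dest: dst_R)
  finally have s1: "E D y x * p 0 + (\<Sum>z | z \<in> Y \<and> (x, z) \<in> R. E D y z) * p 1 = 0" using s0 by simp
  have ee: "{2..<2 + (w - 1)} = {2..<w + 1}" using w by simp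
  have r: "p 0 = of_nat (qnum N w) * p 1" unfolding p_def ee by (rule \<theta>_prod_ratio[OF w])
  have "p 1 \<noteq> 0" unfolding p_def using \<theta>_ne[of 1] w by auto
  moreover have "(E D y x * of_nat (qnum N w) + (\<Sum>z | z \<in> Y \<and> (x, z) \<in> R. E D y z)) * p 1 = 0"
    using s1 unfolding r by (simp add: algebra_simps)
  ultimately have "E D y x * of_nat (qnum N w) + (\<Sum>z | z \<in> Y \<and> (x, z) \<in> R. E D y z) = 0" by simp
  then show ?thesis by (simp add: algebra_simps add_eq_0_iff)
qed

text \<open>The cosine sequence of the last idempotent.\<close>

definition \<sigma> :: "nat \<Rightarrow> real" where
  "\<sigma> = (SOME s. s 0 = 1 \<and> (\<exists>e. e \<noteq> 0 \<and> (\<forall>x\<in>X. \<forall>y\<in>X. E D x y = e * of_real (s (dst x y)))))"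

text \<open>The diagonal entry of \<open>E D\<close> is the squared norm of a row, hence nonzero,
  and serves as the normalising factor e. The quotients are real because the entries are.\<close>

lemma \<sigma>_spec: "\<sigma> 0 = 1 \<and> (\<exists>e. e \<noteq> 0 \<and> (\<forall>x\<in>X. \<forall>y\<in>X. E D x y = e * of_real (\<sigma> (dst x y))))"
proof -
  obtain f where f: "E D = bm f" using E_BM[of D] bose_mesner_iff by auto
  have val: "E D x y = f (dst x y)" if "x \<in> X" "y \<in> X" for x y using that by (simp add: f bm_def)
  have re: "cnj (f k) = f k" if k: "k \<le> D" for k
  proof -
    obtain x y where "x \<in> X" "y \<in> X" "dst x y = k" by (rule dst_exists[OF k])
    then show ?thesis using E_real[of D x y] val[of x y] by simp
  qed
  obtain x where x: "x \<in> X" using X_ne by blast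
  have "(\<Sum>z\<in>X. E D x z * cnj (E D x z)) = (\<Sum>z\<in>X. E D x z * E D z x)"
    by (intro sum.cong refl) (simp add: E_real E_sym[of D x])
  also have "\<dots> = E D x x" by (simp add: E_mult)
  finally have f0: "f 0 \<noteq> 0" using primitive_nonzero_diag[OF E_primitive[of D] x] val[OF x x] by simp
  have "E D u v = f 0 * of_real (Re (f (dst u v) / f 0))" if "u \<in> X" "v \<in> X" for u v
  proof -
    have "cnj (f (dst u v) / f 0) = f (dst u v) / f 0" using re dst_le_D[OF that] by simp
    then have "of_real (Re (f (dst u v) / f 0)) = f (dst u v) / f 0"
      by (metis Reals_cnj_iff of_real_Re)
    then show ?thesis using val[OF that] f0 by simp
  qed
  then have "\<exists>s. s 0 = (1 :: real) \<and> (\<exists>e. e \<noteq> 0 \<and> (\<forall>x\<in>X. \<forall>y\<in>X. E D x y = e * of_real (s (dst x y))))"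
    using f0 by (intro exI[of _ "\<lambda>k. Re (f k / f 0)"]) (auto intro!: exI[of _ "f 0"])
  from someI_ex[OF this] show ?thesis unfolding \<sigma>_def .
qed

lemma \<sigma>_0 [simp]: "\<sigma> 0 = 1" using \<sigma>_spec by blast

lemma \<sigma>_neighbour_sum:
  assumes Y: "Y \<subseteq> X" and wd: "\<And>x y. x \<in> Y \<Longrightarrow> y \<in> Y \<Longrightarrow> dst x y \<le> w" and w: "1 \<le> w" "w \<le> D"
    and dual: "\<And>j. D - w < j \<Longrightarrow> j \<le> D \<Longrightarrow> char_form X (E j) Y = 0"
    and x: "x \<in> Y" and y: "y \<in> X"
  shows "(\<Sum>z | z \<in> Y \<and> (x, z) \<in> R. \<sigma> (dst y z)) = - real (qnum N w) * \<sigma> (dst y x)"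
proof -
  obtain e where e: "e \<noteq> 0" "\<And>x y. x \<in> X \<Longrightarrow> y \<in> X \<Longrightarrow> E D x y = e * of_real (\<sigma> (dst x y))" using \<sigma>_spec by blast
  have "(\<Sum>z | z \<in> Y \<and> (x, z) \<in> R. E D y z) = - of_nat (qnum N w) * E D y x"
    by (rule E_neighbour_sum[OF Y wd w dual x y])
  moreover have "(\<Sum>z | z \<in> Y \<and> (x, z) \<in> R. E D y z) = (\<Sum>z | z \<in> Y \<and> (x, z) \<in> R. e * of_real (\<sigma> (dst y z)))"
    by (intro sum.cong refl e) (use Y y in auto)
  moreover have "E D y x = e * of_real (\<sigma> (dst y x))" by (rule e) (use Y x y in auto)
  ultimately have "e * of_real (\<Sum>z | z \<in> Y \<and> (x, z) \<in> R. \<sigma> (dst y z)) = e * of_real (- real (qnum N w) * \<sigma> (dst y x))"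
    by (simp add: sum_distrib_left)
  then show ?thesis using e(1) by (simp only: mult_cancel_left of_real_eq_iff) simp
qed

text \<open>\<open>X\<close> behaves like a set of width \<open>D\<close>: it is orthogonal to every
  \<open>E j\<close> with j > 0, since these are orthogonal to the constant matrix
  \<open>E 0\<close>. The identity says that -[D] is the eigenvalue of the graph on
  \<open>E D\<close>.\<close>

lemma \<sigma>_neighbour_sum_X:
  assumes x: "x \<in> X" and y: "y \<in> X"
  shows "(\<Sum>z | z \<in> X \<and> (x, z) \<in> R. \<sigma> (dst y z)) = - real (qnum N D) * \<sigma> (dst y x)"
proof (rule \<sigma>_neighbour_sum)
  fix j assume j: "D - D < j" "j \<le> D"
  have "(\<Sum>z\<in>X. E j a z) = 0" if "a \<in> X" for a
  proof -
    have "(\<Sum>z\<in>X. E j a z * E 0 z a) = 0" using E_mult[of j 0 a a] j by simp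
    moreover have "(\<Sum>z\<in>X. E j a z * E 0 z a) = (\<Sum>z\<in>X. E j a z) / of_nat (card X)"
      unfolding sum_divide_distrib by (intro sum.cong refl) (use that in \<open>simp add: E_0\<close>)
    ultimately show ?thesis using X_ne by simp
  qed
  then show "char_form X (E j) X = 0" using char_form_E[of j X] j by simp
qed (use x y D_pos dst_le_D in auto)

text \<open>The hypothesis says that \<open>E D\<close> annihilates the characteristic vector of C.
  It will be checked, from \<sigma> 0 and \<sigma> 1 alone, for the cliques formed by the neighbours
  of a vertex of the other half.\<close>

lemma \<sigma>_clique:
  assumes C: "C \<subseteq> X" and z: "(\<Sum>x\<in>C. \<Sum>y\<in>C. \<sigma> (dst x y)) = 0" and y: "y \<in> X"
  shows "(\<Sum>x\<in>C. \<sigma> (dst y x)) = 0"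
proof -
  obtain e where e: "e \<noteq> 0" "\<And>x y. x \<in> X \<Longrightarrow> y \<in> X \<Longrightarrow> E D x y = e * of_real (\<sigma> (dst x y))" using \<sigma>_spec by blast
  have "char_form X (E D) C = (\<Sum>x\<in>C. \<Sum>y\<in>C. E D x y)" by (rule char_form_subset[OF finite_X C])
  also have "\<dots> = (\<Sum>x\<in>C. \<Sum>y\<in>C. e * of_real (\<sigma> (dst x y)))"
    by (intro sum.cong refl e) (use C in auto)
  also have "\<dots> = e * of_real (\<Sum>x\<in>C. \<Sum>y\<in>C. \<sigma> (dst x y))" by (simp add: sum_distrib_left)
  finally have "char_form X (E D) C = 0" using z by simp
  then have "(\<Sum>x\<in>C. E D y x) = 0" using char_form_E_zero[OF _ C _ y, of D] by simp
  moreover have "(\<Sum>x\<in>C. E D y x) = (\<Sum>x\<in>C. e * of_real (\<sigma> (dst y x)))"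
    by (intro sum.cong refl e) (use C y in auto)
  ultimately have "e * of_real (\<Sum>x\<in>C. \<sigma> (dst y x)) = 0" by (simp add: sum_distrib_left)
  then show ?thesis using e(1) by (simp del: of_real_sum)
qed

end

section \<open>Subspaces over a finite field and the polar space\<close>

lemma card_field_ge_2: "2 \<le> CARD('a::{field,finite})"
proof -
  have "card {0, 1 :: 'a} \<le> CARD('a)" by (rule card_mono) auto
  then show ?thesis by simp
qed

lemma subspace_plus:
  fixes S T :: "('a::field ^ 'm) set"
  assumes "vec.subspace S" "vec.subspace T" shows "vec.subspace (S + T)"
proof -
  have "S + T = {x + y |x y. x \<in> S \<and> y \<in> T}" by (auto simp: set_plus_def)
  then show ?thesis using vec.subspace_sums[OF assms] by simp
qed

lemma subset_plus1:
  fixes S T :: "('a::field ^ 'm) set"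
  assumes "vec.subspace T" shows "S \<subseteq> S + T"
proof
  fix x assume "x \<in> S"
  then have "x + 0 \<in> S + T" using vec.subspace_0[OF assms] by (rule set_plus_intro)
  then show "x \<in> S + T" by simp
qed

lemma subset_plus2:
  fixes S T :: "('a::field ^ 'm) set"
  assumes "vec.subspace S" shows "T \<subseteq> S + T"
  using subset_plus1[OF assms, of T] by (simp add: add.commute)

lemma plus_least:
  fixes S T U :: "('a::field ^ 'm) set"
  assumes "vec.subspace U" "S \<subseteq> U" "T \<subseteq> U" shows "S + T \<subseteq> U"
  using assms vec.subspace_add unfolding set_plus_def by fastforce

lemma subspace_Int: "vec.subspace S \<Longrightarrow> vec.subspace T \<Longrightarrow> vec.subspace (S \<inter> T)"
  by (simp add: vec.subspace_def)

lemma subspace_eqI: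
  fixes S T :: "('a::field ^ 'm) set"
  assumes "vec.subspace S" "vec.subspace T" "S \<subseteq> T" "vec.dim T \<le> vec.dim S" shows "S = T"
  using vec.subspace_dim_equal[OF assms] .

lemma card_span_independent:
  fixes B :: "('a::{field,finite} ^ 'm) set"
  assumes "finite B" "vec.independent B" shows "card (vec.span B) = CARD('a) ^ card B"
  using assms
proof (induction B rule: finite_induct)
  case empty
  then show ?case by simp
next
  case (insert b B)
  have nb: "b \<notin> vec.span B" and ind: "vec.independent B"
    using insert vec.independent_insert by (metis, metis)
  define f :: "'a \<times> ('a ^ 'm) \<Rightarrow> 'a ^ 'm" where "f p = snd p + fst p *s b" for p
  have "bij_betw f (UNIV \<times> vec.span B) (vec.span (insert b B))"
  proof (rule bij_betwI')
    fix p q :: "'a \<times> ('a ^ 'm)" assume p: "p \<in> UNIV \<times> vec.span B" and q: "q \<in> UNIV \<times> vec.span B"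
    have "fst p = fst q" if "f p = f q"
    proof (rule ccontr)
      assume "fst p \<noteq> fst q"
      have "(fst p - fst q) *s b = snd q - snd p"
        using that unfolding f_def by (simp add: vec.scale_left_diff_distrib algebra_simps)
      then have "(1 / (fst p - fst q)) *s ((fst p - fst q) *s b) \<in> vec.span B"
        using p q by (auto simp: vec.span_scale vec.span_diff)
      moreover have "(1 / (fst p - fst q)) *s ((fst p - fst q) *s b) = b"
        using \<open>fst p \<noteq> fst q\<close> unfolding vec.scale_scale by simp
      ultimately show False using nb by metis
    qed
    then show "f p = f q \<longleftrightarrow> p = q" by (auto simp: f_def prod_eq_iff)
  next
    fix p :: "'a \<times> ('a ^ 'm)" assume "p \<in> UNIV \<times> vec.span B"
    then show "f p \<in> vec.span (insert b B)"
      unfolding f_def vec.span_insert by (auto intro!: exI[of _ "fst p"])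
  next
    fix y assume "y \<in> vec.span (insert b B)"
    then obtain k where "y - k *s b \<in> vec.span B" by (auto simp: vec.span_insert)
    then show "\<exists>p\<in>UNIV \<times> vec.span B. y = f p"
      by (intro bexI[of _ "(k, y - k *s b)"]) (auto simp: f_def)
  qed
  then have "card (vec.span (insert b B)) = card (UNIV \<times> vec.span B :: ('a \<times> ('a ^ 'm)) set)"
    by (rule bij_betw_same_card[symmetric])
  then show ?case using insert ind by (simp add: card_cartesian_product)
qed

lemma card_subspace:
  fixes S :: "('a::{field,finite} ^ 'm) set"
  assumes "vec.subspace S" shows "card S = CARD('a) ^ vec.dim S"
proof -
  obtain B where B: "B \<subseteq> S" "vec.independent B" "S \<subseteq> vec.span B" "card B = vec.dim S"
    by (rule vec.basis_exists)
  have "vec.span B = S" using B assms by (metis vec.span_subspace)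
  moreover have "finite B" using B(2) vec.finiteI_independent by blast
  ultimately show ?thesis using card_span_independent[of B] B by simp
qed

text \<open>Over a finite field this is a count: addition maps S \<times> T onto S + T, and all
  fibres have the size of S \<inter> T.\<close>

lemma dim_plus_Int:
  fixes S T :: "('a::{field,finite} ^ 'm) set"
  assumes S: "vec.subspace S" and T: "vec.subspace T"
  shows "vec.dim (S + T) + vec.dim (S \<inter> T) = vec.dim S + vec.dim T"
proof -
  have fib: "card {p \<in> S \<times> T. fst p + snd p = u} = card (S \<inter> T)" if u: "u \<in> S + T" for u
  proof -
    obtain a b where ab: "a \<in> S" "b \<in> T" "u = a + b" using u by (auto simp: set_plus_def)
    have "bij_betw (\<lambda>w. (a + w, b - w)) (S \<inter> T) {p \<in> S \<times> T. fst p + snd p = u}"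
    proof (rule bij_betwI')
      fix p assume "p \<in> {p \<in> S \<times> T. fst p + snd p = u}"
      then have p: "fst p \<in> S" "snd p \<in> T" "fst p + snd p = a + b" using ab by auto
      have e: "fst p - a = b - snd p" using p(3) by (simp add: algebra_simps)
      have "fst p - a \<in> S \<inter> T"
        using vec.subspace_diff[OF S p(1) ab(1)] vec.subspace_diff[OF T ab(2) p(2)] e by simp
      moreover have "p = (a + (fst p - a), b - (fst p - a))"
        by (rule prod_eqI, simp, subst e, simp)
      ultimately show "\<exists>w\<in>S \<inter> T. p = (a + w, b - w)" by blast
    qed (use ab S T in \<open>auto simp: vec.subspace_add vec.subspace_diff\<close>)
    from bij_betw_same_card[OF this] show ?thesis by (rule sym)
  qed
  have "(\<lambda>p. fst p + snd p) ` (S \<times> T) \<subseteq> S + T" by (auto intro: set_plus_intro)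
  then have "card (S \<times> T) = (\<Sum>u\<in>S + T. card {p \<in> S \<times> T. fst p + snd p = u})"
    using sum.group[of "S \<times> T" "S + T" "\<lambda>p. fst p + snd p" "\<lambda>_. 1 :: nat"] by simp
  also have "\<dots> = card (S + T) * card (S \<inter> T)" using fib by simp
  finally have "CARD('a) ^ (vec.dim (S + T) + vec.dim (S \<inter> T)) = CARD('a) ^ (vec.dim S + vec.dim T)"
    by (simp add: card_cartesian_product card_subspace assms subspace_plus subspace_Int power_add)
  then show ?thesis using card_field_ge_2[where 'a='a] by (simp add: power_inject_exp)
qed

lemma dim_insert_subspace:
  fixes A :: "('a::field ^ 'm) set"
  assumes "vec.subspace A" "v \<notin> A" shows "vec.dim (vec.span (insert v A)) = vec.dim A + 1"
  using assms by (simp add: vec.dim_insert vec.span_eq_iff[THEN iffD2])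

lemma qnum_mult: "1 \<le> l \<Longrightarrow> (l - 1) * qnum l k + 1 = (l :: nat) ^ k"
proof (induction k)
  case (Suc k)
  have "(l - 1) * qnum l (Suc k) + 1 = ((l - 1) * qnum l k + 1) + (l - 1) * l ^ k"
    by (simp add: qnum_Suc algebra_simps)
  also have "\<dots> = l ^ k + (l - 1) * l ^ k" using Suc by simp
  also have "\<dots> = l ^ Suc k" using Suc.prems by (simp add: algebra_simps)
  finally show ?case .
qed simp

text \<open>These are the points of the quotient B / A. Each vector of B outside A lies in exactly
  one of them, so the sets P - A partition B - A.\<close>

lemma card_between:
  fixes A B :: "('a::{field,finite} ^ 'm) set"
  assumes A: "vec.subspace A" and B: "vec.subspace B" and AB: "A \<subseteq> B"
  shows "card {P. vec.subspace P \<and> A \<subseteq> P \<and> P \<subseteq> B \<and> vec.dim P = vec.dim A + 1}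
    = qnum CARD('a) (vec.dim B - vec.dim A)"
proof -
  let ?l = "CARD('a)" and ?F = "{P. vec.subspace P \<and> A \<subseteq> P \<and> P \<subseteq> B \<and> vec.dim P = vec.dim A + 1}"
  have l: "2 \<le> ?l" by (rule card_field_ge_2)
  have dAB: "vec.dim A \<le> vec.dim B" using AB by (rule vec.dim_subset)
  have dis: "P = P'" if "P \<in> ?F" "P' \<in> ?F" "v \<in> P - A" "v \<in> P' - A" for P P' v
  proof -
    have e: "vec.span (insert v A) = H" if "H \<in> ?F" "v \<in> H - A" for H
    proof (rule subspace_eqI)
      show "vec.span (insert v A) \<subseteq> H" using that by (intro vec.span_minimal) auto
      show "vec.dim H \<le> vec.dim (vec.span (insert v A))" using dim_insert_subspace[OF A] that by auto
    qed (use that in auto)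
    show ?thesis using e[of P] e[of P'] that by simp
  qed
  have "B - A = (\<Union>P\<in>?F. P - A)"
  proof (intro equalityI subsetI)
    fix v assume v: "v \<in> B - A"
    have "vec.span (insert v A) \<subseteq> B" using v AB B by (intro vec.span_minimal) auto
    then have "vec.span (insert v A) \<in> ?F"
      using dim_insert_subspace[OF A, of v] v vec.span_superset[of "insert v A"] by auto
    moreover have "v \<in> vec.span (insert v A)" by (simp add: vec.span_base)
    ultimately show "v \<in> (\<Union>P\<in>?F. P - A)" using v by blast
  qed auto
  then have "card (B - A) = card (\<Union>P\<in>?F. P - A)" by simp
  also have "\<dots> = (\<Sum>P\<in>?F. card (P - A))"
  proof (rule card_UN_disjoint)
    show "\<forall>P\<in>?F. \<forall>P'\<in>?F. P \<noteq> P' \<longrightarrow> (P - A) \<inter> (P' - A) = {}" using dis by blast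
  qed simp_all
  also have "\<dots> = (\<Sum>P\<in>?F. ?l ^ (vec.dim A + 1) - ?l ^ vec.dim A)"
    by (intro sum.cong refl) (auto simp: card_Diff_subset card_subspace A)
  finally have "?l ^ vec.dim B - ?l ^ vec.dim A = card ?F * (?l ^ (vec.dim A + 1) - ?l ^ vec.dim A)"
    using AB by (simp add: card_Diff_subset card_subspace A B)
  moreover have "?l ^ vec.dim B = ?l ^ vec.dim A * ?l ^ (vec.dim B - vec.dim A)"
    using dAB by (simp add: power_add[symmetric])
  ultimately have "?l ^ vec.dim A * (?l ^ (vec.dim B - vec.dim A) - 1) = ?l ^ vec.dim A * (card ?F * (?l - 1))"
    by (simp add: algebra_simps diff_mult_distrib diff_mult_distrib2)
  then have "?l ^ (vec.dim B - vec.dim A) - 1 = card ?F * (?l - 1)" using l by simp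
  moreover have "?l ^ (vec.dim B - vec.dim A) - 1 = (?l - 1) * qnum ?l (vec.dim B - vec.dim A)"
    using qnum_mult[of ?l "vec.dim B - vec.dim A"] l by linarith
  ultimately have "card ?F * (?l - 1) = qnum ?l (vec.dim B - vec.dim A) * (?l - 1)" by (simp add: mult.commute)
  then show ?thesis using l by simp
qed

lemma exists_between:
  fixes A B :: "('a::field ^ 'm) set"
  assumes A: "vec.subspace A" and B: "vec.subspace B" and AB: "A \<subseteq> B"
    and k: "vec.dim A \<le> k" "k \<le> vec.dim B"
  obtains P where "vec.subspace P" "A \<subseteq> P" "P \<subseteq> B" "vec.dim P = k"
proof -
  have "\<exists>P. vec.subspace P \<and> A \<subseteq> P \<and> P \<subseteq> B \<and> vec.dim P = k"
    using k(1,2)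
  proof (induction k rule: dec_induct)
    case base
    then show ?case using A AB by blast
  next
    case (step j)
    then obtain P where P: "vec.subspace P" "A \<subseteq> P" "P \<subseteq> B" "vec.dim P = j" by auto
    have "\<not> B \<subseteq> P" using vec.dim_subset[of B P] P(4) step by auto
    then obtain v where v: "v \<in> B" "v \<notin> P" by blast
    then have "vec.span (insert v P) \<subseteq> B" using P B by (intro vec.span_minimal) auto
    then show ?case using P v dim_insert_subspace[OF P(1) v(2)] vec.span_superset[of "insert v P"]
      by (intro exI[of _ "vec.span (insert v P)"]) auto
  qed
  then show thesis using that by blast
qed

section \<open>The polar form and orthogonal subspaces\<close>

locale polar_D =
  fixes Q :: "'a::{field,finite} ^ 'm \<Rightarrow> 'a" and n :: nat
  assumes polar: "polar_space_D n Q"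
begin

abbreviation B :: "'a ^ 'm \<Rightarrow> 'a ^ 'm \<Rightarrow> 'a" where "B \<equiv> polar_form Q"
abbreviation V :: "('a ^ 'm) set set" where "V \<equiv> dp_vertices Q"

lemma card_cart_basis [simp]: "card (cart_basis :: ('a ^ 'm) set) = 2 * n"
  using polar vec_dim_card[where 'a='a and 'n='m] unfolding polar_space_D_def by simp

lemma dim_le: "vec.dim (S :: ('a ^ 'm) set) \<le> 2 * n"
  using vec.dim_subset[of S UNIV] by simp

lemma B_commute: "B x y = B y x"
  by (simp add: polar_form_def add.commute)

lemma Q_scale: "Q (c *s x) = c ^ 2 * Q x"
  using polar unfolding polar_space_D_def quadratic_form_def by blast

lemma Q_add: "Q (x + y) = Q x + Q y + B x y"
  by (simp add: polar_form_def)

lemma B_add: "B (x + y) z = B x z + B y z" and B_scale: "B (c *s x) z = c * B x z"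
proof -
  have l: "Vector_Spaces.linear (*s) (*) (\<lambda>x. B x z)"
    using polar unfolding polar_space_D_def quadratic_form_def by blast
  interpret l: Vector_Spaces.linear "(*s)" "(*)" "\<lambda>x. B x z" by (rule l)
  show "B (x + y) z = B x z + B y z" by (rule l.add)
  show "B (c *s x) z = c * B x z" by (rule l.scale)
qed

lemma B_add2: "B z (x + y) = B z x + B z y" and B_scale2: "B z (c *s x) = c * B z x"
  using B_add B_scale B_commute by metis+

lemma B_0 [simp]: "B 0 z = 0" "B z 0 = 0"
  using B_scale[of 0 z z] B_commute[of 0 z] by simp_all

lemma B_diff: "B (x - y) z = B x z - B y z"
proof -
  have "B x z = B (x - y) z + B y z" using B_add[of "x - y" y z] by simp
  then show ?thesis by simp
qed

definition perp :: "('a ^ 'm) set \<Rightarrow> ('a ^ 'm) set" where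
  "perp S = {x. \<forall>y\<in>S. B x y = 0}"

lemma subspace_perp [simp, intro]: "vec.subspace (perp S)"
  by (simp add: vec.subspace_def perp_def B_add B_scale)

lemma perp_antimono: "S \<subseteq> T \<Longrightarrow> perp T \<subseteq> perp S"
  by (auto simp: perp_def)

lemma subset_perp_perp: "S \<subseteq> perp (perp S)"
  by (auto simp: perp_def B_commute)

lemma perp_insert: "perp (insert v S) = perp {v} \<inter> perp S"
  by (auto simp: perp_def)

lemma perp_span: "perp (vec.span S) = perp S"
proof
  show "perp S \<subseteq> perp (vec.span S)"
  proof
    fix x assume "x \<in> perp S"
    then have "S \<subseteq> perp {x}" by (auto simp: perp_def B_commute)
    then have "vec.span S \<subseteq> perp {x}" by (rule vec.span_minimal) simp
    then show "x \<in> perp (vec.span S)" by (auto simp: perp_def B_commute)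
  qed
qed (rule perp_antimono[OF vec.span_superset])

lemma perp_plus:
  assumes "vec.subspace S" "vec.subspace T" shows "perp (S + T) = perp S \<inter> perp T"
proof
  show "perp (S + T) \<subseteq> perp S \<inter> perp T"
    using perp_antimono[OF subset_plus1[OF assms(2), of S]] perp_antimono[OF subset_plus2[OF assms(1), of T]] by blast
  show "perp S \<inter> perp T \<subseteq> perp (S + T)" by (auto simp: perp_def set_plus_def B_add2)
qed

lemma dim_Int_hyperplane:
  assumes "vec.subspace A" shows "vec.dim A \<le> vec.dim (A \<inter> perp {v}) + 1"
proof (cases "A \<subseteq> perp {v}")
  case True
  then show ?thesis by (simp add: Int_absorb2)
next
  case False
  then obtain a where a: "a \<in> A" "B a v \<noteq> 0" by (auto simp: perp_def)
  have "A \<subseteq> vec.span (insert a (A \<inter> perp {v}))"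
  proof
    fix x assume x: "x \<in> A"
    have "x - (B x v / B a v) *s a \<in> A \<inter> perp {v}"
      using x a assms by (simp add: perp_def B_diff B_scale vec.subspace_diff vec.subspace_scale)
    then show "x \<in> vec.span (insert a (A \<inter> perp {v}))"
      unfolding vec.span_insert by (blast intro: vec.span_base)
  qed
  then have "vec.dim A \<le> vec.dim (insert a (A \<inter> perp {v}))" by (rule vec.dim_mono)
  also have "\<dots> \<le> vec.dim (A \<inter> perp {v}) + 1" by (simp add: vec.dim_insert)
  finally show ?thesis .
qed

text \<open>S is enlarged to S' one vector at a time, and each new vector imposes a single linear
  condition on T.\<close>

lemma dim_Int_perp:
  assumes T: "vec.subspace T" and S: "vec.subspace S" and S': "vec.subspace S'" and SS: "S \<subseteq> S'"
  shows "vec.dim (T \<inter> perp S) \<le> vec.dim (T \<inter> perp S') + (vec.dim S' - vec.dim S)"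
  using S SS
proof (induction "vec.dim S' - vec.dim S" arbitrary: S)
  case 0
  then have "S = S'" using S' by (intro subspace_eqI) auto
  then show ?case by simp
next
  case (Suc k)
  have "S \<noteq> S'" using Suc.hyps(2) by auto
  then obtain v where v: "v \<in> S'" "v \<notin> S" using Suc.prems by blast
  let ?S1 = "vec.span (insert v S)"
  have d: "vec.dim ?S1 = vec.dim S + 1" by (rule dim_insert_subspace[OF Suc.prems(1) v(2)])
  have sub: "?S1 \<subseteq> S'" using v Suc.prems S' by (intro vec.span_minimal) auto
  have IH: "vec.dim (T \<inter> perp ?S1) \<le> vec.dim (T \<inter> perp S') + (vec.dim S' - vec.dim ?S1)"
    using Suc.hyps d sub by (intro Suc.hyps(1)) auto
  have e: "T \<inter> perp ?S1 = (T \<inter> perp S) \<inter> perp {v}" unfolding perp_span perp_insert[of v S] by blast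
  have "vec.dim (T \<inter> perp S) \<le> vec.dim (T \<inter> perp ?S1) + 1"
    unfolding e by (intro dim_Int_hyperplane subspace_Int T subspace_perp)
  then show ?case using IH d Suc.hyps(2) by linarith
qed

lemma isotropic_subset_perp: "isotropic Q U \<Longrightarrow> U \<subseteq> perp U"
  using vec.subspace_add by (fastforce simp: isotropic_def perp_def polar_form_def)

lemma dim_isotropic_le: "isotropic Q U \<Longrightarrow> vec.dim U \<le> n"
proof -
  assume U: "isotropic Q U"
  have "vec.dim U \<le> witt_index Q" unfolding witt_index_def
  proof (rule Max_ge)
    show "finite {vec.dim U |U. isotropic Q U}"
      by (rule finite_subset[of _ "{..2 * n}"]) (use dim_le in auto)
  qed (use U in blast)
  then show ?thesis using polar unfolding polar_space_D_def by simp
qed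

lemma vertex_iff: "U \<in> V \<longleftrightarrow> isotropic Q U \<and> vec.dim U = n"
proof -
  have "W = U" if "isotropic Q U" "vec.dim U = n" "isotropic Q W" "U \<subseteq> W" for W
    using that dim_isotropic_le[of W] by (intro subspace_eqI[symmetric]) (auto simp: isotropic_def)
  then show ?thesis using polar unfolding dp_vertices_def polar_space_D_def by auto
qed

lemma vertex_subspace [simp, intro]: "x \<in> V \<Longrightarrow> vec.subspace x"
  and vertex_dim [simp]: "x \<in> V \<Longrightarrow> vec.dim x = n"
  and vertex_Q: "x \<in> V \<Longrightarrow> v \<in> x \<Longrightarrow> Q v = 0"
  by (auto simp: vertex_iff isotropic_def)

text \<open>Nondegeneracy only excludes nonzero singular vectors from the radical
  \<open>perp UNIV\<close>. As x is isotropic, it meets the radical trivially all the same, and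
  \<open>dim_Int_perp\<close> from \<open>perp x\<close> to the whole space bounds the dimension of
  \<open>perp x\<close> by n.\<close>

lemma perp_vertex: assumes "x \<in> V" shows "perp x = x"
proof -
  have xs: "x \<subseteq> perp x" using assms isotropic_subset_perp by (auto simp: vertex_iff)
  have nd: "x \<inter> perp UNIV \<subseteq> {0}"
    using polar vertex_Q[OF assms] unfolding polar_space_D_def nondegenerate_def perp_def by auto
  have "x \<inter> perp (perp x) = x" using subset_perp_perp[of x] by blast
  then have "n \<le> vec.dim (x \<inter> perp UNIV) + (2 * n - vec.dim (perp x))"
    using dim_Int_perp[of x "perp x" UNIV] assms by simp
  moreover have "vec.dim (x \<inter> perp UNIV) = 0" using nd by simp
  ultimately have "vec.dim (perp x) \<le> n" using dim_le[of "perp x"] by linarith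
  then show ?thesis using subspace_eqI[OF _ _ xs] assms by simp
qed

lemma vertex_exists: obtains x where "x \<in> V"
proof -
  have "finite {vec.dim U |U. isotropic Q U}"
    by (rule finite_subset[of _ "{..2 * n}"]) (use dim_le in auto)
  moreover have "Q 0 = 0" using Q_scale[of 0 0] by simp
  then have "isotropic Q {0}" by (simp add: isotropic_def)
  then have "{vec.dim U |U. isotropic Q U} \<noteq> {}" by blast
  ultimately have "witt_index Q \<in> {vec.dim U |U. isotropic Q U}"
    unfolding witt_index_def by (rule Max_in)
  then obtain U where "isotropic Q U" "vec.dim U = n" using polar unfolding polar_space_D_def by auto
  then show thesis using that vertex_iff by blast
qed

text \<open>The radical lies in \<open>perp x = x\<close>, so all its vectors are singular. Only now
  does nondegeneracy give a trivial radical of the polar form, in characteristic 2 as well.\<close>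

lemma perp_UNIV: "perp UNIV = {0}"
proof -
  obtain x where x: "x \<in> V" by (rule vertex_exists)
  have "perp UNIV \<subseteq> x" using perp_antimono[of x UNIV] perp_vertex[OF x] by simp
  then have "perp UNIV \<subseteq> {0}"
    using polar vertex_Q[OF x] unfolding polar_space_D_def nondegenerate_def perp_def by auto
  then show ?thesis using vec.subspace_0[OF subspace_perp] by blast
qed

lemma dim_perp: assumes "vec.subspace S" shows "vec.dim (perp S) + vec.dim S = 2 * n"
proof -
  have "perp {0} = UNIV" by (auto simp: perp_def)
  then have "2 * n \<le> vec.dim (perp S) + vec.dim S"
    using dim_Int_perp[of UNIV "{0}" S] assms vec.subspace_0[OF assms] by simp
  moreover have "vec.dim (perp S) \<le> 2 * n - vec.dim S"
    using dim_Int_perp[of UNIV S UNIV] assms perp_UNIV by simp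
  ultimately show ?thesis using dim_le[of S] by linarith
qed

lemma perp_perp: assumes "vec.subspace S" shows "perp (perp S) = S"
  using subspace_eqI[OF assms subspace_perp subset_perp_perp] dim_perp[OF assms] dim_perp[of "perp S"] by simp

end

section \<open>The dual polar graph and its halves\<close>

context polar_D
begin

text \<open>The distance in the dual polar graph, by \<open>gdist_dp_adj\<close> below. It is
  measured by sums rather than intersections because the geometry at x consists of the subspaces
  containing x.\<close>

definition \<delta> :: "('a ^ 'm) set \<Rightarrow> ('a ^ 'm) set \<Rightarrow> nat" where
  "\<delta> x y = vec.dim (x + y) - n"

lemma dim_plus: "x \<in> V \<Longrightarrow> y \<in> V \<Longrightarrow> vec.dim (x + y) = n + \<delta> x y"
  using vec.dim_subset[OF subset_plus1[of y x]] by (simp add: \<delta>_def)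

lemma dim_Int: "x \<in> V \<Longrightarrow> y \<in> V \<Longrightarrow> vec.dim (x \<inter> y) + \<delta> x y = n"
  using dim_plus_Int[of x y] dim_plus[of x y] by simp

lemma \<delta>_commute: "\<delta> x y = \<delta> y x"
  by (simp add: \<delta>_def add.commute)

lemma \<delta>_le: "x \<in> V \<Longrightarrow> y \<in> V \<Longrightarrow> \<delta> x y \<le> n"
  using dim_Int[of x y] by simp

lemma \<delta>_eq_0_iff: assumes "x \<in> V" "y \<in> V" shows "\<delta> x y = 0 \<longleftrightarrow> x = y"
proof
  assume "\<delta> x y = 0"
  then have d: "vec.dim (x \<inter> y) = n" using dim_Int[OF assms] by simp
  then have "x \<inter> y = x" "x \<inter> y = y" using assms by (intro subspace_eqI subspace_Int; simp)+
  then show "x = y" by blast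
next
  assume "x = y"
  then show "\<delta> x y = 0" using dim_Int[of x y] assms by simp
qed

lemma \<delta>_self [simp]: "x \<in> V \<Longrightarrow> \<delta> x x = 0"
  by (simp add: \<delta>_eq_0_iff)

text \<open>The intersection of x + y and y + z contains y, which has dimension n.\<close>

lemma \<delta>_triangle: assumes "x \<in> V" "y \<in> V" "z \<in> V" shows "\<delta> x z \<le> \<delta> x y + \<delta> y z"
proof -
  have s: "vec.subspace (x + y)" "vec.subspace (y + z)" using assms by (auto intro: subspace_plus)
  have "x + z \<subseteq> (x + y) + (y + z)"
    using assms by (intro set_plus_mono2 subset_plus1 subset_plus2) auto
  then have "n + \<delta> x z \<le> vec.dim ((x + y) + (y + z))" using dim_plus[of x z] assms vec.dim_subset by metis
  moreover have "y \<subseteq> (x + y) \<inter> (y + z)" using assms subset_plus1 subset_plus2 vertex_subspace by blast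
  from vec.dim_subset[OF this] have "n \<le> vec.dim ((x + y) \<inter> (y + z))" using assms by simp
  ultimately show ?thesis using dim_plus_Int[OF s] dim_plus[of x y] dim_plus[of y z] assms by simp
qed

lemma dp_adj_iff: "(x, y) \<in> dp_adj Q \<longleftrightarrow> x \<in> V \<and> y \<in> V \<and> \<delta> x y = 1"
  using dim_Int[of x y] polar unfolding dp_adj_def polar_space_D_def by auto

lemma Q_plus_scale: "Q (b + c *s v) = Q b + c ^ 2 * Q v + c * B b v"
  by (simp add: Q_add Q_scale B_scale2)

text \<open>Projection in a polar space. One linear condition cuts x down by at most one dimension,
  while n bounds the dimension of the isotropic z; so \<open>x \<inter> perp {v}\<close> is a
  hyperplane of x and z is a vertex.\<close>

lemma vertex_through:
  assumes x: "x \<in> V" and v: "Q v = 0" "v \<notin> x"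
  defines "z \<equiv> vec.span (insert v (x \<inter> perp {v}))"
  shows "z \<in> V" "\<delta> x z = 1" "v \<in> z" "z \<subseteq> vec.span (insert v x)"
proof -
  let ?g = "x \<inter> perp {v}"
  have g: "vec.subspace ?g" using x by (intro subspace_Int) auto
  have dg: "n \<le> vec.dim ?g + 1" using dim_Int_hyperplane[of x v] x by simp
  have dz: "vec.dim z = vec.dim ?g + 1" unfolding z_def by (rule dim_insert_subspace[OF g]) (use v in blast)
  have iso: "isotropic Q z" unfolding isotropic_def
  proof (intro conjI ballI)
    fix u assume "u \<in> z"
    then obtain k where "u - k *s v \<in> vec.span ?g" unfolding z_def vec.span_insert by blast
    then have k: "u - k *s v \<in> ?g" using g by (simp add: vec.span_eq_iff[THEN iffD2])
    have "Q ((u - k *s v) + k *s v) = 0"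
      unfolding Q_plus_scale using k v(1) vertex_Q[OF x] by (simp add: perp_def)
    then show "Q u = 0" by simp
  qed (simp add: z_def)
  then have dzn: "vec.dim z = n" using dim_isotropic_le[of z] dz dg by simp
  then show zV: "z \<in> V" using iso vertex_iff by blast
  show vz: "v \<in> z" unfolding z_def by (simp add: vec.span_base)
  have "?g \<subseteq> x \<inter> z" unfolding z_def using vec.span_superset[of "insert v ?g"] by auto
  then have "vec.dim ?g \<le> vec.dim (x \<inter> z)" by (rule vec.dim_subset)
  then have "\<delta> x z \<le> 1" using dim_Int[OF x zV] dz dzn by simp
  moreover have "\<delta> x z \<noteq> 0" using vz v(2) \<delta>_eq_0_iff[OF x zV] by blast
  ultimately show "\<delta> x z = 1" by simp
  show "z \<subseteq> vec.span (insert v x)" unfolding z_def by (intro vec.span_mono) auto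
qed

lemma perp_vertex_plus: "x \<in> V \<Longrightarrow> y \<in> V \<Longrightarrow> perp (x + y) = x \<inter> y"
  by (simp add: perp_plus perp_vertex)

text \<open>Modulo \<open>perp P\<close> the space P is a hyperbolic plane with exactly two singular
  points. One comes from x, the other gives z. With \<open>flip_unique\<close>, neighbours of x
  correspond to points over x.\<close>

lemma flip_exists:
  assumes x: "x \<in> V" and P: "vec.subspace P" "x \<subseteq> P" "vec.dim P = n + 1"
  obtains z where "z \<in> V" "x + z = P" "\<delta> x z = 1"
proof -
  have "\<not> P \<subseteq> x" using vec.dim_subset[of P x] P x by auto
  then obtain a where a: "a \<in> P" "a \<notin> x" by blast
  then have "a \<notin> perp x" using perp_vertex[OF x] by simp
  then obtain p0 where p0: "p0 \<in> x" "B a p0 \<noteq> 0" by (auto simp: perp_def)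
  \<comment> \<open>The coefficient t solves Q a + t B a p0 = 0; the equation is linear because p0
    is singular.\<close>
  define v where "v = a + (- (Q a / B a p0)) *s p0"
  have "Q v = Q a + (- (Q a / B a p0)) * B a p0"
    unfolding v_def Q_plus_scale using vertex_Q[OF x p0(1)] by simp
  then have Qv: "Q v = 0" using p0 by simp
  have vx: "v \<notin> x"
  proof
    assume "v \<in> x"
    then have "v - (- (Q a / B a p0)) *s p0 \<in> x"
      using p0 x by (intro vec.subspace_diff vec.subspace_scale) auto
    then show False using a unfolding v_def by simp
  qed
  have vP: "v \<in> P" unfolding v_def using P a p0 by (intro vec.subspace_add vec.subspace_scale) auto
  let ?z = "vec.span (insert v (x \<inter> perp {v}))"
  note z = vertex_through[OF x Qv vx]
  have "?z \<subseteq> P" using z(4) vec.span_minimal[of "insert v x" P] vP P by blast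
  then have "x + ?z \<subseteq> P" using P by (intro plus_least) auto
  then have "x + ?z = P" using P z x dim_plus[OF x z(1)] by (intro subspace_eqI subspace_plus) auto
  then show thesis using that z by blast
qed

text \<open>Write a vector of w outside x as b + c v with b in x and c nonzero. Both b and v are
  singular, so its singularity forces B b v = 0, which puts b into z.\<close>

lemma flip_unique:
  assumes x: "x \<in> V" and z: "z \<in> V" "\<delta> x z = 1" and w: "w \<in> V" "\<delta> x w = 1" and e: "x + z = x + w"
  shows "z = w"
proof -
  have g: "x \<inter> z = x \<inter> w" using perp_vertex_plus[OF x z(1)] perp_vertex_plus[OF x w(1)] e by simp
  have "z \<noteq> x" using z \<delta>_eq_0_iff[OF x z(1)] by auto
  then obtain v where v: "v \<in> z" "v \<notin> x"
    using subspace_eqI[of z x] x z(1) by auto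
  have Px: "vec.span (insert v x) = x + z"
  proof (rule subspace_eqI)
    show "vec.span (insert v x) \<subseteq> x + z"
      using v x z subset_plus1[of z x] subset_plus2[of x z] by (intro vec.span_minimal subspace_plus) auto
    show "vec.dim (x + z) \<le> vec.dim (vec.span (insert v x))"
      using dim_insert_subspace[of x v] x v dim_plus[OF x z(1)] z(2) by simp
  qed (use x z in \<open>auto intro: subspace_plus\<close>)
  have hyp: "x \<inter> perp {v} = x \<inter> z"
  proof (rule subspace_eqI[symmetric])
    show "x \<inter> z \<subseteq> x \<inter> perp {v}"
      using isotropic_subset_perp[of z] z(1) v(1) by (auto simp: vertex_iff perp_def)
    have "x \<inter> perp {v} \<noteq> x"
    proof
      assume "x \<inter> perp {v} = x"
      then have "v \<in> perp x" by (auto simp: perp_def B_commute)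
      then show False using perp_vertex[OF x] v by simp
    qed
    then have "vec.dim (x \<inter> perp {v}) \<noteq> n"
      using subspace_eqI[of "x \<inter> perp {v}" x] x by (auto intro: subspace_Int)
    moreover have "vec.dim (x \<inter> perp {v}) \<le> n" using vec.dim_subset[of "x \<inter> perp {v}" x] x by simp
    ultimately show "vec.dim (x \<inter> perp {v}) \<le> vec.dim (x \<inter> z)" using dim_Int[OF x z(1)] z(2) by simp
  qed (use x z in \<open>auto intro: subspace_Int\<close>)
  have "w \<subseteq> z"
  proof
    fix u assume u: "u \<in> w"
    show "u \<in> z"
    proof (cases "u \<in> x")
      case True
      then show ?thesis using u g by blast
    next
      case False
      have "u \<in> x + w" using u subset_plus2[of x w] x by auto
      then have "u \<in> vec.span (insert v x)" unfolding Px e .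
      then obtain c where "u - c *s v \<in> vec.span x" unfolding vec.span_insert by blast
      then have c: "u - c *s v \<in> x" using x by (simp add: vec.span_eq_iff[THEN iffD2])
      have "c \<noteq> 0" using c False by auto
      have "Q ((u - c *s v) + c *s v) = 0" using vertex_Q[OF w(1) u] by simp
      then have "B (u - c *s v) v = 0"
        unfolding Q_plus_scale using vertex_Q[OF x c] vertex_Q[OF z(1) v(1)] \<open>c \<noteq> 0\<close> by simp
      then have "u - c *s v \<in> x \<inter> perp {v}" using c by (simp add: perp_def)
      then have "u - c *s v \<in> z" using hyp by blast
      then have "(u - c *s v) + c *s v \<in> z" using v z by (intro vec.subspace_add vec.subspace_scale) auto
      then show ?thesis by simp
    qed
  qed
  then show ?thesis using z w by (intro subspace_eqI[symmetric]) auto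
qed

text \<open>Projecting a vector of y outside x gives a neighbour of x that keeps x \<inter> y and
  gains a dimension of y. The two inclusions later keep shortest paths inside a hyperplane
  containing both ends.\<close>

lemma closer_exists:
  assumes x: "x \<in> V" and y: "y \<in> V" and d: "\<delta> x y = Suc k"
  obtains z where "z \<in> V" "\<delta> x z = 1" "\<delta> z y = k" "x \<inter> y \<subseteq> z" "z \<subseteq> x + y"
proof -
  have "\<not> y \<subseteq> x" using d \<delta>_eq_0_iff[OF x y] subspace_eqI[of y x] x y by auto
  then obtain v where v: "v \<in> y" "v \<notin> x" by blast
  let ?z = "vec.span (insert v (x \<inter> perp {v}))"
  note z = vertex_through[OF x vertex_Q[OF y v(1)] v(2)]
  have "x \<inter> y \<subseteq> x \<inter> perp {v}"
    using isotropic_subset_perp[of y] y v(1) by (auto simp: vertex_iff perp_def)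
  then have sub: "x \<inter> y \<subseteq> ?z" using vec.span_superset[of "insert v (x \<inter> perp {v})"] by auto
  have "vec.span (insert v (x \<inter> y)) \<subseteq> ?z \<inter> y"
    using sub v z(3) y by (intro vec.span_minimal subspace_Int) auto
  then have "vec.dim (vec.span (insert v (x \<inter> y))) \<le> vec.dim (?z \<inter> y)" by (rule vec.dim_subset)
  moreover have "vec.dim (vec.span (insert v (x \<inter> y))) = vec.dim (x \<inter> y) + 1"
    using v x y by (intro dim_insert_subspace subspace_Int) auto
  ultimately have "\<delta> ?z y \<le> k" using dim_Int[OF x y] dim_Int[OF z(1) y] d by linarith
  moreover have "Suc k \<le> 1 + \<delta> ?z y" using \<delta>_triangle[OF x z(1) y] z(2) d by simp
  ultimately have "\<delta> ?z y = k" by simp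
  moreover have "?z \<subseteq> x + y"
    using z(4) vec.span_minimal[of "insert v x" "x + y"] v x y subset_plus1[of y x] subset_plus2[of x y]
      subspace_plus[of x y] by blast
  ultimately show thesis using that z(1,2) sub by blast
qed

text \<open>A singular v not orthogonal to some p in x \<inter> y projects to a neighbour of x that
  loses p and gains nothing from y.\<close>

lemma farther_exists:
  assumes x: "x \<in> V" and y: "y \<in> V" and d: "\<delta> x y < n"
  obtains z where "z \<in> V" "\<delta> x z = 1" "\<delta> z y = Suc (\<delta> x y)"
proof -
  have "vec.dim (x \<inter> y) \<noteq> 0" using d dim_Int[OF x y] by linarith
  then have "\<not> x \<inter> y \<subseteq> {0}" by (metis vec.dim_eq_0)
  then obtain p where p: "p \<in> x" "p \<in> y" "p \<noteq> 0" by blast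
  have "p \<notin> perp UNIV" using p perp_UNIV by simp
  then obtain a where a: "B a p \<noteq> 0" by (auto simp: perp_def B_commute)
  define v where "v = a + (- (Q a / B a p)) *s p"
  have "Q v = Q a + (- (Q a / B a p)) * B a p"
    unfolding v_def Q_plus_scale using vertex_Q[OF x p(1)] by simp
  then have Qv: "Q v = 0" using a by simp
  have Bpp: "B p p = 0" using isotropic_subset_perp[of x] x p by (auto simp: vertex_iff perp_def)
  have Bv: "B v p \<noteq> 0" unfolding v_def using a by (simp add: B_add B_diff B_scale Bpp)
  have vx: "v \<notin> x" using Bv isotropic_subset_perp[of x] x p by (auto simp: vertex_iff perp_def)
  let ?z = "vec.span (insert v (x \<inter> perp {v}))"
  note z = vertex_through[OF x Qv vx]
  have "?z \<inter> y \<subseteq> x \<inter> y"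
  proof
    fix u assume u: "u \<in> ?z \<inter> y"
    then obtain c where "u - c *s v \<in> vec.span (x \<inter> perp {v})" unfolding vec.span_insert by blast
    then have c: "u - c *s v \<in> x \<inter> perp {v}"
      using x by (simp add: vec.span_eq_iff[THEN iffD2] subspace_Int)
    have "B (u - c *s v) p = 0" "B u p = 0"
      using isotropic_subset_perp[of x] isotropic_subset_perp[of y] x y p c u by (auto simp: vertex_iff perp_def)
    then have "c = 0" using Bv by (simp add: B_diff B_scale)
    then show "u \<in> x \<inter> y" using c u by auto
  qed
  moreover have "p \<notin> ?z" using Bv isotropic_subset_perp[of ?z] z by (auto simp: vertex_iff perp_def B_commute)
  ultimately have "?z \<inter> y \<subset> x \<inter> y" using p by blast
  moreover have "vec.subspace (?z \<inter> y)" "vec.subspace (x \<inter> y)"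
    using x y z(1) by (auto intro: subspace_Int)
  ultimately have "vec.dim (?z \<inter> y) < vec.dim (x \<inter> y)"
    using subspace_eqI[of "?z \<inter> y" "x \<inter> y"] by force
  then have "\<delta> x y < \<delta> ?z y" using dim_Int[OF x y] dim_Int[OF z(1) y] by simp
  moreover have "\<delta> ?z y \<le> 1 + \<delta> x y" using \<delta>_triangle[OF z(1) x y] z(2) \<delta>_commute[of x] by simp
  ultimately show thesis using that z(1,2) by simp
qed

lemma relpow_dp_adj_\<delta>: "x \<in> V \<Longrightarrow> (x, y) \<in> dp_adj Q ^^ k \<Longrightarrow> y \<in> V \<and> \<delta> x y \<le> k"
proof (induction k arbitrary: y)
  case (Suc k)
  then obtain z where z: "(x, z) \<in> dp_adj Q ^^ k" "(z, y) \<in> dp_adj Q" by auto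
  then have "z \<in> V" "\<delta> x z \<le> k" "y \<in> V" "\<delta> z y = 1" using Suc by (auto simp: dp_adj_iff)
  then show ?case using \<delta>_triangle[of x z y] Suc by simp
qed simp

lemma \<delta>_relpow: "x \<in> V \<Longrightarrow> y \<in> V \<Longrightarrow> (x, y) \<in> dp_adj Q ^^ \<delta> x y"
proof (induction "\<delta> x y" arbitrary: x)
  case 0
  then have "x = y" using \<delta>_eq_0_iff by simp
  then show ?case using 0 by simp
next
  case (Suc k)
  obtain z where z: "z \<in> V" "\<delta> x z = 1" "\<delta> z y = k"
    using closer_exists[OF Suc.prems Suc.hyps(2)[symmetric]] by blast
  then have "(z, y) \<in> dp_adj Q ^^ k" using Suc.hyps(1)[of z] Suc.prems by simp
  moreover have "(x, z) \<in> dp_adj Q" using z Suc.prems dp_adj_iff by simp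
  ultimately show ?case unfolding Suc.hyps(2)[symmetric] by (rule relpow_Suc_I2[rotated])
qed

lemma gdist_dp_adj: "x \<in> V \<Longrightarrow> y \<in> V \<Longrightarrow> gdist (dp_adj Q) x y = \<delta> x y"
  unfolding gdist_def by (rule Least_equality) (use \<delta>_relpow relpow_dp_adj_\<delta> in auto)

end

section \<open>One half of the dual polar graph\<close>

locale half_polar = polar_D Q n for Q :: "'a::{field,finite} ^ 'm \<Rightarrow> 'a" and n +
  fixes X :: "('a ^ 'm) set set"
  assumes half: "bipartite_half (dp_vertices Q) (dp_adj Q) X" and X_nonempty: "X \<noteq> {}"
begin

abbreviation R :: "(('a ^ 'm) set \<times> ('a ^ 'm) set) set" where "R \<equiv> halved_adj (dp_adj Q) X"

lemma X_sub: "x \<in> X \<Longrightarrow> x \<in> V"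
  using half by (auto simp: bipartite_half_def)

lemma parity: "x \<in> V \<Longrightarrow> y \<in> V \<Longrightarrow> even (\<delta> x y) \<longleftrightarrow> (x \<in> X \<longleftrightarrow> y \<in> X)"
proof (induction "\<delta> x y" arbitrary: x)
  case 0
  then have "x = y" using \<delta>_eq_0_iff by simp
  then show ?case using 0 by simp
next
  case (Suc k)
  obtain z where z: "z \<in> V" "\<delta> x z = 1" "\<delta> z y = k"
    using closer_exists[OF Suc.prems Suc.hyps(2)[symmetric]] by blast
  have "even k \<longleftrightarrow> (z \<in> X \<longleftrightarrow> y \<in> X)" using Suc.hyps(1)[of z] z Suc.prems by simp
  moreover have "(x, z) \<in> dp_adj Q" using z Suc.prems dp_adj_iff by simp
  then have "x \<in> X \<longleftrightarrow> z \<notin> X" using half by (auto simp: bipartite_half_def)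
  ultimately show ?case unfolding Suc.hyps(2)[symmetric] by auto
qed

lemma parity_X: "x \<in> X \<Longrightarrow> y \<in> X \<Longrightarrow> even (\<delta> x y)"
  using parity X_sub by blast

lemma R_iff: "(x, y) \<in> R \<longleftrightarrow> x \<in> X \<and> y \<in> X \<and> \<delta> x y = 2"
proof -
  have "(x, y) \<in> (dp_adj Q)\<^sup>*" if "x \<in> X" "y \<in> X"
    using \<delta>_relpow[of x y] that X_sub relpow_imp_rtrancl by blast
  then show ?thesis unfolding halved_adj_def using gdist_dp_adj X_sub by auto
qed

lemma closer_X:
  assumes x: "x \<in> X" and y: "y \<in> X" and d: "\<delta> x y = Suc (Suc k)"
  obtains z where "z \<in> X" "\<delta> x z = 2" "\<delta> z y = k" "x \<inter> y \<subseteq> z" "z \<subseteq> x + y"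
proof -
  obtain u where u: "u \<in> V" "\<delta> x u = 1" "\<delta> u y = Suc k" "x \<inter> y \<subseteq> u" "u \<subseteq> x + y"
    using closer_exists[OF X_sub[OF x] X_sub[OF y] d] by blast
  obtain z where z: "z \<in> V" "\<delta> u z = 1" "\<delta> z y = k" "u \<inter> y \<subseteq> z" "z \<subseteq> u + y"
    using closer_exists[OF u(1) X_sub[OF y] u(3)] by blast
  have "even (\<delta> z y)" using parity_X[OF x y] d z(3) by simp
  then have zX: "z \<in> X" using parity[OF z(1) X_sub[OF y]] y by simp
  have "\<delta> x z \<le> 2" using \<delta>_triangle[OF X_sub[OF x] u(1) z(1)] u z by simp
  moreover have "Suc (Suc k) \<le> \<delta> x z + k" using \<delta>_triangle[OF X_sub[OF x] z(1) X_sub[OF y]] z d by simp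
  ultimately have "\<delta> x z = 2" by simp
  moreover have "x \<inter> y \<subseteq> z" using u z by blast
  moreover have "u + y \<subseteq> x + y"
    using u(5) X_sub[OF x] X_sub[OF y] by (intro plus_least subspace_plus subset_plus2) auto
  then have "z \<subseteq> x + y" using z by blast
  ultimately show thesis using that zX z(3) by blast
qed

lemma relpow_R_\<delta>: "x \<in> X \<Longrightarrow> (x, y) \<in> R ^^ k \<Longrightarrow> y \<in> X \<and> \<delta> x y \<le> 2 * k"
proof (induction k arbitrary: y)
  case 0
  then show ?case using X_sub by simp
next
  case (Suc k)
  then obtain z where z: "(x, z) \<in> R ^^ k" "(z, y) \<in> R" by auto
  then have "z \<in> X" "\<delta> x z \<le> 2 * k" "y \<in> X" "\<delta> z y = 2" using Suc by (auto simp: R_iff)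
  then show ?case using \<delta>_triangle[of x z y] Suc X_sub by simp
qed

lemma \<delta>_relpow_R: "x \<in> X \<Longrightarrow> y \<in> X \<Longrightarrow> \<delta> x y = 2 * k \<Longrightarrow> (x, y) \<in> R ^^ k"
proof (induction k arbitrary: x)
  case 0
  then have "x = y" using \<delta>_eq_0_iff X_sub by simp
  then show ?case by simp
next
  case (Suc k)
  have "\<delta> x y = Suc (Suc (2 * k))" using Suc.prems(3) by simp
  then obtain z where z: "z \<in> X" "\<delta> x z = 2" "\<delta> z y = 2 * k"
    using closer_X[OF Suc.prems(1,2)] by blast
  then have "(z, y) \<in> R ^^ k" using Suc by simp
  moreover have "(x, z) \<in> R" using z Suc.prems R_iff by simp
  ultimately show ?case by (rule relpow_Suc_I2[rotated])
qed

lemma gdist_R: assumes "x \<in> X" "y \<in> X" shows "\<delta> x y = 2 * gdist R x y"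
proof -
  obtain k where k: "\<delta> x y = 2 * k" using parity_X[OF assms] by (auto elim: evenE)
  have "gdist R x y = k"
    unfolding gdist_def
  proof (rule Least_equality)
    show "(x, y) \<in> R ^^ k" by (rule \<delta>_relpow_R[OF assms k])
    show "k \<le> m" if "(x, y) \<in> R ^^ m" for m using relpow_R_\<delta>[OF assms(1) that] k by simp
  qed
  then show ?thesis using k by simp
qed

lemma far_pair: "2 * k \<le> n \<Longrightarrow> \<exists>x\<in>X. \<exists>y\<in>X. \<delta> x y = 2 * k"
proof (induction k)
  case 0
  obtain x where "x \<in> X" using X_nonempty by blast
  then show ?case using X_sub by (intro bexI[of _ x]) simp_all
next
  case (Suc k)
  then obtain x y where xy: "x \<in> X" "y \<in> X" "\<delta> x y = 2 * k" by auto
  have "\<delta> x y < n" using xy Suc by simp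
  then obtain u where u: "u \<in> V" "\<delta> u y = Suc (2 * k)"
    using farther_exists[OF X_sub[OF xy(1)] X_sub[OF xy(2)]] xy(3) by metis
  have "\<delta> u y < n" using u Suc by simp
  then obtain z where z: "z \<in> V" "\<delta> z y = Suc (Suc (2 * k))"
    using farther_exists[OF u(1) X_sub[OF xy(2)]] u(2) by metis
  then have "z \<in> X" using parity[OF z(1) X_sub[OF xy(2)]] xy by auto
  then show ?case using z xy by auto
qed

lemma finite_half: "finite X"
  by (rule finite_subset[of _ UNIV]) auto

lemma gdiam_R: "gdiam X R = n div 2"
  unfolding gdiam_def
proof (rule Max_eqI)
  have "{gdist R x y |x y. x \<in> X \<and> y \<in> X} = (\<lambda>(x, y). gdist R x y) ` (X \<times> X)" by auto
  then show "finite {gdist R x y |x y. x \<in> X \<and> y \<in> X}" using finite_half by simp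
  show "k \<le> n div 2" if k: "k \<in> {gdist R x y |x y. x \<in> X \<and> y \<in> X}" for k
  proof -
    obtain x y where xy: "x \<in> X" "y \<in> X" "k = gdist R x y" using k by blast
    then show ?thesis using gdist_R[OF xy(1,2)] \<delta>_le[OF X_sub[OF xy(1)] X_sub[OF xy(2)]] by simp
  qed
  obtain x y where xy: "x \<in> X" "y \<in> X" "\<delta> x y = 2 * (n div 2)" using far_pair[of "n div 2"] by auto
  then have "n div 2 = gdist R x y" using gdist_R[of x y] by simp
  then show "n div 2 \<in> {gdist R x y |x y. x \<in> X \<and> y \<in> X}" using xy by blast
qed

text \<open>Points and lines of the projective space on the quotient by a vertex \<open>x\<close>, which is the
  dual of \<open>x\<close>.\<close>

definition pts :: "('a ^ 'm) set \<Rightarrow> ('a ^ 'm) set \<Rightarrow> ('a ^ 'm) set set" where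
  "pts x S = {P. vec.subspace P \<and> x \<subseteq> P \<and> P \<subseteq> S \<and> vec.dim P = n + 1}"

definition lines :: "('a ^ 'm) set \<Rightarrow> ('a ^ 'm) set \<Rightarrow> ('a ^ 'm) set set" where
  "lines x S = {L. vec.subspace L \<and> x \<subseteq> L \<and> L \<subseteq> S \<and> vec.dim L = n + 2}"

lemma card_pts: "x \<in> V \<Longrightarrow> vec.subspace S \<Longrightarrow> x \<subseteq> S \<Longrightarrow> card (pts x S) = qnum CARD('a) (vec.dim S - n)"
  using card_between[of x S] by (simp add: pts_def)

lemma card_lines_through:
  assumes "P \<in> pts x S" "vec.subspace S"
  shows "card {L \<in> lines x S. P \<subseteq> L} = qnum CARD('a) (vec.dim S - (n + 1))"
proof -
  have "{L \<in> lines x S. P \<subseteq> L} = {L. vec.subspace L \<and> P \<subseteq> L \<and> L \<subseteq> S \<and> vec.dim L = vec.dim P + 1}"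
    using assms by (auto simp: lines_def pts_def)
  then show ?thesis using card_between[of P S] assms by (simp add: pts_def)
qed

text \<open>By the flip lemmas, x |-> z + x is a bijection onto the points over z inside S.\<close>

lemma card_opposite_neighbours:
  assumes z: "z \<in> V" and S: "vec.subspace S" "z \<subseteq> S"
  shows "card {x \<in> V. \<delta> z x = 1 \<and> x \<subseteq> S} = qnum CARD('a) (vec.dim S - n)"
proof -
  have "bij_betw (\<lambda>x. z + x) {x \<in> V. \<delta> z x = 1 \<and> x \<subseteq> S} (pts z S)"
    unfolding bij_betw_def
  proof
    show "inj_on (\<lambda>x. z + x) {x \<in> V. \<delta> z x = 1 \<and> x \<subseteq> S}"
      using flip_unique[OF z] by (intro inj_onI) blast
    show "(\<lambda>x. z + x) ` {x \<in> V. \<delta> z x = 1 \<and> x \<subseteq> S} = pts z S"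
    proof (intro equalityI subsetI)
      fix P assume "P \<in> (\<lambda>x. z + x) ` {x \<in> V. \<delta> z x = 1 \<and> x \<subseteq> S}"
      then obtain x where x: "x \<in> V" "\<delta> z x = 1" "x \<subseteq> S" "P = z + x" by blast
      then show "P \<in> pts z S" unfolding pts_def
        using z S dim_plus[of z x] subset_plus1[of x z] plus_least[of S z x] subspace_plus[of z x] by simp
    next
      fix P assume P: "P \<in> pts z S"
      obtain x where x: "x \<in> V" "z + x = P" "\<delta> z x = 1"
        using flip_exists[OF z, of P] P unfolding pts_def by blast
      have "x \<subseteq> S" using subset_plus2[of z x] z x P unfolding pts_def by blast
      then show "P \<in> (\<lambda>x. z + x) ` {x \<in> V. \<delta> z x = 1 \<and> x \<subseteq> S}" using x by blast
    qed
  qed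
  from bij_betw_same_card[OF this] show ?thesis using card_pts[OF z S] by simp
qed

text \<open>Modulo \<open>perp L\<close> the space L carries a hyperbolic quadric in dimension 4,
  with two reguli of 1 + l maximal isotropic subspaces each, l being the order of the field; the
  halves separate the reguli. The set counted is the regulus of x without x, found as the
  neighbourhood of a member o' of the other regulus.\<close>

lemma card_line_fibre:
  assumes x: "x \<in> X" and L: "L \<in> lines x UNIV"
  shows "card {z \<in> X. x + z = L} = CARD('a)"
proof -
  have xV: "x \<in> V" using x X_sub by blast
  have Ls: "vec.subspace L" "x \<subseteq> L" "vec.dim L = n + 2" using L by (auto simp: lines_def)
  obtain P where P: "vec.subspace P" "x \<subseteq> P" "P \<subseteq> L" "vec.dim P = n + 1"
    using exists_between[of x L "n + 1"] xV Ls by auto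
  obtain o' where o: "o' \<in> V" "x + o' = P" "\<delta> x o' = 1"
    using flip_exists[OF xV P(1,2,4)] by blast
  have oX: "o' \<notin> X" using parity[OF xV o(1)] o x by simp
  have oP: "o' \<subseteq> P" using o subset_plus2[of x o'] xV by blast
  have oL: "o' \<subseteq> L" using oP P by blast
  have x_in: "x \<in> {z \<in> V. \<delta> o' z = 1 \<and> z \<subseteq> L}" using xV o Ls \<delta>_commute[of x] by simp
  have eq: "{z \<in> X. x + z = L} = {z \<in> V. \<delta> o' z = 1 \<and> z \<subseteq> L} - {x}"
  proof (intro equalityI subsetI)
    fix z assume "z \<in> {z \<in> X. x + z = L}"
    then have z: "z \<in> X" "x + z = L" "z \<in> V" using X_sub by auto
    have zL: "z \<subseteq> L" using z subset_plus2[of x z] xV by blast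
    have "o' + z \<subseteq> L" using oL zL Ls by (intro plus_least) auto
    then have "vec.dim (o' + z) \<le> n + 2" using vec.dim_subset[of "o' + z" L] Ls(3) by simp
    then have "\<delta> o' z \<le> 2" using dim_plus[OF o(1) z(3)] by simp
    moreover have "odd (\<delta> o' z)" using parity[OF o(1) z(3)] z oX by blast
    ultimately have "\<delta> o' z = 1" by presburger
    moreover have "z \<noteq> x"
    proof
      assume "z = x"
      then have "vec.dim (x + x) = n + 2" using z(2) Ls by simp
      then show False using dim_plus[OF xV xV] xV by simp
    qed
    ultimately show "z \<in> {z \<in> V. \<delta> o' z = 1 \<and> z \<subseteq> L} - {x}" using z zL by blast
  next
    fix z assume "z \<in> {z \<in> V. \<delta> o' z = 1 \<and> z \<subseteq> L} - {x}"
    then have z: "z \<in> V" "\<delta> o' z = 1" "z \<subseteq> L" "z \<noteq> x" by auto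
    have zX: "z \<in> X" using parity[OF o(1) z(1)] z oX by simp
    have sub: "x + z \<subseteq> L" using z Ls by (intro plus_least) auto
    have "\<delta> x z \<noteq> 0" using \<delta>_eq_0_iff[OF xV z(1)] z by simp
    moreover have "even (\<delta> x z)" using parity_X[OF x zX] .
    ultimately have "2 \<le> \<delta> x z" by presburger
    then have "x + z = L" using sub Ls xV z dim_plus[OF xV z(1)] by (intro subspace_eqI subspace_plus) auto
    then show "z \<in> {z \<in> X. x + z = L}" using zX by blast
  qed
  have "card {z \<in> V. \<delta> o' z = 1 \<and> z \<subseteq> L} = qnum CARD('a) 2"
    using card_opposite_neighbours[OF o(1) Ls(1) oL] Ls by simp
  then show ?thesis unfolding eq using x_in by (simp add: qnum_def numeral_2_eq_2)
qed

end

section \<open>Lines through a vertex of a half\<close>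

lemma qnum_1 [simp]: "qnum q (Suc 0) = 1" and qnum_2: "qnum q 2 = 1 + q"
  by (simp_all add: qnum_def numeral_2_eq_2)

lemma qnum_rec: "qnum q (Suc k) = 1 + q * qnum q k"
  using qnum_add[of q 1 k] by simp

text \<open>Translates between the base l^2 of the classical parameters and the base l of subspace
  counts.\<close>

lemma qnum_square: "(1 + l) * qnum (l ^ 2) k = qnum l (2 * k)"
  by (induction k) (simp_all add: qnum_Suc algebra_simps power_mult power2_eq_square power_mult_distrib)

lemma qnum_strict_mono: assumes "0 < l" "i < j" shows "qnum l i < qnum (l :: nat) j"
proof -
  obtain k where "j = i + Suc k" using assms(2) less_imp_Suc_add by fastforce
  then show ?thesis using qnum_pos[OF assms(1), of "Suc k"] assms(1) by (simp only: qnum_add) simp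
qed

lemma qnum_less_iff: "0 < l \<Longrightarrow> qnum l i < qnum (l :: nat) j \<longleftrightarrow> i < j"
  using qnum_strict_mono[of l i j] qnum_strict_mono[of l j i] by (cases i j rule: linorder_cases) auto

lemma qnum_le_iff: "0 < l \<Longrightarrow> qnum l i \<le> qnum (l :: nat) j \<longleftrightarrow> i \<le> j"
  using qnum_less_iff[of l j i] by linarith

context half_polar
begin

lemma finite_lines [simp]: "finite (lines x S)" and finite_pts [simp]: "finite (pts x S)"
  by (rule finite_subset[of _ UNIV]; simp)+

lemma lines_mono: "S \<subseteq> S' \<Longrightarrow> lines x S \<subseteq> lines x S'" and pts_mono: "S \<subseteq> S' \<Longrightarrow> pts x S \<subseteq> pts x S'"
  by (auto simp: lines_def pts_def)

lemma card_pts_line: "x \<in> V \<Longrightarrow> L \<in> lines x S \<Longrightarrow> card (pts x L) = 1 + CARD('a)"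
  using card_pts[of x L] by (simp add: lines_def qnum_2)

lemma pts_of_line: "L \<in> lines x S \<Longrightarrow> P \<in> pts x L \<longleftrightarrow> P \<in> pts x S \<and> P \<subseteq> L"
  by (auto simp: lines_def pts_def)

lemma line_plus:
  assumes "P \<in> pts x S" "P' \<in> pts x S" "P \<noteq> P'" "vec.subspace S" "x \<in> V"
  shows "P + P' \<in> lines x S" "L \<in> lines x S \<Longrightarrow> P \<subseteq> L \<Longrightarrow> P' \<subseteq> L \<Longrightarrow> L = P + P'"
proof -
  have P: "vec.subspace P" "x \<subseteq> P" "P \<subseteq> S" "vec.dim P = n + 1"
    and P': "vec.subspace P'" "x \<subseteq> P'" "P' \<subseteq> S" "vec.dim P' = n + 1"
    using assms by (auto simp: pts_def)
  have "vec.dim (P \<inter> P') \<noteq> n + 1"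
  proof
    assume d: "vec.dim (P \<inter> P') = n + 1"
    then have "P \<inter> P' = P" "P \<inter> P' = P'" using P P' by (intro subspace_eqI subspace_Int; simp)+
    then show False using assms(3) by blast
  qed
  moreover have "vec.dim (P \<inter> P') \<le> n + 1" using vec.dim_subset[of "P \<inter> P'" P] P by simp
  moreover have "n \<le> vec.dim (P \<inter> P')" using vec.dim_subset[of x "P \<inter> P'"] P P' assms(5) by simp
  ultimately have dPP: "vec.dim (P + P') = n + 2" using dim_plus_Int[OF P(1) P'(1)] P P' by linarith
  have sPP: "vec.subspace (P + P')" using P P' by (intro subspace_plus)
  have "x \<subseteq> P + P'" using subset_plus1[OF P'(1), of P] P by blast
  moreover have "P + P' \<subseteq> S" using P P' assms(4) by (intro plus_least)
  ultimately show "P + P' \<in> lines x S" using sPP dPP by (simp add: lines_def)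
  show "L = P + P'" if "L \<in> lines x S" "P \<subseteq> L" "P' \<subseteq> L"
    using that dPP sPP plus_least[of L P P'] by (intro subspace_eqI[symmetric]) (auto simp: lines_def)
qed

text \<open>Double counting of incident points and lines. The factor stays on the left to avoid
  division, and later counts of lines are compared in this form.\<close>

lemma card_lines:
  assumes x: "x \<in> V" and S: "vec.subspace S" "x \<subseteq> S" "vec.dim S = n + k"
  shows "(1 + CARD('a)) * card (lines x S) = qnum CARD('a) k * qnum CARD('a) (k - 1)"
proof -
  have "(1 + CARD('a)) * card (lines x S) = (\<Sum>L\<in>lines x S. card {P \<in> pts x S. P \<subseteq> L})"
  proof -
    have "card {P \<in> pts x S. P \<subseteq> L} = 1 + CARD('a)" if "L \<in> lines x S" for L
    proof -
      have "{P \<in> pts x S. P \<subseteq> L} = pts x L" using pts_of_line[OF that] by blast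
      then show ?thesis using card_pts_line[OF x that] by simp
    qed
    then show ?thesis by simp
  qed
  also have "\<dots> = (\<Sum>P\<in>pts x S. card {L \<in> lines x S. P \<subseteq> L})"
    by (rule sum_multicount_gen) simp_all
  also have "\<dots> = (\<Sum>P\<in>pts x S. qnum CARD('a) (k - 1))"
    using card_lines_through[of _ x S] S by (intro sum.cong refl) simp
  also have "\<dots> = qnum CARD('a) k * qnum CARD('a) (k - 1)"
    using card_pts[OF x S(1,2)] S by simp
  finally show ?thesis .
qed

text \<open>The lines through P in S partition the other points of S. The summand \<open>f P\<close>
  on the left makes up for P being included in the total on the right.\<close>

lemma sum_lines_through:
  fixes f :: "('a ^ 'm) set \<Rightarrow> nat"
  assumes x: "x \<in> V" and S: "vec.subspace S" "vec.dim S = n + k" and P: "P \<in> pts x S"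
  shows "(\<Sum>L | L \<in> lines x S \<and> P \<subseteq> L. \<Sum>P'\<in>pts x L. f P') + f P = qnum CARD('a) (k - 1) * f P + (\<Sum>P'\<in>pts x S. f P')"
proof -
  let ?A = "{L. L \<in> lines x S \<and> P \<subseteq> L}"
  have fA: "finite ?A" by (rule finite_subset[of _ "lines x S"]) auto
  have PL: "P \<in> pts x L" if "L \<in> ?A" for L using that P by (auto simp: pts_def)
  have "(\<Sum>L\<in>?A. \<Sum>P'\<in>pts x L. f P') = (\<Sum>L\<in>?A. f P + (\<Sum>P'\<in>pts x L - {P}. f P'))"
    by (intro sum.cong refl) (simp add: sum.remove[OF _ PL])
  also have "\<dots> = card ?A * f P + (\<Sum>L\<in>?A. \<Sum>P'\<in>pts x L - {P}. f P')" by (simp add: sum.distrib)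
  also have "(\<Sum>L\<in>?A. \<Sum>P'\<in>pts x L - {P}. f P') = (\<Sum>P'\<in>(\<Union>L\<in>?A. pts x L - {P}). f P')"
  proof (rule sum.UNION_disjoint[symmetric])
    show "\<forall>L\<in>?A. \<forall>L'\<in>?A. L \<noteq> L' \<longrightarrow> (pts x L - {P}) \<inter> (pts x L' - {P}) = {}"
    proof (intro ballI impI)
      fix L L' assume L: "L \<in> ?A" "L' \<in> ?A" and "L \<noteq> L'"
      have False if p: "P' \<in> pts x L" "P' \<in> pts x L'" "P' \<noteq> P" for P'
      proof -
        have "P' \<in> pts x S" "P' \<subseteq> L" "P' \<subseteq> L'" using p L pts_of_line[of L x S P'] pts_of_line[of L' x S P'] by auto
        then show False using line_plus(2)[OF P, of P' L] line_plus(2)[OF P, of P' L'] p L S x \<open>L \<noteq> L'\<close> by simp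
      qed
      then show "(pts x L - {P}) \<inter> (pts x L' - {P}) = {}" by blast
    qed
  qed (use fA in auto)
  also have "(\<Union>L\<in>?A. pts x L - {P}) = pts x S - {P}"
  proof (intro equalityI subsetI)
    fix P' assume "P' \<in> pts x S - {P}"
    then have p: "P' \<in> pts x S" "P' \<noteq> P" by auto
    have sub: "vec.subspace P" "vec.subspace P'" using P p by (auto simp: pts_def)
    have L: "P + P' \<in> lines x S" using line_plus(1)[OF P p(1)] p S x by simp
    moreover have "P \<subseteq> P + P'" "P' \<subseteq> P + P'" using subset_plus1 subset_plus2 sub by blast+
    ultimately have "P + P' \<in> ?A" "P' \<in> pts x (P + P')" using pts_of_line[OF L] p by auto
    then show "P' \<in> (\<Union>L\<in>?A. pts x L - {P})" using p by blast
  qed (auto simp: lines_def pts_def)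
  finally have e: "(\<Sum>L\<in>?A. \<Sum>P'\<in>pts x L. f P') = card ?A * f P + sum f (pts x S - {P})" .
  have "card ?A = qnum CARD('a) (k - 1)" using card_lines_through[OF P S(1)] S by simp
  moreover have "(\<Sum>P'\<in>pts x S. f P') = f P + sum f (pts x S - {P})" using P by (simp add: sum.remove)
  ultimately show ?thesis using e by simp
qed

lemma point_through:
  assumes "x \<in> V" "v \<in> S" "v \<notin> x" "vec.subspace S" "x \<subseteq> S"
  shows "vec.span (insert v x) \<in> pts x S" "v \<in> vec.span (insert v x)"
proof -
  show "v \<in> vec.span (insert v x)" by (simp add: vec.span_base)
  have "x \<subseteq> vec.span (insert v x)" using vec.span_superset[of "insert v x"] by auto
  moreover have "vec.span (insert v x) \<subseteq> S" using assms by (intro vec.span_minimal) auto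
  ultimately show "vec.span (insert v x) \<in> pts x S"
    using dim_insert_subspace[of x v] assms by (simp add: pts_def)
qed

lemma line_of:
  assumes "x \<in> X" "z \<in> X" shows "x + z \<in> lines x UNIV \<longleftrightarrow> \<delta> x z = 2"
  using assms X_sub dim_plus[of x z] subset_plus1[of z x] subspace_plus[of x z] by (auto simp: lines_def)

lemma \<delta>_same_line:
  assumes x: "x \<in> X" and y: "y \<in> X" and z: "z \<in> X" and L: "vec.dim (x + y) = n + 2" "x + y = x + z" and ne: "y \<noteq> z"
  shows "\<delta> y z = 2"
proof -
  have V: "x \<in> V" "y \<in> V" "z \<in> V" using x y z X_sub by auto
  have "y + z \<subseteq> x + y" using V L(2) subset_plus2[of x y] subset_plus2[of x z] by (intro plus_least subspace_plus) auto
  then have "\<delta> y z \<le> 2" using vec.dim_subset[of "y + z" "x + y"] dim_plus[OF V(2,3)] L by simp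
  moreover have "even (\<delta> y z)" "\<delta> y z \<noteq> 0" using parity_X[OF y z] \<delta>_eq_0_iff[OF V(2,3)] ne by auto
  ultimately show ?thesis by presburger
qed

text \<open>Two neighbours of \<open>x\<close> on different lines are adjacent iff their lines meet.\<close>

lemma card_common_pts:
  assumes x: "x \<in> X" and y: "y \<in> X" "\<delta> x y = 2" and z: "z \<in> X" "\<delta> x z = 2"
  shows "card {P \<in> pts x (x + y). P \<subseteq> x + z}
    = of_bool (\<delta> y z = 2) + of_bool (z = y) + CARD('a) * of_bool (x + z = x + y)"
proof -
  have V: "x \<in> V" "y \<in> V" "z \<in> V" using x y z X_sub by auto
  have s: "vec.subspace (x + y)" "vec.subspace (x + z)" using V by (auto intro: subspace_plus)
  have d: "vec.dim (x + y) = n + 2" "vec.dim (x + z) = n + 2" using dim_plus V y z by auto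
  let ?I = "(x + y) \<inter> (x + z)"
  have xI: "x \<subseteq> ?I" using subset_plus1 V by auto
  have sI: "vec.subspace ?I" using s by (rule subspace_Int)
  have "{P \<in> pts x (x + y). P \<subseteq> x + z} = pts x ?I" by (auto simp: pts_def)
  then have c: "card {P \<in> pts x (x + y). P \<subseteq> x + z} = qnum CARD('a) (vec.dim ?I - n)"
    using card_pts[OF V(1) sI xI] by simp
  show ?thesis
  proof (cases "x + z = x + y")
    case True
    have "vec.dim ?I - n = 2" using True d by simp
    moreover have "\<delta> y z = 2 \<longleftrightarrow> z \<noteq> y"
      using \<delta>_same_line[OF x y(1) z(1) d(1) True[symmetric]] V by auto
    ultimately show ?thesis unfolding c using True by (simp add: qnum_2)
  next
    case False
    then have zy: "z \<noteq> y" by blast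
    have nI: "n \<le> vec.dim ?I" using vec.dim_subset[OF xI] V by simp
    have "vec.dim ?I \<noteq> n + 2"
    proof
      assume "vec.dim ?I = n + 2"
      then have "?I = x + y" "?I = x + z" using s sI d by (intro subspace_eqI; simp)+
      then show False using False by blast
    qed
    moreover have "vec.dim ?I \<le> n + 2" using vec.dim_subset[of ?I "x + y"] d by simp
    ultimately consider "vec.dim ?I = n + 1" | "vec.dim ?I = n" using nI by linarith
    then show ?thesis
    proof cases
      case 1
      \<comment> \<open>Concurrent lines span dimension n + 3, and evenness of \<delta> inside
        \<open>X\<close> excludes the value 3.\<close>
      have "vec.dim ((x + y) + (x + z)) = n + 3" using dim_plus_Int[OF s] d 1 by simp
      moreover have "y + z \<subseteq> (x + y) + (x + z)"
        using V by (intro set_plus_mono2 subset_plus2) auto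
      ultimately have "\<delta> y z \<le> 3" using vec.dim_subset[of "y + z" "(x + y) + (x + z)"] dim_plus[OF V(2,3)] by simp
      moreover have "even (\<delta> y z)" "\<delta> y z \<noteq> 0" using parity_X[OF y(1) z(1)] \<delta>_eq_0_iff[OF V(2,3)] zy by auto
      ultimately have "\<delta> y z = 2" by presburger
      then show ?thesis unfolding c using 1 zy False by simp
    next
      case 2
      have I: "?I = x" using xI sI V 2 by (intro subspace_eqI[symmetric]) auto
      have dp: "vec.dim ((x + y) + (x + z)) = n + 4" using dim_plus_Int[OF s] d 2 by simp
      \<comment> \<open>Disjoint lines: a vector of y \<inter> z is orthogonal to x \<inter> y =
        perp (x + y) and to x \<inter> z, so it lies in both lines and hence in x. Then y \<inter> z
        is contained in a space of dimension n - 4, too small for \<delta> y z = 2.\<close>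
      have "y \<inter> z \<subseteq> x"
      proof
        fix v assume v: "v \<in> y \<inter> z"
        have "v \<in> perp (x \<inter> y)" "v \<in> perp (x \<inter> z)"
          using v perp_antimono[of "x \<inter> y" y] perp_antimono[of "x \<inter> z" z] perp_vertex V by auto
        then have "v \<in> perp (perp (x + y)) \<inter> perp (perp (x + z))" using perp_vertex_plus V by simp
        then show "v \<in> x" using I perp_perp[OF s(1)] perp_perp[OF s(2)] by blast
      qed
      then have "y \<inter> z \<subseteq> perp ((x + y) + (x + z))"
        using perp_plus[OF s] perp_vertex_plus V by auto
      then have "vec.dim (y \<inter> z) \<le> vec.dim (perp ((x + y) + (x + z)))" by (rule vec.dim_subset)
      then have "\<delta> y z \<noteq> 2" using dim_perp[OF subspace_plus[OF s]] dp dim_Int[OF V(2,3)] by linarith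
      then show ?thesis unfolding c using 2 zy False by simp
    qed
  qed
qed

section \<open>Counting neighbours by their lines\<close>

definition line_count :: "('a ^ 'm) set set \<Rightarrow> ('a ^ 'm) set \<Rightarrow> ('a ^ 'm) set \<Rightarrow> nat" where
  "line_count Z x L = card {z \<in> Z. x + z = L}"

text \<open>Count pairs of a neighbour z of x in Z and a point on both lines x + y and x + z.
  \<open>card_common_pts\<close> gives the contribution of each z; the extra terms on the left come
  from z = y and from the z on the line of y.\<close>

lemma common_neighbours:
  assumes Z: "Z \<subseteq> X" and x: "x \<in> X" and y: "y \<in> X" "\<delta> x y = 2"
  shows "card {z \<in> Z. \<delta> x z = 2 \<and> \<delta> y z = 2} + of_bool (y \<in> Z) + CARD('a) * line_count Z x (x + y)
    = (\<Sum>P\<in>pts x (x + y). card {z \<in> Z. \<delta> x z = 2 \<and> P \<subseteq> x + z})"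
proof -
  have fZ: "finite Z" using Z finite_half finite_subset by blast
  let ?N = "{z \<in> Z. \<delta> x z = 2}"
  have fN: "finite ?N" using fZ by simp
  have "(\<Sum>P\<in>pts x (x + y). card {z \<in> Z. \<delta> x z = 2 \<and> P \<subseteq> x + z}) = (\<Sum>P\<in>pts x (x + y). card {z \<in> ?N. P \<subseteq> x + z})"
    by (intro sum.cong refl arg_cong[of _ _ card]) auto
  also have "\<dots> = (\<Sum>z\<in>?N. card {P \<in> pts x (x + y). P \<subseteq> x + z})"
    by (rule sum_multicount_gen) (use fN in auto)
  also have "\<dots> = (\<Sum>z\<in>?N. of_bool (\<delta> y z = 2) + of_bool (z = y) + CARD('a) * of_bool (x + z = x + y))"
    by (intro sum.cong refl card_common_pts x y) (use Z in auto)
  also have "\<dots> = card {z \<in> ?N. \<delta> y z = 2} + card {z \<in> ?N. z = y} + CARD('a) * card {z \<in> ?N. x + z = x + y}"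
    using fN by (simp add: sum.distrib sum_distrib_left[symmetric] Collect_conj_eq Int_assoc Int_Collect)
  also have "{z \<in> ?N. z = y} = (if y \<in> Z then {y} else {})" using y by auto
  also have "{z \<in> ?N. x + z = x + y} = {z \<in> Z. x + z = x + y}"
  proof -
    have "\<delta> x z = 2" if "z \<in> Z" "x + z = x + y" for z
      using dim_plus[of x z] dim_plus[of x y] that Z x y X_sub by (metis add_left_cancel subsetD)
    then show ?thesis by blast
  qed
  also have "{z \<in> ?N. \<delta> y z = 2} = {z \<in> Z. \<delta> x z = 2 \<and> \<delta> y z = 2}" by auto
  finally show ?thesis unfolding line_count_def by (simp split: if_splits)
qed

lemma sum_line_count:
  assumes Z: "Z \<subseteq> X" and x: "x \<in> X" and A: "A \<subseteq> lines x UNIV"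
  shows "(\<Sum>L\<in>A. line_count Z x L) = card {z \<in> Z. x + z \<in> A}"
proof -
  have fZ: "finite Z" using Z finite_half finite_subset by blast
  have fA: "finite A" using A finite_lines finite_subset by blast
  have "card {z \<in> Z. x + z \<in> A} = card (\<Union>L\<in>A. {z \<in> Z. x + z = L})"
    by (rule arg_cong[of _ _ card]) auto
  also have "\<dots> = (\<Sum>L\<in>A. card {z \<in> Z. x + z = L})"
    by (rule card_UN_disjoint) (use fZ fA in auto)
  finally show ?thesis unfolding line_count_def by simp
qed

lemma card_neighbours_through:
  assumes Z: "Z \<subseteq> X" and x: "x \<in> X" and P: "P \<in> pts x UNIV"
  shows "card {z \<in> Z. \<delta> x z = 2 \<and> P \<subseteq> x + z} = (\<Sum>L | L \<in> lines x UNIV \<and> P \<subseteq> L. line_count Z x L)"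
proof -
  have "{z \<in> Z. \<delta> x z = 2 \<and> P \<subseteq> x + z} = {z \<in> Z. x + z \<in> {L. L \<in> lines x UNIV \<and> P \<subseteq> L}}"
    using line_of[OF x] Z by blast
  then show ?thesis using sum_line_count[OF Z x, of "{L. L \<in> lines x UNIV \<and> P \<subseteq> L}"] by auto
qed

lemma card_neighbours:
  assumes Z: "Z \<subseteq> X" and x: "x \<in> X"
  shows "card {z \<in> Z. \<delta> x z = 2} = (\<Sum>L\<in>lines x UNIV. line_count Z x L)"
proof -
  have "{z \<in> Z. \<delta> x z = 2} = {z \<in> Z. x + z \<in> lines x UNIV}" using line_of[OF x] Z by blast
  then show ?thesis using sum_line_count[OF Z x, of "lines x UNIV"] by simp
qed

lemma line_count_X: "x \<in> X \<Longrightarrow> L \<in> lines x UNIV \<Longrightarrow> line_count X x L = CARD('a)"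
  unfolding line_count_def by (rule card_line_fibre)

lemma valency_X:
  assumes x: "x \<in> X"
  shows "(1 + CARD('a)) * card {z \<in> X. \<delta> x z = 2} = CARD('a) * (qnum CARD('a) n * qnum CARD('a) (n - 1))"
proof -
  have "card {z \<in> X. \<delta> x z = 2} = CARD('a) * card (lines x UNIV)"
    using card_neighbours[OF subset_refl x] line_count_X[OF x] by simp
  then have "(1 + CARD('a)) * card {z \<in> X. \<delta> x z = 2} = CARD('a) * ((1 + CARD('a)) * card (lines x UNIV))"
    by (simp only: mult.left_commute)
  then show ?thesis using card_lines[OF X_sub[OF x], of UNIV n] by (simp only: vec.subspace_UNIV subset_UNIV vec.dim_UNIV card_cart_basis mult_2)
qed

lemma common_neighbours_X:
  assumes x: "x \<in> X" and y: "y \<in> X" "\<delta> x y = 2"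
  shows "card {z \<in> X. \<delta> x z = 2 \<and> \<delta> y z = 2} + 1 + CARD('a) ^ 2 = (1 + CARD('a)) * (CARD('a) * qnum CARD('a) (n - 1))"
proof -
  have L: "x + y \<in> lines x UNIV" using line_of[OF x y(1)] y by simp
  have "card {z \<in> X. \<delta> x z = 2 \<and> P \<subseteq> x + z} = CARD('a) * qnum CARD('a) (n - 1)" if "P \<in> pts x (x + y)" for P
  proof -
    have P: "P \<in> pts x UNIV" using that by (auto simp: pts_def)
    have "(\<Sum>L | L \<in> lines x UNIV \<and> P \<subseteq> L. line_count X x L) = (\<Sum>L | L \<in> lines x UNIV \<and> P \<subseteq> L. CARD('a))"
      by (intro sum.cong refl line_count_X x) auto
    then show ?thesis using card_neighbours_through[OF subset_refl x P] card_lines_through[OF P] by simp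
  qed
  then show ?thesis
    using common_neighbours[OF subset_refl x y] card_pts_line[OF X_sub[OF x] L] line_count_X[OF x L] y(1)
    by (simp add: power2_eq_square)
qed

end

section \<open>Local structure of a descendent\<close>

text \<open>Elimination of the second cosine \<sigma>; the first one is -1/\<beta>. The assumptions
  X and Y are the neighbour identities of the graph and of the descendent at an adjacent vertex,
  with D and W standing for [d] and [w], a and c for the numbers of common neighbours, and
  \<epsilon> for membership in the descendent.\<close>

lemma neighbour_equations:
  fixes \<sigma> :: real
  assumes \<beta>: "\<beta> > 0" and D: "D > 1"
    and X: "1 - a / \<beta> + (D * \<beta> - 1 - a) * \<sigma> = D / \<beta>"
    and Y: "\<epsilon> - c / \<beta> + (W * \<beta> - \<epsilon> - c) * \<sigma> = W / \<beta>"
  shows "c * (D - 1) = \<epsilon> * ((\<beta> - 1) * (D - 1) - (a + 1 - \<beta>)) + W * (a + 1 - \<beta>)"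
proof -
  define s where "s = \<beta> * \<sigma>"
  \<comment> \<open>u is \<beta> times the difference of the second and the first cosine, and v is
    \<beta>^2 times the difference of the second cosine and the square of the first. In these terms
    both identities are linear and homogeneous.\<close>
  define u where "u = 1 + s"
  define v where "v = \<beta> * s - 1"
  have "\<beta> * (1 - a / \<beta> + (D * \<beta> - 1 - a) * \<sigma>) = \<beta> * (D / \<beta>)" using X by simp
  then have "\<beta> - a + (D * \<beta> - 1 - a) * s = D" using \<beta> unfolding s_def by (simp add: algebra_simps)
  then have e1: "(\<beta> - 1 - a) * u = - (D - 1) * v" unfolding u_def v_def by (simp add: algebra_simps)
  have "\<beta> * (\<epsilon> - c / \<beta> + (W * \<beta> - \<epsilon> - c) * \<sigma>) = \<beta> * (W / \<beta>)" using Y by simp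
  then have "\<beta> * \<epsilon> - c + (W * \<beta> - \<epsilon> - c) * s = W" using \<beta> unfolding s_def by (simp add: algebra_simps)
  then have e2: "c * u = \<epsilon> * (\<beta> - 1) * u + (W - \<epsilon>) * v" unfolding u_def v_def by (simp add: algebra_simps)
  have "u \<noteq> 0"
  proof
    assume "u = 0"
    then have "s = -1" unfolding u_def by simp
    moreover have "v = 0" using e1 \<open>u = 0\<close> D by simp
    ultimately show False using \<beta> unfolding v_def by simp
  qed
  moreover have "(c * (D - 1)) * u = (\<epsilon> * ((\<beta> - 1) * (D - 1) - (a + 1 - \<beta>)) + W * (a + 1 - \<beta>)) * u"
  proof -
    have "(c * (D - 1)) * u = (D - 1) * (\<epsilon> * (\<beta> - 1) * u) + (W - \<epsilon>) * ((D - 1) * v)"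
      using arg_cong[OF e2, of "\<lambda>t. (D - 1) * t"] by (simp add: algebra_simps)
    also have "(D - 1) * v = (a + 1 - \<beta>) * u" using e1 by (simp add: algebra_simps)
    finally show ?thesis by (simp add: algebra_simps)
  qed
  ultimately show ?thesis by simp
qed

text \<open>In the half, the distance of \<open>x\<close> and \<open>y\<close> is \<open>\<delta> x y div 2\<close>.\<close>

locale half_descendent = half_polar Q n X
  for Q :: "'a::{field,finite} ^ 'm \<Rightarrow> 'a" and n X +
  fixes l d w :: nat and \<sigma> :: "nat \<Rightarrow> real" and Y :: "('a ^ 'm) set set"
  assumes card_field: "CARD('a) = l" and d3: "3 \<le> d" and n_cases: "n = 2 * d \<or> n = 2 * d + 1"
    and Y_sub: "Y \<subseteq> X" and Y_ne: "Y \<noteq> {}" and w1: "1 \<le> w" and wd: "w < d"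
    and width_Y: "\<And>x y. x \<in> Y \<Longrightarrow> y \<in> Y \<Longrightarrow> \<delta> x y \<le> 2 * w"
    and \<sigma>_0: "\<sigma> 0 = 1"
    and \<sigma>_X: "\<And>x y. x \<in> X \<Longrightarrow> y \<in> X \<Longrightarrow>
      (\<Sum>z | z \<in> X \<and> \<delta> x z = 2. \<sigma> (\<delta> y z div 2)) = - real (qnum (l ^ 2) d) * \<sigma> (\<delta> y x div 2)"
    and \<sigma>_Y: "\<And>x y. x \<in> Y \<Longrightarrow> y \<in> X \<Longrightarrow>
      (\<Sum>z | z \<in> Y \<and> \<delta> x z = 2. \<sigma> (\<delta> y z div 2)) = - real (qnum (l ^ 2) w) * \<sigma> (\<delta> y x div 2)"
    and \<sigma>_clique: "\<And>C y. C \<subseteq> X \<Longrightarrow> (\<Sum>x\<in>C. \<Sum>y\<in>C. \<sigma> (\<delta> x y div 2)) = 0 \<Longrightarrow> y \<in> X \<Longrightarrow>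
      (\<Sum>x\<in>C. \<sigma> (\<delta> y x div 2)) = 0"
begin

lemma l2: "2 \<le> l"
  using card_field_ge_2[where 'a='a] by (simp add: card_field)

lemma YX: "x \<in> Y \<Longrightarrow> x \<in> X"
  using Y_sub by blast

lemma finite_sub_X: "Z \<subseteq> X \<Longrightarrow> finite Z"
  using finite_half finite_subset by blast

text \<open>The q-number [k] in base l, where k is the odd one of n - 1 and n. Then l m is the
  classical parameter \<beta>, and the valency is l m times [d] in base l^2.\<close>

definition m :: nat where
  "m = (if n = 2 * d then qnum l (n - 1) else qnum l n)"

lemma m_gt: "1 + l < m"
proof -
  have "qnum l 2 < m" unfolding m_def using l2 d3 n_cases by (auto intro!: qnum_strict_mono)
  then show ?thesis by (simp add: qnum_2)
qed

lemma card_neighbours_X: assumes x: "x \<in> X" shows "card {z \<in> X. \<delta> x z = 2} = l * m * qnum (l ^ 2) d"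
proof -
  have "(1 + l) * card {z \<in> X. \<delta> x z = 2} = l * (qnum l n * qnum l (n - 1))"
    using valency_X[OF x] unfolding card_field .
  also have "qnum l n * qnum l (n - 1) = m * qnum l (2 * d)" unfolding m_def using n_cases by auto
  also have "l * (m * qnum l (2 * d)) = (1 + l) * (l * m * qnum (l ^ 2) d)"
    unfolding qnum_square[symmetric] by (simp add: algebra_simps)
  finally show ?thesis unfolding mult_cancel1 by simp
qed

lemma qd_gt: "1 < qnum (l ^ 2) d" "qnum (l ^ 2) w < qnum (l ^ 2) d" "0 < qnum (l ^ 2) w"
proof -
  have "qnum (l ^ 2) 1 < qnum (l ^ 2) d" using l2 d3 by (intro qnum_strict_mono) auto
  then show "1 < qnum (l ^ 2) d" by simp
  show "qnum (l ^ 2) w < qnum (l ^ 2) d" using l2 wd by (intro qnum_strict_mono) auto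
  show "0 < qnum (l ^ 2) w" using l2 w1 by (intro qnum_pos) auto
qed

text \<open>The neighbour identity at y = x: this is the eigenvalue -[d] divided by the
  valency.\<close>

lemma \<sigma>_1: "\<sigma> 1 = - 1 / real (l * m)"
proof -
  obtain x where x: "x \<in> X" using X_nonempty by blast
  have "(\<Sum>z | z \<in> X \<and> \<delta> x z = 2. \<sigma> (\<delta> x z div 2)) = (\<Sum>z | z \<in> X \<and> \<delta> x z = 2. \<sigma> 1)"
    by (intro sum.cong refl) auto
  also have "\<dots> = real (card {z \<in> X. \<delta> x z = 2}) * \<sigma> 1" by simp
  also have "\<dots> = real (l * m * qnum (l ^ 2) d) * \<sigma> 1" unfolding card_neighbours_X[OF x] ..
  finally have e: "(\<Sum>z | z \<in> X \<and> \<delta> x z = 2. \<sigma> (\<delta> x z div 2)) = real (l * m * qnum (l ^ 2) d) * \<sigma> 1" .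
  have "real (l * m * qnum (l ^ 2) d) * \<sigma> 1 = - real (qnum (l ^ 2) d)"
    unfolding e[symmetric] \<sigma>_X[OF x x] using X_sub[OF x] \<sigma>_0 by simp
  then have "real (qnum (l ^ 2) d) * (real (l * m) * \<sigma> 1) = real (qnum (l ^ 2) d) * (- 1)"
    by (simp add: algebra_simps)
  then have "real (l * m) * \<sigma> 1 = - 1" using qd_gt(1) by (simp only: mult_cancel_left) auto
  moreover have "real (l * m) \<noteq> 0" using l2 m_gt by simp
  ultimately show ?thesis by (simp add: field_simps)
qed

text \<open>The identity for \<open>Y\<close> at y = x, now that \<sigma> 1 is known. Compared with
  the whole graph, [d] is replaced by [w].\<close>

lemma card_neighbours_Y: assumes x: "x \<in> Y" shows "card {z \<in> Y. \<delta> x z = 2} = l * m * qnum (l ^ 2) w"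
proof -
  have "(\<Sum>z | z \<in> Y \<and> \<delta> x z = 2. \<sigma> (\<delta> x z div 2)) = (\<Sum>z | z \<in> Y \<and> \<delta> x z = 2. \<sigma> 1)"
    by (intro sum.cong refl) auto
  also have "\<dots> = real (card {z \<in> Y. \<delta> x z = 2}) * \<sigma> 1" by simp
  finally have "real (card {z \<in> Y. \<delta> x z = 2}) * \<sigma> 1 = - real (qnum (l ^ 2) w)"
    using \<sigma>_Y[OF x YX[OF x]] X_sub[OF YX[OF x]] \<sigma>_0 by simp
  then have "real (card {z \<in> Y. \<delta> x z = 2}) / real (l * m) = real (qnum (l ^ 2) w)" unfolding \<sigma>_1 by simp
  moreover have "real (l * m) \<noteq> 0" using l2 m_gt by simp
  ultimately have "real (card {z \<in> Y. \<delta> x z = 2}) = real (l * m * qnum (l ^ 2) w)" by (simp add: field_simps)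
  then show ?thesis by (simp only: of_nat_eq_iff)
qed

lemma \<sigma>_sum_adjacent:
  assumes Z: "Z \<subseteq> X" and x: "x \<in> X" and y: "y \<in> X" "\<delta> x y = 2"
  shows "(\<Sum>z | z \<in> Z \<and> \<delta> x z = 2. \<sigma> (\<delta> y z div 2)) =
    of_bool (y \<in> Z) + real (card {z \<in> Z. \<delta> x z = 2 \<and> \<delta> y z = 2}) * \<sigma> 1
    + (real (card {z \<in> Z. \<delta> x z = 2}) - of_bool (y \<in> Z) - real (card {z \<in> Z. \<delta> x z = 2 \<and> \<delta> y z = 2})) * \<sigma> 2"
proof -
  let ?N = "{z. z \<in> Z \<and> \<delta> x z = 2}"
  let ?A = "{z. z \<in> Z \<and> \<delta> x z = 2 \<and> z = y}"
  let ?B = "{z. z \<in> Z \<and> \<delta> x z = 2 \<and> \<delta> y z = 2}"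
  let ?C = "{z. z \<in> Z \<and> \<delta> x z = 2 \<and> \<delta> y z = 4}"
  have fin: "finite ?A" "finite ?B" "finite ?C" using finite_sub_X[OF Z] by simp_all
  have yy: "\<delta> y y = 0" using X_sub[OF y(1)] by simp
  have "\<delta> y z = 0 \<or> \<delta> y z = 2 \<or> \<delta> y z = 4" if "z \<in> ?N" for z
  proof -
    have z: "z \<in> X" "\<delta> x z = 2" using that Z by auto
    have "\<delta> y z \<le> \<delta> y x + \<delta> x z" by (rule \<delta>_triangle) (use X_sub x y z in auto)
    then have "\<delta> y z \<le> 4" using y(2) z(2) \<delta>_commute[of x y] by simp
    moreover have "even (\<delta> y z)" using parity_X[OF y(1) z(1)] .
    ultimately show ?thesis by presburger
  qed
  moreover have "\<delta> y z = 0 \<longleftrightarrow> z = y" if "z \<in> ?N" for z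
    using that Z \<delta>_eq_0_iff[of y z] X_sub[OF y(1)] X_sub[of z] by auto
  ultimately have N: "?N = ?A \<union> (?B \<union> ?C)" by blast
  have dis: "?A \<inter> (?B \<union> ?C) = {}" "?B \<inter> ?C = {}" using yy by auto
  have A: "?A = (if y \<in> Z then {y} else {})" using y by auto
  have cN: "card ?N = card ?A + (card ?B + card ?C)"
    unfolding N using fin dis by (simp add: card_Un_disjoint)
  have "(\<Sum>z\<in>?N. \<sigma> (\<delta> y z div 2)) = (\<Sum>z\<in>?A. \<sigma> (\<delta> y z div 2)) + ((\<Sum>z\<in>?B. \<sigma> (\<delta> y z div 2)) + (\<Sum>z\<in>?C. \<sigma> (\<delta> y z div 2)))"
    unfolding N using fin dis by (simp add: sum.union_disjoint)
  also have "(\<Sum>z\<in>?A. \<sigma> (\<delta> y z div 2)) = of_bool (y \<in> Z)" unfolding A using \<sigma>_0 yy by simp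
  also have "(\<Sum>z\<in>?B. \<sigma> (\<delta> y z div 2)) = (\<Sum>z\<in>?B. \<sigma> 1)" by (intro sum.cong refl) auto
  also have "(\<Sum>z\<in>?C. \<sigma> (\<delta> y z div 2)) = (\<Sum>z\<in>?C. \<sigma> 2)" by (intro sum.cong refl) auto
  finally have e: "(\<Sum>z\<in>?N. \<sigma> (\<delta> y z div 2)) = of_bool (y \<in> Z) + (real (card ?B) * \<sigma> 1 + real (card ?C) * \<sigma> 2)" by simp
  have "card ?A = of_bool (y \<in> Z)" unfolding A by simp
  then have "real (card ?C) = real (card ?N) - of_bool (y \<in> Z) - real (card ?B)" using cN by simp
  then show ?thesis using e by simp
qed

text \<open>The identities for \<open>X\<close> and \<open>Y\<close> at an adjacent y share the
  unknown \<sigma> 2. Once \<open>neighbour_equations\<close> has removed it, the count depends on y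
  only through membership in \<open>Y\<close>.\<close>

lemma card_common_Y:
  assumes x: "x \<in> Y" and y: "y \<in> X" "\<delta> x y = 2"
  shows "real (card {z \<in> Y. \<delta> x z = 2 \<and> \<delta> y z = 2})
    = of_bool (y \<in> Y) * (real (l * m) - 1 - real l - real l ^ 2) + real l * real (qnum l (2 * w))"
proof -
  define \<beta> where "\<beta> = real (l * m)"
  define a where "a = real (card {z \<in> X. \<delta> x z = 2 \<and> \<delta> y z = 2})"
  define c where "c = real (card {z \<in> Y. \<delta> x z = 2 \<and> \<delta> y z = 2})"
  define \<epsilon> where "\<epsilon> = (of_bool (y \<in> Y) :: real)"
  define D where "D = real (qnum (l ^ 2) d)"
  define W where "W = real (qnum (l ^ 2) w)"
  have \<beta>: "\<beta> > 0" unfolding \<beta>_def using l2 m_gt by simp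
  have D1: "D > 1" unfolding D_def using qd_gt by simp
  have s1: "\<sigma> 1 = - 1 / \<beta>" unfolding \<beta>_def by (rule \<sigma>_1)
  have yx: "\<delta> y x div 2 = 1" using y \<delta>_commute[of x y] by simp
  have nX: "real (card {z \<in> X. \<delta> x z = 2}) = D * \<beta>"
    using card_neighbours_X[OF YX[OF x]] unfolding D_def \<beta>_def by simp
  have nY: "real (card {z \<in> Y. \<delta> x z = 2}) = W * \<beta>"
    using card_neighbours_Y[OF x] unfolding W_def \<beta>_def by simp
  have "1 + a * \<sigma> 1 + (D * \<beta> - 1 - a) * \<sigma> 2 = - D * \<sigma> 1"
    using \<sigma>_sum_adjacent[OF subset_refl YX[OF x] y] \<sigma>_X[OF YX[OF x] y(1)] y(1)
    unfolding yx nX a_def[symmetric] D_def[symmetric] by simp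
  then have eX: "1 - a / \<beta> + (D * \<beta> - 1 - a) * \<sigma> 2 = D / \<beta>" unfolding s1 by simp
  have "\<epsilon> + c * \<sigma> 1 + (W * \<beta> - \<epsilon> - c) * \<sigma> 2 = - W * \<sigma> 1"
    using \<sigma>_sum_adjacent[OF Y_sub YX[OF x] y] \<sigma>_Y[OF x y(1)]
    unfolding yx nY c_def[symmetric] W_def[symmetric] \<epsilon>_def[symmetric] by simp
  then have eY: "\<epsilon> - c / \<beta> + (W * \<beta> - \<epsilon> - c) * \<sigma> 2 = W / \<beta>" unfolding s1 by simp
  have key: "c * (D - 1) = \<epsilon> * ((\<beta> - 1) * (D - 1) - (a + 1 - \<beta>)) + W * (a + 1 - \<beta>)"
    by (rule neighbour_equations[OF \<beta> D1 eX eY])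
  define b where "b = real (qnum l (n - 1))"
  define L where "L = real l"
  have sqD: "(1 + L) * D = real (qnum l (2 * d))" unfolding D_def L_def
    using arg_cong[OF qnum_square[of l d], of real] by (simp add: algebra_simps)
  have sqW: "(1 + L) * W = real (qnum l (2 * w))" unfolding W_def L_def
    using arg_cong[OF qnum_square[of l w], of real] by (simp add: algebra_simps)
  have nr: "real (qnum l n) = 1 + L * b"
    using arg_cong[OF qnum_rec[of l "n - 1"], of real] d3 n_cases unfolding b_def L_def by auto
  have aX: "a + 1 + L ^ 2 = (1 + L) * (L * b)"
    using arg_cong[OF common_neighbours_X[OF YX[OF x] y], of real]
    unfolding card_field a_def L_def b_def by (simp add: algebra_simps)
  \<comment> \<open>In classical parameters this is \<alpha> ([d] - 1) with \<alpha> = l (1 + l),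
    for both parities of n.\<close>
  have "a + 1 - \<beta> = L * ((1 + L) * D - 1 - L)"
    using n_cases
  proof
    assume n: "n = 2 * d"
    have "\<beta> = L * b" unfolding \<beta>_def m_def b_def L_def using n by simp
    moreover have "(1 + L) * D = 1 + L * b" using sqD nr n by simp
    ultimately show ?thesis using aX by (simp add: algebra_simps power2_eq_square)
  next
    assume n: "n = 2 * d + 1"
    have "\<beta> = L * (1 + L * b)" unfolding \<beta>_def m_def L_def[symmetric] of_nat_mult using n nr L_def by simp
    moreover have "(1 + L) * D = b" using sqD n b_def by simp
    ultimately show ?thesis using aX by (simp add: algebra_simps power2_eq_square)
  qed
  then have A: "a + 1 - \<beta> = L * (1 + L) * (D - 1)" by (simp add: algebra_simps)
  have "c * (D - 1) = (\<epsilon> * (\<beta> - 1 - L * (1 + L)) + W * (L * (1 + L))) * (D - 1)"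
    using key unfolding A by (simp add: algebra_simps)
  then have "c = \<epsilon> * (\<beta> - 1 - L * (1 + L)) + W * (L * (1 + L))" using D1 by simp
  also have "W * (L * (1 + L)) = L * ((1 + L) * W)" by (simp add: algebra_simps)
  finally have "c = \<epsilon> * (\<beta> - 1 - L * (1 + L)) + L * real (qnum l (2 * w))" unfolding sqW .
  then show ?thesis unfolding c_def \<epsilon>_def \<beta>_def L_def by (simp add: algebra_simps power2_eq_square)
qed

lemma sum_points_Y:
  assumes x: "x \<in> Y" and y: "y \<in> X" "\<delta> x y = 2"
  shows "real (\<Sum>P\<in>pts x (x + y). card {z \<in> Y. \<delta> x z = 2 \<and> P \<subseteq> x + z})
    = real l * real (line_count Y x (x + y)) + of_bool (y \<in> Y) * (real (l * m) - real l - real l ^ 2)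
      + real l * real (qnum l (2 * w))"
  using arg_cong[OF common_neighbours[OF Y_sub YX[OF x] y], of real] card_common_Y[OF x y]
  unfolding card_field by (cases "y \<in> Y") simp_all

text \<open>As y and z determine the same line, the two instances of \<open>sum_points_Y\<close>
  could differ only in the membership term, whose coefficient l (m - 1 - l) is positive.\<close>

lemma line_full:
  assumes x: "x \<in> Y" and y: "y \<in> X" "\<delta> x y = 2" and z: "z \<in> Y" "x + y = x + z" shows "y \<in> Y"
proof (rule ccontr)
  assume ny: "y \<notin> Y"
  have "\<delta> x z = 2" using line_of[OF YX[OF x] y(1)] line_of[OF YX[OF x] YX[OF z(1)]] y z by simp
  then have "real (l * m) - real l - real l ^ 2 = 0"
    using sum_points_Y[OF x y] sum_points_Y[OF x YX[OF z(1)]] z ny by simp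
  then have "real l * (real m - 1 - real l) = 0" by (simp add: algebra_simps power2_eq_square)
  then show False using l2 m_gt by simp
qed

section \<open>The lines of the descendent at a vertex\<close>

definition T :: "('a ^ 'm) set \<Rightarrow> ('a ^ 'm) set set" where
  "T x = {L \<in> lines x UNIV. \<exists>z\<in>Y. x + z = L}"

definition \<tau> :: "('a ^ 'm) set \<Rightarrow> ('a ^ 'm) set \<Rightarrow> nat" where
  "\<tau> x P = card {L \<in> T x. P \<subseteq> L}"

lemma finite_T [simp]: "finite (T x)"
  unfolding T_def by simp

lemma T_full: "x \<in> Y \<Longrightarrow> y \<in> X \<Longrightarrow> x + y \<in> T x \<Longrightarrow> y \<in> Y"
  using line_full[of x y] line_of[OF YX, of x y] unfolding T_def by auto

lemma line_count_Y: assumes x: "x \<in> Y" and L: "L \<in> lines x UNIV" shows "line_count Y x L = l * of_bool (L \<in> T x)"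
proof (cases "L \<in> T x")
  case True
  then have "{z \<in> Y. x + z = L} = {z \<in> X. x + z = L}" using T_full[OF x] YX by blast
  then show ?thesis using card_line_fibre[OF YX[OF x] L] True card_field by (simp add: line_count_def)
next
  case False
  then have "{z \<in> Y. x + z = L} = {}" using L unfolding T_def by blast
  then show ?thesis using False by (simp add: line_count_def)
qed

lemma line_representative:
  assumes x: "x \<in> X" and L: "L \<in> lines x UNIV" obtains y where "y \<in> X" "x + y = L" "\<delta> x y = 2"
proof -
  have "card {z \<in> X. x + z = L} \<noteq> 0" using card_line_fibre[OF x L] card_field l2 by simp
  then have "{z \<in> X. x + z = L} \<noteq> {}" by force
  then obtain y where "y \<in> X" "x + y = L" by blast
  then show thesis using that line_of[OF x, of y] L by blast
qed

text \<open>The Cameron--Liebler property: the left side counts the lines of \<open>T x\<close> that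
  meet L, with L itself counted 1 + l times if it belongs to \<open>T x\<close>. This is
  \<open>sum_points_Y\<close> divided by l, because each line of \<open>T x\<close> carries l
  neighbours.\<close>

lemma sum_\<tau>_line:
  assumes x: "x \<in> Y" and L: "L \<in> lines x UNIV"
  shows "(\<Sum>P\<in>pts x L. \<tau> x P) = qnum l (2 * w) + of_bool (L \<in> T x) * (m - 1)"
proof -
  obtain y where y: "y \<in> X" "x + y = L" "\<delta> x y = 2" using line_representative[OF YX[OF x] L] by blast
  have "card {z \<in> Y. \<delta> x z = 2 \<and> P \<subseteq> x + z} = l * \<tau> x P" if "P \<in> pts x L" for P
  proof -
    have P: "P \<in> pts x UNIV" using that by (auto simp: pts_def)
    have "card {z \<in> Y. \<delta> x z = 2 \<and> P \<subseteq> x + z} = (\<Sum>L | L \<in> lines x UNIV \<and> P \<subseteq> L. l * of_bool (L \<in> T x))"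
      unfolding card_neighbours_through[OF Y_sub YX[OF x] P]
      by (intro sum.cong refl line_count_Y x) auto
    also have "\<dots> = l * card ({L. L \<in> lines x UNIV \<and> P \<subseteq> L} \<inter> T x)"
      by (simp add: sum_distrib_left[symmetric] Int_def)
    also have "{L. L \<in> lines x UNIV \<and> P \<subseteq> L} \<inter> T x = {L \<in> T x. P \<subseteq> L}" unfolding T_def by blast
    finally show ?thesis unfolding \<tau>_def .
  qed
  then have "(\<Sum>P\<in>pts x L. card {z \<in> Y. \<delta> x z = 2 \<and> P \<subseteq> x + z}) = l * (\<Sum>P\<in>pts x L. \<tau> x P)"
    by (simp add: sum_distrib_left)
  moreover have "L \<in> T x \<longleftrightarrow> (\<exists>z\<in>Y. x + z = L)" using L by (simp add: T_def)
  then have yT: "y \<in> Y \<longleftrightarrow> L \<in> T x" using T_full[OF x y(1), unfolded y(2)] y(2) by blast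
  ultimately have "real l * real (\<Sum>P\<in>pts x L. \<tau> x P) = real l * (real l * of_bool (L \<in> T x)) + of_bool (L \<in> T x) * (real (l * m) - real l - real l ^ 2)
      + real l * real (qnum l (2 * w))"
    using sum_points_Y[OF x y(1,3)] unfolding y(2) line_count_Y[OF x L] by simp
  also have "\<dots> = real l * (real (qnum l (2 * w)) + of_bool (L \<in> T x) * (real m - 1))"
    by (simp add: algebra_simps power2_eq_square)
  finally have "real (\<Sum>P\<in>pts x L. \<tau> x P) = real (qnum l (2 * w)) + of_bool (L \<in> T x) * (real m - 1)"
    using l2 by (simp only: mult_cancel_left) simp
  also have "\<dots> = real (qnum l (2 * w) + of_bool (L \<in> T x) * (m - 1))" using m_gt by (simp add: of_nat_diff)
  finally show ?thesis by (simp only: of_nat_eq_iff)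
qed

lemma card_T: assumes x: "x \<in> Y" shows "(1 + l) * card (T x) = m * qnum l (2 * w)"
proof -
  have "l * m * qnum (l ^ 2) w = (\<Sum>L\<in>lines x UNIV. l * of_bool (L \<in> T x))"
    unfolding card_neighbours_Y[OF x, symmetric] card_neighbours[OF Y_sub YX[OF x]]
    by (intro sum.cong refl line_count_Y x)
  also have "\<dots> = l * card (lines x UNIV \<inter> T x)" by (simp add: sum_distrib_left[symmetric] Int_def)
  also have "lines x UNIV \<inter> T x = T x" unfolding T_def by blast
  finally have "l * (m * qnum (l ^ 2) w) = l * card (T x)" by (simp add: mult.assoc)
  then have "card (T x) = m * qnum (l ^ 2) w" using l2 by simp
  then show ?thesis unfolding qnum_square[symmetric] by (simp add: algebra_simps)
qed

lemma T_sub: "T x \<subseteq> lines x UNIV"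
  unfolding T_def by blast

text \<open>Add up \<open>sum_\<tau>_line\<close> over the lines through P and compare with
  \<open>sum_lines_through\<close>.\<close>

lemma double_count_\<tau>:
  assumes x: "x \<in> Y" and P: "P \<in> pts x UNIV"
  shows "qnum l (n - 1) * qnum l (2 * w) + \<tau> x P * (m - 1) + \<tau> x P
    = qnum l (n - 1) * \<tau> x P + (\<Sum>P'\<in>pts x UNIV. \<tau> x P')"
proof -
  have "(\<Sum>L | L \<in> lines x UNIV \<and> P \<subseteq> L. \<Sum>P'\<in>pts x L. \<tau> x P')
     = (\<Sum>L | L \<in> lines x UNIV \<and> P \<subseteq> L. qnum l (2 * w) + of_bool (L \<in> T x) * (m - 1))"
    by (intro sum.cong refl sum_\<tau>_line x) auto
  also have "\<dots> = card {L. L \<in> lines x UNIV \<and> P \<subseteq> L} * qnum l (2 * w) + card ({L. L \<in> lines x UNIV \<and> P \<subseteq> L} \<inter> T x) * (m - 1)"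
    by (simp add: sum.distrib sum_distrib_right[symmetric] Int_def)
  also have "{L. L \<in> lines x UNIV \<and> P \<subseteq> L} \<inter> T x = {L \<in> T x. P \<subseteq> L}" unfolding T_def by blast
  also have "card {L. L \<in> lines x UNIV \<and> P \<subseteq> L} = qnum l (n - 1)"
    using card_lines_through[OF P] by (simp add: card_field)
  finally show ?thesis
    using sum_lines_through[OF X_sub[OF YX[OF x]] vec.subspace_UNIV _ P, of n "\<tau> x"]
    unfolding \<tau>_def[symmetric] by (simp add: card_field mult_2)
qed

text \<open>For odd n the coefficient m - [n - 1] is positive, so \<open>double_count_\<tau>\<close>
  makes \<open>\<tau> x\<close> constant. All lines then have the same point sum, although
  \<open>T x\<close> is neither empty nor the set of all lines and membership changes the sum by m -
  1.\<close>

lemma n_even: "n = 2 * d"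
proof (rule ccontr)
  assume "n \<noteq> 2 * d"
  then have n: "n = 2 * d + 1" "m = qnum l n" using n_cases m_def by auto
  obtain x where x: "x \<in> Y" using Y_ne by blast
  have "card (T x) \<noteq> 0"
  proof
    assume "card (T x) = 0"
    then show False using card_T[OF x] m_gt qnum_pos[of l "2 * w"] l2 w1 by simp
  qed
  then have "T x \<noteq> {}" by auto
  then obtain L1 where L1: "L1 \<in> T x" by blast
  have "card (T x) \<noteq> card (lines x UNIV)"
  proof
    assume "card (T x) = card (lines x UNIV)"
    then have "m * qnum l (2 * w) = qnum l n * qnum l (n - 1)"
      using card_T[OF x] card_lines[OF X_sub[OF YX[OF x]], of UNIV n] by (simp add: card_field mult_2)
    then have "qnum l (2 * w) = qnum l (n - 1)" using n m_gt by simp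
    moreover have "qnum l (2 * w) < qnum l (n - 1)" using n wd l2 by (intro qnum_strict_mono) auto
    ultimately show False by simp
  qed
  then have "\<not> lines x UNIV \<subseteq> T x" using T_sub[of x] by (metis subset_antisym)
  then obtain L2 where L2: "L2 \<in> lines x UNIV" "L2 \<notin> T x" by blast
  define C where "C = (\<Sum>P'\<in>pts x UNIV. \<tau> x P')"
  have eq: "qnum l (n - 1) * qnum l (2 * w) + \<tau> x P * m = qnum l (n - 1) * \<tau> x P + C" if "P \<in> pts x UNIV" for P
    using double_count_\<tau>[OF x that] m_gt unfolding C_def[symmetric] by (cases m) (auto simp: algebra_simps)
  have lt: "qnum l (n - 1) < m" unfolding n(2) using d3 n(1) l2 by (intro qnum_strict_mono) auto
  have const: "\<tau> x P = \<tau> x P'" if "P \<in> pts x UNIV" "P' \<in> pts x UNIV" for P P'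
  proof -
    have e: "int (\<tau> x P) * (int m - int (qnum l (n - 1))) = int C - int (qnum l (n - 1) * qnum l (2 * w))"
      if "P \<in> pts x UNIV" for P
      using arg_cong[OF eq[OF that], of int] by (simp add: algebra_simps)
    then have "int (\<tau> x P) * (int m - int (qnum l (n - 1))) = int (\<tau> x P') * (int m - int (qnum l (n - 1)))"
      using e[OF that(1)] e[OF that(2)] by simp
    then show ?thesis using lt by simp
  qed
  have xV: "x \<in> V" using x YX X_sub by blast
  have L1': "L1 \<in> lines x UNIV" using L1 T_sub by blast
  have "card (pts x L1) \<noteq> 0" using card_pts_line[OF xV L1'] by simp
  then have "pts x L1 \<noteq> {}" by auto
  then obtain P0 where P0: "P0 \<in> pts x L1" by blast
  have s: "(\<Sum>P\<in>pts x L. \<tau> x P) = (1 + l) * \<tau> x P0" if "L \<in> lines x UNIV" for L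
  proof -
    have "(\<Sum>P\<in>pts x L. \<tau> x P) = (\<Sum>P\<in>pts x L. \<tau> x P0)"
      by (intro sum.cong refl const) (use P0 in \<open>auto simp: pts_def\<close>)
    then show ?thesis using card_pts_line[OF xV that] card_field by simp
  qed
  have "m - 1 = 0"
    using s[OF L1'] s[OF L2(1)] sum_\<tau>_line[OF x L1'] sum_\<tau>_line[OF x L2(1)] L1 L2 by simp
  then show False using m_gt by simp
qed

section \<open>Even n: cosines from cliques, and vertices at locally maximal distance\<close>

lemma m_eq: "m = qnum l (n - 1)"
  using n_even m_def by simp

lemma qnum_n: "qnum l n = 1 + l * m"
  using qnum_rec[of l "n - 1"] n_even d3 m_eq by (simp add: Suc_pred')

text \<open>The neighbours in \<Delta> of a vertex z outside \<open>X\<close> form a clique of size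
  [n] = 1 + l m in the half, and 1 + l m \<sigma> 1 = 0 makes \<open>\<sigma>_clique\<close>
  applicable. Seen from y at distance 2i - 1 from z, [2i - 1] members are nearer and the others
  farther, which links consecutive cosines.\<close>

lemma \<sigma>_rec:
  assumes i: "1 \<le> i" "2 * i \<le> n"
  shows "real (qnum l (2 * i - 1)) * \<sigma> (i - 1) + (real (qnum l n) - real (qnum l (2 * i - 1))) * \<sigma> i = 0"
proof -
  obtain x y where xy: "x \<in> X" "y \<in> X" "\<delta> x y = 2 * i" using far_pair[OF i(2)] by blast
  have "\<delta> x y = Suc (2 * i - 1)" using xy i by simp
  then obtain z where z: "z \<in> V" "\<delta> x z = 1" "\<delta> z y = 2 * i - 1"
    using closer_exists[OF X_sub[OF xy(1)] X_sub[OF xy(2)]] by blast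
  have zX: "z \<notin> X" using parity[OF X_sub[OF xy(1)] z(1)] z xy by simp
  have V: "y \<in> V" using xy X_sub by blast
  define C where "C = {x \<in> V. \<delta> z x = 1}"
  have CX: "C \<subseteq> X" using parity[OF z(1)] zX unfolding C_def by force
  have cC: "card C = qnum l n"
    using card_opposite_neighbours[OF z(1), of UNIV] unfolding C_def by (simp add: card_field mult_2)
  have adj: "\<delta> u v = 2" if "u \<in> C" "v \<in> C" "u \<noteq> v" for u v
  proof -
    have "\<delta> u v \<le> \<delta> u z + \<delta> z v" by (rule \<delta>_triangle) (use that z in \<open>auto simp: C_def\<close>)
    then have "\<delta> u v \<le> 2" using that \<delta>_commute[of u z] unfolding C_def by simp
    moreover have "even (\<delta> u v)" "\<delta> u v \<noteq> 0"
      using parity_X[of u v] \<delta>_eq_0_iff[of u v] that CX X_sub by blast+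
    ultimately show ?thesis by presburger
  qed
  have fC: "finite C" using finite_sub_X[OF CX] .
  have "(\<Sum>v\<in>C. \<sigma> (\<delta> u v div 2)) = 0" if u: "u \<in> C" for u
  proof -
    have "(\<Sum>v\<in>C. \<sigma> (\<delta> u v div 2)) = \<sigma> (\<delta> u u div 2) + (\<Sum>v\<in>C - {u}. \<sigma> (\<delta> u v div 2))"
      by (rule sum.remove[OF fC u])
    also have "(\<Sum>v\<in>C - {u}. \<sigma> (\<delta> u v div 2)) = (\<Sum>v\<in>C - {u}. \<sigma> 1)"
    proof (intro sum.cong refl)
      fix v assume "v \<in> C - {u}"
      then have "\<delta> u v = 2" using adj[OF u, of v] by blast
      then show "\<sigma> (\<delta> u v div 2) = \<sigma> 1" by simp
    qed
    also have "\<dots> = real (qnum l n - 1) * \<sigma> 1" using u fC cC by simp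
    also have "real (qnum l n - 1) * \<sigma> 1 = -1"
      unfolding \<sigma>_1 using qnum_n l2 m_gt by simp
    finally show ?thesis using \<sigma>_0 u by (simp add: C_def)
  qed
  then have "(\<Sum>u\<in>C. \<Sum>v\<in>C. \<sigma> (\<delta> u v div 2)) = 0" by simp
  from \<sigma>_clique[OF CX this xy(2)] have s0: "(\<Sum>u\<in>C. \<sigma> (\<delta> y u div 2)) = 0" .
  let ?A = "{u \<in> V. \<delta> z u = 1 \<and> u \<subseteq> z + y}"
  have sub: "vec.subspace (z + y)" "z \<subseteq> z + y" using z V by (intro subspace_plus subset_plus1; simp)+
  have dzy: "vec.dim (z + y) = n + (2 * i - 1)" using dim_plus[OF z(1) V] z by simp
  have cA: "card ?A = qnum l (2 * i - 1)"
    using card_opposite_neighbours[OF z(1) sub] dzy by (simp add: card_field)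
  have AC: "?A \<subseteq> C" unfolding C_def by blast
  \<comment> \<open>Parity leaves 2i - 2 and 2i as distances; the nearer members are those inside z
    + y.\<close>
  have val: "\<delta> y u div 2 = (if u \<subseteq> z + y then i - 1 else i)" if u: "u \<in> C" for u
  proof -
    have uV: "u \<in> V" "\<delta> z u = 1" using u by (auto simp: C_def)
    have t: "\<delta> u y \<le> 2 * i" "2 * i - 1 \<le> 1 + \<delta> u y"
      using \<delta>_triangle[OF uV(1) z(1) V] \<delta>_triangle[OF z(1) uV(1) V] uV z i \<delta>_commute[of u z] by auto
    have ev: "even (\<delta> u y)" using parity_X[of u y] u CX xy by blast
    show ?thesis
    proof (cases "u \<subseteq> z + y")
      case True
      then have "u + y \<subseteq> z + y" using sub z by (intro plus_least subset_plus2) auto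
      then have "\<delta> u y \<le> 2 * i - 1" using vec.dim_subset[of "u + y" "z + y"] dim_plus[OF uV(1) V] dzy by simp
      then have "\<delta> u y = 2 * (i - 1)" using t ev i by presburger
      then show ?thesis using True \<delta>_commute[of u y] by simp
    next
      case False
      have "\<delta> u y \<noteq> 2 * (i - 1)"
      proof
        assume a: "\<delta> u y = 2 * (i - 1)"
        have s1: "vec.subspace (u + y)" "vec.subspace (z + u)" using uV V z by (auto intro: subspace_plus)
        have "u \<subseteq> (u + y) \<inter> (z + u)" using uV V z subset_plus1[of y u] subset_plus2[of z u] by auto
        from vec.dim_subset[OF this] have "n \<le> vec.dim ((u + y) \<inter> (z + u))" using uV by simp
        then have "vec.dim ((u + y) + (z + u)) \<le> n + (2 * i - 1)"
          using dim_plus_Int[OF s1] dim_plus[OF uV(1) V] dim_plus[OF z(1) uV(1)] a uV i by simp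
        moreover have "z + y \<subseteq> (u + y) + (z + u)"
          using uV V z set_plus_mono2[of y "u + y" z "z + u"] subset_plus2[of u y] subset_plus1[of u z]
          by (simp add: add.commute)
        ultimately have "z + y = (u + y) + (z + u)"
          using dzy sub(1) subspace_plus[OF s1] by (intro subspace_eqI) simp_all
        moreover have "u \<subseteq> (u + y) + (z + u)"
          using s1 subset_plus1[of y u] subset_plus1[OF s1(2), of "u + y"] V by auto
        ultimately show False using False by simp
      qed
      then have "\<delta> u y = 2 * i" using t ev i by presburger
      then show ?thesis using False \<delta>_commute[of u y] by simp
    qed
  qed
  have "(\<Sum>u\<in>C. \<sigma> (\<delta> y u div 2)) = (\<Sum>u\<in>?A. \<sigma> (\<delta> y u div 2)) + (\<Sum>u\<in>C - ?A. \<sigma> (\<delta> y u div 2))"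
    using sum.subset_diff[OF AC fC] by (simp add: add.commute)
  also have "(\<Sum>u\<in>?A. \<sigma> (\<delta> y u div 2)) = (\<Sum>u\<in>?A. \<sigma> (i - 1))"
    by (intro sum.cong refl) (use val AC in \<open>auto simp: C_def\<close>)
  also have "(\<Sum>u\<in>C - ?A. \<sigma> (\<delta> y u div 2)) = (\<Sum>u\<in>C - ?A. \<sigma> i)"
    by (intro sum.cong refl) (use val in \<open>auto simp: C_def\<close>)
  also have "(\<Sum>u\<in>C - ?A. \<sigma> i) = real (card C - card ?A) * \<sigma> i"
    using AC finite_subset[OF AC fC] by (simp add: card_Diff_subset)
  finally have "real (qnum l (2 * i - 1)) * \<sigma> (i - 1) + real (qnum l n - qnum l (2 * i - 1)) * \<sigma> i = 0"
    using s0 cA cC by simp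
  moreover have "qnum l (2 * i - 1) \<le> qnum l n" using i l2 by (simp add: qnum_le_iff)
  ultimately show ?thesis by (simp add: of_nat_diff)
qed

lemma \<sigma>_ne: "2 * i \<le> n \<Longrightarrow> \<sigma> i \<noteq> 0"
proof (induction i)
  case 0
  then show ?case using \<sigma>_0 by simp
next
  case (Suc i)
  then have "\<sigma> i \<noteq> 0" "0 < qnum l (2 * Suc i - 1)" using l2 by (auto intro!: qnum_pos)
  then show ?case using \<sigma>_rec[of "Suc i"] Suc by auto
qed

text \<open>The neighbour identity determines the number of neighbours \<open>z\<close> in \<open>Y\<close> that are closer to \<open>y\<close>,
  and \<open>z \<mapsto> x + z\<close> embeds them into the lines of \<open>x + y\<close>.\<close>

lemma local_maximum:
  assumes x: "x \<in> Y" and y: "y \<in> X" and i: "\<delta> x y = 2 * i" "1 \<le> i"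
    and far: "\<And>z. z \<in> Y \<Longrightarrow> \<delta> x z = 2 \<Longrightarrow> \<delta> z y \<le> 2 * i"
  shows "w \<le> i" and "i = w \<Longrightarrow> lines x (x + y) \<subseteq> T x"
proof -
  have V: "x \<in> V" "y \<in> V" using x y YX X_sub by auto
  have in2: "2 * i \<le> n" using \<delta>_le[OF V] i by simp
  let ?N = "{z \<in> Y. \<delta> x z = 2}" and ?M = "{z \<in> Y. \<delta> x z = 2 \<and> \<delta> z y = 2 * (i - 1)}"
  have fin: "finite ?N" using finite_sub_X[OF Y_sub] by simp
  have MN: "?M \<subseteq> ?N" by auto
  have val: "\<delta> y z div 2 = (if z \<in> ?M then i - 1 else i)" if z: "z \<in> ?N" for z
  proof -
    have zV: "z \<in> V" "z \<in> X" using z YX X_sub by auto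
    have "2 * i \<le> 2 + \<delta> z y" using \<delta>_triangle[OF V(1) zV(1) V(2)] z i by simp
    moreover have "\<delta> z y \<le> 2 * i" using far z by blast
    moreover have "even (\<delta> z y)" using parity_X zV y by blast
    ultimately have "\<delta> z y = 2 * (i - 1) \<or> \<delta> z y = 2 * i" using i by presburger
    then show ?thesis using z \<delta>_commute[of z y] i by auto
  qed
  have "(\<Sum>z\<in>?N. \<sigma> (\<delta> y z div 2)) = (\<Sum>z\<in>?M. \<sigma> (\<delta> y z div 2)) + (\<Sum>z\<in>?N - ?M. \<sigma> (\<delta> y z div 2))"
    using sum.subset_diff[OF MN fin] by (simp add: add.commute)
  also have "(\<Sum>z\<in>?M. \<sigma> (\<delta> y z div 2)) = (\<Sum>z\<in>?M. \<sigma> (i - 1))"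
    by (intro sum.cong refl) (use val in auto)
  also have "(\<Sum>z\<in>?N - ?M. \<sigma> (\<delta> y z div 2)) = (\<Sum>z\<in>?N - ?M. \<sigma> i)"
    by (intro sum.cong refl) (use val in auto)
  also have "(\<Sum>z\<in>?N - ?M. \<sigma> i) = (real (card ?N) - real (card ?M)) * \<sigma> i"
    using MN fin card_mono[OF fin MN] by (simp add: card_Diff_subset finite_subset of_nat_diff)
  also have "(\<Sum>z\<in>?M. \<sigma> (i - 1)) = real (card ?M) * \<sigma> (i - 1)" by simp
  finally have e1: "real (card ?M) * \<sigma> (i - 1) + (real (card ?N) - real (card ?M)) * \<sigma> i
      = - real (qnum (l ^ 2) w) * \<sigma> i"
    using \<sigma>_Y[OF x y] i \<delta>_commute[of x y] by simp
  define a where "a = real (qnum l (2 * i - 1))"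
  define M where "M = real (card ?M)"
  define W where "W = real (qnum (l ^ 2) w)"
  define b where "b = real (qnum l n)"
  have N: "real (card ?N) = W * (b - 1)" unfolding card_neighbours_Y[OF x] W_def b_def qnum_n by simp
  have e2: "a * \<sigma> (i - 1) = - (b - a) * \<sigma> i" using \<sigma>_rec[OF i(2) in2] unfolding a_def b_def by (simp add: algebra_simps)
  have e1': "M * \<sigma> (i - 1) + (W * (b - 1) - M) * \<sigma> i = - W * \<sigma> i"
    using e1 unfolding N M_def[symmetric] W_def[symmetric] .
  \<comment> \<open>Multiplied by a, the identity can be rewritten by the recurrence for cosines so
    that only \<sigma> i remains; it is nonzero and cancels, leaving M = W a.\<close>
  have "M * (a * \<sigma> (i - 1)) + a * (W * (b - 1) - M) * \<sigma> i = - a * W * \<sigma> i"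
    using arg_cong[OF e1', of "\<lambda>t. a * t"] by (simp add: algebra_simps)
  then have "M * (- (b - a) * \<sigma> i) + a * (W * (b - 1) - M) * \<sigma> i = - a * W * \<sigma> i" unfolding e2 .
  then have "(b * \<sigma> i) * M = (b * \<sigma> i) * (W * a)" by argo
  moreover have "0 < qnum l n" using l2 d3 n_even by (intro qnum_pos) auto
  then have "b * \<sigma> i \<noteq> 0" using \<sigma>_ne[OF in2] unfolding b_def by simp
  ultimately have "M = W * a" using mult_left_cancel[of "b * \<sigma> i" M "W * a"] by blast
  then have cM: "card ?M = qnum (l ^ 2) w * qnum l (2 * i - 1)"
    unfolding M_def W_def a_def of_nat_mult[symmetric] of_nat_eq_iff .
  have U: "vec.subspace (x + y)" "x \<subseteq> x + y" "vec.dim (x + y) = n + 2 * i"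
    using V i dim_plus[OF V] subspace_plus[of x y] subset_plus1[of y x] by simp_all
  \<comment> \<open>As z lies on a geodesic from x to y, the sum of x + z and z + y is no larger
    than x + y.\<close>
  have img: "(\<lambda>z. x + z) ` ?M \<subseteq> lines x (x + y)"
  proof
    fix L assume "L \<in> (\<lambda>z. x + z) ` ?M"
    then obtain z where z: "z \<in> Y" "\<delta> x z = 2" "\<delta> z y = 2 * (i - 1)" "L = x + z" by blast
    have zV: "z \<in> V" using z YX X_sub by blast
    have s: "vec.subspace (x + z)" "vec.subspace (z + y)" using V zV by (auto intro: subspace_plus)
    have "z \<subseteq> (x + z) \<inter> (z + y)" using V zV subset_plus1[of y z] subset_plus2[of x z] by auto
    from vec.dim_subset[OF this] have "n \<le> vec.dim ((x + z) \<inter> (z + y))" using zV by simp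
    then have "vec.dim ((x + z) + (z + y)) \<le> n + 2 * i"
      using dim_plus_Int[OF s] dim_plus[OF V(1) zV] dim_plus[OF zV V(2)] z i by simp
    moreover have "x + y \<subseteq> (x + z) + (z + y)"
      using V zV by (intro set_plus_mono2 subset_plus1 subset_plus2) auto
    ultimately have "x + y = (x + z) + (z + y)" using U subspace_plus[OF s] by (intro subspace_eqI) simp_all
    then have "x + z \<subseteq> x + y" using subset_plus1[OF s(2)] by simp
    then show "L \<in> lines x (x + y)" using z s dim_plus[OF V(1) zV] V zV subset_plus1[of z x] by (auto simp: lines_def)
  qed
  \<comment> \<open>Two such z and z' on one line L = x + z would both meet y in L \<inter> y. That
    intersection would lie in z \<inter> z' = x \<inter> z and thus in x \<inter> y, whose dimension
    is smaller by 2.\<close>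
  have inj: "inj_on (\<lambda>z. x + z) ?M"
  proof (rule inj_onI, rule ccontr)
    fix z z' assume z: "z \<in> ?M" and z': "z' \<in> ?M" and e: "x + z = x + z'" and ne: "z \<noteq> z'"
    have zV: "z \<in> V" "z' \<in> V" "z \<in> X" "z' \<in> X" using z z' YX X_sub by auto
    have "\<delta> z z' = 2"
      by (rule \<delta>_same_line[OF YX[OF x] zV(3,4) _ e ne]) (use dim_plus[OF V(1) zV(1)] z in simp)
    have g: "x \<inter> z = x \<inter> z'" using perp_vertex_plus[OF V(1) zV(1)] perp_vertex_plus[OF V(1) zV(2)] e by simp
    have "x \<inter> z = z \<inter> z'"
    proof (rule subspace_eqI)
      show "x \<inter> z \<subseteq> z \<inter> z'" using g by blast
      show "vec.dim (z \<inter> z') \<le> vec.dim (x \<inter> z)"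
        using dim_Int[OF zV(1,2)] dim_Int[OF V(1) zV(1)] \<open>\<delta> z z' = 2\<close> z by simp
    qed (use V zV in \<open>auto intro: subspace_Int\<close>)
    then have gx: "z \<inter> z' \<subseteq> x" by blast
    let ?L = "x + z"
    have Ls: "vec.subspace ?L" using V zV by (auto intro: subspace_plus)
    have Lsub: "?L \<subseteq> x + y" using img z by (auto simp: lines_def)
    have Ly: "?L + y \<subseteq> x + y"
      by (rule plus_least[OF U(1) Lsub subset_plus2[OF vertex_subspace[OF V(1)]]])
    from vec.dim_subset[OF Ly] have dLy: "vec.dim (?L + y) \<le> n + 2 * i" using U by simp
    have dL: "vec.dim ?L = n + 2" using dim_plus[OF V(1) zV(1)] z by simp
    have eqI: "u \<inter> y = ?L \<inter> y" if u: "u \<in> V" "\<delta> u y = 2 * (i - 1)" "u \<subseteq> ?L" for u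
    proof (rule subspace_eqI)
      have sLy: "?L + y = x + y"
      proof
        show "x + y \<subseteq> ?L + y" using V zV by (intro set_plus_mono2 subset_plus1) auto
      qed (rule Ly)
      then have "vec.dim (?L \<inter> y) + 2 * i = n + 2" using dim_plus_Int[OF Ls, of y] V U dL by simp
      then show "vec.dim (?L \<inter> y) \<le> vec.dim (u \<inter> y)" using dim_Int[OF u(1) V(2)] u(2) i by simp
      show "u \<inter> y \<subseteq> ?L \<inter> y" using u by blast
    qed (use u V Ls in \<open>auto intro: subspace_Int\<close>)
    have "z \<subseteq> ?L" "z' \<subseteq> ?L" using subset_plus2[of x z] subset_plus2[of x z'] V e by auto
    then have "z \<inter> y = z' \<inter> y" using eqI[of z] eqI[of z'] z z' zV by simp
    then have "z \<inter> y \<subseteq> x \<inter> y" using gx by blast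
    from vec.dim_subset[OF this] show False
      using dim_Int[OF zV(1) V(2)] dim_Int[OF V] z i by simp
  qed
  \<comment> \<open>Up to the factor 1 + l the cardinalities are [2i] [2i - 1] and [2w] [2i - 1].
    The embedding forces w \<le> i, and for i = w it is onto.\<close>
  have cl: "(1 + l) * card (lines x (x + y)) = qnum l (2 * i) * qnum l (2 * i - 1)"
    using card_lines[OF V(1) U] unfolding card_field .
  have cI: "(1 + l) * card ((\<lambda>z. x + z) ` ?M) = qnum l (2 * w) * qnum l (2 * i - 1)"
    unfolding card_image[OF inj] cM qnum_square[symmetric] by (simp add: algebra_simps)
  have "card ((\<lambda>z. x + z) ` ?M) \<le> card (lines x (x + y))" by (rule card_mono[OF finite_lines img])
  then have "(1 + l) * card ((\<lambda>z. x + z) ` ?M) \<le> (1 + l) * card (lines x (x + y))" by (rule mult_le_mono2)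
  then have "qnum l (2 * w) \<le> qnum l (2 * i)"
    unfolding cl cI using qnum_pos[of l "2 * i - 1"] i l2 by simp
  then show "w \<le> i" using l2 by (simp add: qnum_le_iff)
  assume "i = w"
  then have "(1 + l) * card ((\<lambda>z. x + z) ` ?M) = (1 + l) * card (lines x (x + y))" unfolding cl cI by simp
  then have "card ((\<lambda>z. x + z) ` ?M) = card (lines x (x + y))" unfolding mult_cancel1 by simp
  then have "(\<lambda>z. x + z) ` ?M = lines x (x + y)" by (rule card_subset_eq[OF finite_lines img])
  moreover have "(\<lambda>z. x + z) ` ?M \<subseteq> T x"
    unfolding T_def using img lines_mono[of "x + y" UNIV x] by blast
  ultimately show "lines x (x + y) \<subseteq> T x" by simp
qed

lemma neighbour_in_Y: assumes "x \<in> Y" obtains z where "z \<in> Y" "\<delta> x z = 2"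
proof -
  have "card {z \<in> Y. \<delta> x z = 2} \<noteq> 0" using card_neighbours_Y[OF assms] l2 m_gt qd_gt(3) by simp
  then have "{z \<in> Y. \<delta> x z = 2} \<noteq> {}" by force
  then show thesis using that by blast
qed

text \<open>C is a union of connected components of the graph on \<open>Y\<close>, and y may lie
  outside it. A vertex of C farthest from y is a local maximum, so \<open>local_maximum\<close>
  bounds the distance from below and the width bounds it from above.\<close>

lemma far_in_component:
  assumes C: "C \<subseteq> Y" "C \<noteq> {}" and closed: "\<And>x z. x \<in> C \<Longrightarrow> z \<in> Y \<Longrightarrow> \<delta> x z = 2 \<Longrightarrow> z \<in> C"
    and y: "y \<in> Y"
  obtains x where "x \<in> C" "\<delta> x y = 2 * w" "lines x (x + y) \<subseteq> T x"
proof -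
  have fC: "finite C" using C finite_sub_X[OF Y_sub] finite_subset by blast
  have "Max ((\<lambda>z. \<delta> z y) ` C) \<in> (\<lambda>z. \<delta> z y) ` C" using fC C by (intro Max_in) auto
  then obtain x where xC: "x \<in> C" "Max ((\<lambda>z. \<delta> z y) ` C) = \<delta> x y" by (rule imageE)
  have x: "x \<in> C" "\<And>z. z \<in> C \<Longrightarrow> \<delta> z y \<le> \<delta> x y"
    using xC fC by (auto simp: xC(2)[symmetric])
  have xY: "x \<in> Y" using x C by blast
  obtain i where i: "\<delta> x y = 2 * i" using parity_X[of x y] xY y YX by (auto elim: evenE)
  have far: "\<delta> z y \<le> 2 * i" if "z \<in> Y" "\<delta> x z = 2" for z
    using x(2)[of z] closed[OF x(1) that] i by simp
  \<comment> \<open>If x were y, a neighbour of x in \<open>Y\<close> would belong to C and be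
    farther from y.\<close>
  have "i \<noteq> 0"
  proof
    assume "i = 0"
    then have "x = y" using i \<delta>_eq_0_iff[of x y] xY y YX X_sub by simp
    obtain z where "z \<in> Y" "\<delta> x z = 2" using neighbour_in_Y[OF xY] by blast
    then show False using far[of z] \<open>i = 0\<close> \<open>x = y\<close> \<delta>_commute[of x z] by simp
  qed
  then have i1: "1 \<le> i" by simp
  have "w \<le> i" by (rule local_maximum(1)[OF xY YX[OF y] i i1 far])
  moreover have "i \<le> w" using width_Y[OF xY y] i by simp
  ultimately have iw: "i = w" by simp
  have "lines x (x + y) \<subseteq> T x" by (rule local_maximum(2)[OF xY YX[OF y] i i1 far iw])
  then show thesis using that x(1) i iw by blast
qed

end

section \<open>Classification\<close>

context half_descendent
begin

lemma vertex_facts: assumes "x \<in> Y" shows "x \<in> X" "x \<in> V" "vec.subspace x" "vec.dim x = n"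
  using assms YX X_sub by auto

section \<open>Width at least two: the hyperplane at a vertex\<close>

lemma \<tau>_pos: "L \<in> T x \<Longrightarrow> P \<subseteq> L \<Longrightarrow> 0 < \<tau> x P"
  unfolding \<tau>_def by (rule card_gt_0_iff[THEN iffD2]) auto

text \<open>All lines of U belong to \<open>T x\<close> and so have the same point sum. Adding these
  sums over the lines of U through a point determines \<open>\<tau> x\<close> there because [2w - 1]
  > 1; for w = 1 the space U is a single line and the equation is empty.\<close>

lemma \<tau>_const_on_subspace:
  assumes x: "x \<in> Y" and U: "vec.subspace U" "x \<subseteq> U" "vec.dim U = n + 2 * w" "lines x U \<subseteq> T x"
    and w2: "2 \<le> w" and P: "P \<in> pts x U"
  shows "(1 + l) * \<tau> x P = qnum l (2 * w) + (m - 1)"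
proof -
  note xf = vertex_facts[OF x]
  define s where "s = qnum l (2 * w) + (m - 1)"
  have sL: "(\<Sum>P\<in>pts x L. \<tau> x P) = s" if "L \<in> lines x U" for L
  proof -
    have "L \<in> T x" "L \<in> lines x UNIV" using that U(4) T_sub by blast+
    then show ?thesis using sum_\<tau>_line[OF x] unfolding s_def by simp
  qed
  define b where "b = qnum l (2 * w - 1)"
  have b1: "1 < b" unfolding b_def using qnum_strict_mono[of l 1 "2 * w - 1"] l2 w2 by simp
  have eq: "b * s + \<tau> x R = b * \<tau> x R + (\<Sum>P'\<in>pts x U. \<tau> x P')" if R: "R \<in> pts x U" for R
  proof -
    have "(\<Sum>L | L \<in> lines x U \<and> R \<subseteq> L. \<Sum>P'\<in>pts x L. \<tau> x P') = (\<Sum>L | L \<in> lines x U \<and> R \<subseteq> L. s)"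
      by (intro sum.cong refl sL) auto
    also have "\<dots> = b * s" using card_lines_through[OF R U(1)] U(3) unfolding b_def by (simp add: card_field)
    finally show ?thesis using sum_lines_through[OF xf(2) U(1,3) R, of "\<tau> x"] unfolding card_field b_def[symmetric] by simp
  qed
  have const: "\<tau> x R = \<tau> x P" if R: "R \<in> pts x U" for R
  proof -
    have "int (\<tau> x R) * (int b - 1) = int (\<tau> x P) * (int b - 1)"
      using arg_cong[OF eq[OF R], of int] arg_cong[OF eq[OF P], of int] by (simp add: algebra_simps)
    then show ?thesis using b1 by simp
  qed
  have sP: "vec.subspace P" "x \<subseteq> P" "P \<subseteq> U" "vec.dim P = n + 1" using P by (auto simp: pts_def)
  obtain L where L: "vec.subspace L" "P \<subseteq> L" "L \<subseteq> U" "vec.dim L = n + 2"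
    using exists_between[OF sP(1) U(1) sP(3), of "n + 2"] sP U w2 by auto
  then have LU: "L \<in> lines x U" using sP by (auto simp: lines_def)
  have "(\<Sum>R\<in>pts x L. \<tau> x R) = (\<Sum>R\<in>pts x L. \<tau> x P)"
    by (intro sum.cong refl const) (use LU in \<open>auto simp: lines_def pts_def\<close>)
  then show ?thesis using sL[OF LU] card_pts_line[OF xf(2) LU] unfolding s_def by (simp add: card_field)
qed

text \<open>If w < d - 1, the value of \<open>\<tau> x\<close> at a point P0 of U exceeds [2w], the
  whole point sum of a line outside \<open>T x\<close>. So all lines through P0 belong to
  \<open>T x\<close>, and \<open>\<tau> x P0 = m\<close> contradicts the formula on U. For w = d - 1
  a point of U exhausts this sum exactly, which spreads \<open>T x\<close> from U to a
  hyperplane.\<close>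

lemma T_hyperplane:
  assumes x: "x \<in> Y" and U: "vec.subspace U" "x \<subseteq> U" "vec.dim U = n + 2 * w" "lines x U \<subseteq> T x" and w2: "2 \<le> w"
  shows "w = d - 1" and "\<exists>H. vec.subspace H \<and> x \<subseteq> H \<and> vec.dim H = 2 * n - 1 \<and> T x = lines x H"
proof -
  note xf = vertex_facts[OF x]
  note tc = \<tau>_const_on_subspace[OF x U w2]
  have m_rec: "m = 1 + l * qnum l (n - 2)"
    using qnum_rec[of l "n - 2"] m_eq n_even d3 by (simp add: Suc_diff_Suc numeral_2_eq_2)
  obtain P0 where P0': "vec.subspace P0" "x \<subseteq> P0" "P0 \<subseteq> U" "vec.dim P0 = n + 1"
    using exists_between[OF xf(3) U(1,2), of "n + 1"] U w2 xf by auto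
  then have P0: "P0 \<in> pts x U" by (simp add: pts_def)
  have P0U: "P0 \<in> pts x UNIV" using P0 by (auto simp: pts_def)
  have meet: "L \<in> T x" if w': "w < d - 1" and L: "L \<in> lines x UNIV" and PL: "P0 \<subseteq> L" for L
  proof (rule ccontr)
    assume "L \<notin> T x"
    then have "(\<Sum>P\<in>pts x L. \<tau> x P) = qnum l (2 * w)" using sum_\<tau>_line[OF x L] by simp
    moreover have "P0 \<in> pts x L" using P0U PL by (simp add: pts_def)
    ultimately have "\<tau> x P0 \<le> qnum l (2 * w)" using member_le_sum[of P0 "pts x L" "\<tau> x"] by simp
    then have "(1 + l) * \<tau> x P0 \<le> (1 + l) * qnum l (2 * w)" by (rule mult_le_mono2)
    then have "m - 1 \<le> l * qnum l (2 * w)" unfolding tc[OF P0] by simp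
    then have "l * qnum l (n - 2) \<le> l * qnum l (2 * w)" unfolding m_rec by simp
    then have "qnum l (n - 2) \<le> qnum l (2 * w)" using l2 by simp
    then have "n - 2 \<le> 2 * w" using l2 by (simp add: qnum_le_iff)
    then show False using w' n_even by simp
  qed
  show wd1: "w = d - 1"
  proof (rule ccontr)
    assume "w \<noteq> d - 1"
    then have w': "w < d - 1" using wd by simp
    have "{L \<in> T x. P0 \<subseteq> L} = {L \<in> lines x UNIV. P0 \<subseteq> L}" using meet[OF w'] T_sub by blast
    then have "\<tau> x P0 = m"
      unfolding \<tau>_def using card_lines_through[OF P0U] m_eq by (simp add: card_field)
    then have "(1 + l) * m = qnum l (2 * w) + (m - 1)" using tc[OF P0] by simp
    then have "l * m < qnum l (2 * w)" using m_gt by (simp add: algebra_simps)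
    moreover have "m \<le> l * m" using l2 by simp
    moreover have "qnum l (2 * w) \<le> m" unfolding m_eq using l2 wd n_even by (simp add: qnum_le_iff)
    ultimately show False by simp
  qed
  have n2: "n - 2 = 2 * w" using wd1 n_even by simp
  have tU: "\<tau> x P = qnum l (n - 2)" if "P \<in> pts x U" for P
  proof -
    have "(1 + l) * \<tau> x P = (1 + l) * qnum l (n - 2)"
      using tc[OF that] m_rec unfolding n2 by simp
    then show ?thesis unfolding mult_cancel1 by simp
  qed
  \<comment> \<open>A line outside \<open>T x\<close> has point sum [n - 2], and its point P in U
    already accounts for all of it.\<close>
  have zero: "\<tau> x P' = 0"
    if L: "L \<in> lines x UNIV" "L \<notin> T x" and P: "P \<in> pts x U" "P \<subseteq> L" and P': "P' \<in> pts x L" "P' \<noteq> P" for L P P'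
  proof -
    have PL: "P \<in> pts x L" using P by (simp add: pts_def)
    have "(\<Sum>R\<in>pts x L. \<tau> x R) = qnum l (n - 2)" using sum_\<tau>_line[OF x L(1)] L(2) n2 by simp
    moreover have "(\<Sum>R\<in>pts x L. \<tau> x R) = \<tau> x P + (\<Sum>R\<in>pts x L - {P}. \<tau> x R)"
      using PL by (simp add: sum.remove)
    ultimately have "(\<Sum>R\<in>pts x L - {P}. \<tau> x R) = 0" using tU[OF P(1)] by simp
    then show ?thesis using P' by simp
  qed
  \<comment> \<open>Through P0 there are [2w] lines of \<open>T x\<close> but only [2w - 1] lines
    inside U.\<close>
  obtain L0 where L0: "L0 \<in> T x" "P0 \<subseteq> L0" "\<not> L0 \<subseteq> U"
  proof -
    have "card {L \<in> lines x U. P0 \<subseteq> L} = qnum l (2 * w - 1)"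
      using card_lines_through[OF P0 U(1)] U(3) by (simp add: card_field)
    also have "\<dots> < qnum l (n - 2)" unfolding n2 using l2 w2 by (intro qnum_strict_mono) auto
    finally have "card {L \<in> lines x U. P0 \<subseteq> L} < card {L \<in> T x. P0 \<subseteq> L}"
      using tU[OF P0] by (simp add: \<tau>_def)
    then have "\<not> {L \<in> T x. P0 \<subseteq> L} \<subseteq> {L \<in> lines x U. P0 \<subseteq> L}"
      using card_mono[of "{L \<in> lines x U. P0 \<subseteq> L}" "{L \<in> T x. P0 \<subseteq> L}"] by force
    then obtain L where "L \<in> T x" "P0 \<subseteq> L" "L \<notin> lines x U" by blast
    then show thesis using that T_sub[of x] by (auto simp: lines_def)
  qed
  have L0f: "vec.subspace L0" "x \<subseteq> L0" "vec.dim L0 = n + 2" using L0 T_sub[of x] by (auto simp: lines_def)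
  have "\<exists>P'\<in>pts x L0. \<not> P' \<subseteq> U"
  proof -
    obtain v where v: "v \<in> L0" "v \<notin> U" using L0(3) by blast
    moreover from v have "v \<notin> x" using U by blast
    ultimately have "vec.span (insert v x) \<in> pts x L0" "\<not> vec.span (insert v x) \<subseteq> U"
      using point_through[OF xf(2) _ _ L0f(1,2)] by blast+
    then show ?thesis by blast
  qed
  then obtain P1 where P1: "P1 \<in> pts x L0" "\<not> P1 \<subseteq> U" by blast
  have P1f: "vec.subspace P1" "x \<subseteq> P1" "vec.dim P1 = n + 1" "P1 \<in> pts x UNIV" using P1 by (auto simp: pts_def)
  have t1: "0 < \<tau> x P1" using \<tau>_pos[OF L0(1)] P1(1) by (auto simp: pts_def)
  define H where "H = U + P1"
  have Hs: "vec.subspace H" "U \<subseteq> H" "P1 \<subseteq> H" unfolding H_def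
    using U P1f by (auto intro: subspace_plus simp: subset_plus1 subset_plus2)
  have dU: "vec.dim U = 2 * n - 2" using U(3) n2 n_even d3 by simp
  have dH: "vec.dim H = 2 * n - 1"
  proof -
    have "x \<subseteq> U \<inter> P1" using U P1f by blast
    from vec.dim_subset[OF this] have "n \<le> vec.dim (U \<inter> P1)" using xf by simp
    then have "vec.dim H \<le> 2 * n - 1" using dim_plus_Int[OF U(1) P1f(1)] dU P1f n_even d3 unfolding H_def by simp
    moreover have "\<not> vec.dim H \<le> vec.dim U"
      using subspace_eqI[OF U(1) Hs(1,2)] Hs(3) P1(2) by auto
    ultimately show ?thesis using dU n_even d3 by simp
  qed
  \<comment> \<open>U has codimension 1 in H, so every line of H has a point in U.\<close>
  have U_meets: "\<exists>P\<in>pts x U. P \<subseteq> M" if M: "M \<in> lines x H" for M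
  proof -
    have Mf: "vec.subspace M" "x \<subseteq> M" "M \<subseteq> H" "vec.dim M = n + 2" using M by (auto simp: lines_def)
    have "vec.dim (M + U) \<le> 2 * n - 1" using vec.dim_subset[OF plus_least[OF Hs(1) Mf(3) Hs(2)]] dH by simp
    then have d: "n + 1 \<le> vec.dim (M \<inter> U)" using dim_plus_Int[OF Mf(1) U(1)] Mf dU n_even d3 by simp
    have "x \<subseteq> M \<inter> U" using Mf U by blast
    then obtain P where "vec.subspace P" "x \<subseteq> P" "P \<subseteq> M \<inter> U" "vec.dim P = n + 1"
      using exists_between[OF xf(3) subspace_Int[OF Mf(1) U(1)], of "n + 1"] d xf by auto
    then show ?thesis by (auto simp: pts_def)
  qed
  have inT: "M \<in> T x" if M: "M \<in> lines x H" and R: "R \<in> pts x M" "\<not> R \<subseteq> U" "0 < \<tau> x R" for M R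
  proof (rule ccontr)
    assume nM: "M \<notin> T x"
    obtain P where P: "P \<in> pts x U" "P \<subseteq> M" using U_meets[OF M] by blast
    have "R \<noteq> P" using P R by (auto simp: pts_def)
    then have "\<tau> x R = 0" using zero[OF _ nM P R(1)] M by (auto simp: lines_def)
    then show False using R by simp
  qed
  \<comment> \<open>The line joining R to P1 contains the point P1 outside U with positive
    \<open>\<tau> x\<close>, so \<open>inT\<close> puts it into \<open>T x\<close>.\<close>
  have pos: "0 < \<tau> x R" if R: "R \<in> pts x H" "\<not> R \<subseteq> U" for R
  proof (cases "R = P1")
    case True
    then show ?thesis using t1 by simp
  next
    case False
    have P1H: "P1 \<in> pts x H" using P1f Hs by (simp add: pts_def)
    have L: "P1 + R \<in> lines x H" using line_plus(1)[OF P1H R(1) _ Hs(1) xf(2)] False by blast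
    have sR: "vec.subspace R" using R by (simp add: pts_def)
    have "P1 \<in> pts x (P1 + R)" using P1f subset_plus1[OF sR] by (simp add: pts_def)
    then have "P1 + R \<in> T x" using inT[OF L _ P1(2) t1] by blast
    then show ?thesis using \<tau>_pos[of "P1 + R" x R] subset_plus2[OF P1f(1)] by blast
  qed
  have sub: "lines x H \<subseteq> T x"
  proof
    fix M assume M: "M \<in> lines x H"
    show "M \<in> T x"
    proof (cases "M \<subseteq> U")
      case True
      then show ?thesis using M U(4) by (auto simp: lines_def)
    next
      case False
      then obtain v where v: "v \<in> M" "v \<notin> U" by blast
      have Mf: "vec.subspace M" "x \<subseteq> M" "M \<subseteq> H" "vec.dim M = n + 2" using M by (auto simp: lines_def)
      let ?P = "vec.span (insert v x)"
      have "v \<notin> x" using v U by blast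
      then have "?P \<in> pts x M" "v \<in> ?P" using point_through[OF xf(2) v(1) _ Mf(1,2)] by blast+
      then have P: "?P \<in> pts x M" "?P \<in> pts x H" "\<not> ?P \<subseteq> U" using v Mf(3) by (auto simp: pts_def)
      show ?thesis by (rule inT[OF M P(1,3) pos[OF P(2,3)]])
    qed
  qed
  have xH: "x \<subseteq> H" using U Hs by blast
  \<comment> \<open>Up to the factor 1 + l, both the lines of H and \<open>T x\<close> number
    [n - 1] [n - 2], so the inclusion is an equality.\<close>
  have "vec.dim H = n + (n - 1)" using dH n_even d3 by simp
  then have "(1 + l) * card (lines x H) = qnum l (n - 1) * qnum l (n - 1 - 1)"
    using card_lines[OF xf(2) Hs(1) xH] unfolding card_field by blast
  moreover have "n - 1 - 1 = 2 * w" using n2 by simp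
  ultimately have "(1 + l) * card (T x) = (1 + l) * card (lines x H)" using card_T[OF x] m_eq by simp
  then have "card (lines x H) = card (T x)" unfolding mult_cancel1 by simp
  then have "lines x H = T x" by (rule card_subset_eq[OF finite_T sub])
  then show "\<exists>H. vec.subspace H \<and> x \<subseteq> H \<and> vec.dim H = 2 * n - 1 \<and> T x = lines x H"
    using Hs xH dH by blast
qed

lemma neighbour_in_hyperplane:
  assumes x: "x \<in> Y" and H: "vec.subspace H" "x \<subseteq> H" "T x = lines x H" and z: "z \<in> X" "\<delta> x z = 2"
  shows "z \<in> Y \<longleftrightarrow> z \<subseteq> H"
proof -
  note xf = vertex_facts[OF x]
  have zV: "z \<in> V" using z X_sub by blast
  have L: "x + z \<in> lines x UNIV" using line_of[OF xf(1) z(1)] z by simp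
  have "z \<in> Y \<longleftrightarrow> x + z \<in> T x" using T_full[OF x z(1)] L unfolding T_def by blast
  also have "\<dots> \<longleftrightarrow> x + z \<subseteq> H" using L unfolding H by (auto simp: lines_def)
  also have "\<dots> \<longleftrightarrow> z \<subseteq> H" using subset_plus2[OF xf(3), of z] plus_least[OF H(1,2)] by blast
  finally show ?thesis .
qed

text \<open>If K had a vector v outside H, join it to a point P over z on the line z + x. The
  joining line belongs to \<open>T z\<close>, and a vertex y of \<open>Y\<close> on it is x or
  adjacent to x, as the lines of x and y at z meet in P. So y lies in H, and with it v.\<close>

lemma hyperplane_invariant:
  assumes x: "x \<in> Y" and H: "vec.subspace H" "x \<subseteq> H" "vec.dim H = 2 * n - 1" "T x = lines x H"
    and z: "z \<in> Y" "\<delta> x z = 2" and K: "vec.subspace K" "z \<subseteq> K" "vec.dim K = 2 * n - 1" "T z = lines z K"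
  shows "K = H"
proof -
  note xf = vertex_facts[OF x]
  note zf = vertex_facts[OF z(1)]
  have "K \<subseteq> H"
  proof (rule ccontr)
    assume "\<not> K \<subseteq> H"
    then obtain v where v: "v \<in> K" "v \<notin> H" by blast
    have zH: "z \<subseteq> H" using neighbour_in_hyperplane[OF x H(1,2,4) zf(1) z(2)] z(1) by simp
    have xK: "x \<subseteq> K" using neighbour_in_hyperplane[OF z(1) K(1,2,4) xf(1)] z(2) x \<delta>_commute[of x z] by simp
    have sxz: "vec.subspace (x + z)" using xf zf by (simp add: subspace_plus)
    have zxz: "z \<subseteq> x + z" by (rule subset_plus2[OF xf(3)])
    have dxz: "vec.dim (x + z) = n + 2" using dim_plus[OF xf(2) zf(2)] z by simp
    obtain P where P: "vec.subspace P" "z \<subseteq> P" "P \<subseteq> x + z" "vec.dim P = n + 1"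
      using exists_between[OF zf(3) sxz zxz, of "n + 1"] zf dxz by auto
    have xzK: "x + z \<subseteq> K" by (rule plus_least[OF K(1) xK K(2)])
    have xzH: "x + z \<subseteq> H" by (rule plus_least[OF H(1,2) zH])
    have vP: "v \<notin> P" using v P xzH by blast
    let ?L = "vec.span (insert v P)"
    have Ls: "vec.subspace ?L" "P \<subseteq> ?L" "v \<in> ?L" using vec.span_superset[of "insert v P"] by auto
    have dL: "vec.dim ?L = n + 2" using dim_insert_subspace[OF P(1) vP] P by simp
    have LK: "?L \<subseteq> K" using v P xzK K by (intro vec.span_minimal) auto
    have zL: "z \<subseteq> ?L" using P Ls by blast
    have L: "?L \<in> lines z K" using Ls(1) zL LK dL by (simp add: lines_def)
    then have LT: "?L \<in> T z" using K by simp
    have LU: "?L \<in> lines z UNIV" using L by (auto simp: lines_def)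
    obtain y where y: "y \<in> X" "z + y = ?L" "\<delta> z y = 2" using line_representative[OF zf(1) LU] by blast
    have yY: "y \<in> Y" using T_full[OF z(1) y(1)] y(2) LT by simp
    have yf: "y \<in> V" "vec.subspace y" using vertex_facts[OF yY] by auto
    have "y \<subseteq> H"
    proof (cases "y = x")
      case True
      then show ?thesis using H by simp
    next
      case False
      have "P \<in> {P \<in> pts z (z + x). P \<subseteq> z + y}"
        using P Ls y by (simp add: pts_def add.commute)
      then have "card {P \<in> pts z (z + x). P \<subseteq> z + y} \<noteq> 0" by auto
      moreover have "z + y \<noteq> z + x" using v Ls y xzH by (metis add.commute subsetD)
      ultimately have "\<delta> x y = 2"
        using card_common_pts[OF zf(1) xf(1) _ y(1,3)] z(2) \<delta>_commute[of x z] False by (auto split: if_splits)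
      then show ?thesis using neighbour_in_hyperplane[OF x H(1,2,4) y(1)] yY by simp
    qed
    then have "?L \<subseteq> H" using plus_least[OF H(1) zH] y(2) by metis
    then show False using v Ls by blast
  qed
  then show ?thesis using H K by (intro subspace_eqI) auto
qed

lemma descendent_width_ge_2:
  assumes w2: "2 \<le> w"
  shows "w = d - 1 \<and> (\<exists>u. isotropic Q u \<and> vec.dim u = 1 \<and> Y = {x \<in> X. u \<subseteq> x})"
proof -
  \<comment> \<open>Every x in \<open>Y\<close> has some y in \<open>Y\<close> at the maximal
    distance 2w: apply \<open>far_in_component\<close> with C = Y and x as target. Then x in turn is
    a local maximum with respect to y.\<close>
  have hyp: "w = d - 1 \<and> (\<exists>H. vec.subspace H \<and> x \<subseteq> H \<and> vec.dim H = 2 * n - 1 \<and> T x = lines x H)" if x: "x \<in> Y" for x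
  proof -
    note xf = vertex_facts[OF x]
    obtain y where y: "y \<in> Y" "\<delta> y x = 2 * w"
      by (rule far_in_component[OF subset_refl Y_ne _ x])
    note yf = vertex_facts[OF y(1)]
    have far: "\<delta> z y \<le> 2 * w" if "z \<in> Y" for z using width_Y[OF that y(1)] .
    have d: "\<delta> x y = 2 * w" using y \<delta>_commute[of x y] by simp
    have "lines x (x + y) \<subseteq> T x" by (rule local_maximum(2)[OF x yf(1) d w1 far]) simp_all
    then show ?thesis
      using T_hyperplane[OF x subspace_plus[OF xf(3) yf(3)] subset_plus1[OF yf(3)] _ _ w2] dim_plus[OF xf(2) yf(2)] d
      by simp
  qed
  obtain x0 where x0: "x0 \<in> Y" using Y_ne by blast
  obtain H where H: "vec.subspace H" "x0 \<subseteq> H" "vec.dim H = 2 * n - 1" "T x0 = lines x0 H" using hyp[OF x0] by blast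
  \<comment> \<open>The vertices of \<open>Y\<close> whose hyperplane is H itself; by
    \<open>hyperplane_invariant\<close> this is a union of components of \<open>Y\<close>.\<close>
  define C where "C = {x \<in> Y. x \<subseteq> H \<and> T x = lines x H}"
  have closed: "z \<in> C" if xz: "x \<in> C" "z \<in> Y" "\<delta> x z = 2" for x z
  proof -
    have x: "x \<in> Y" "x \<subseteq> H" "T x = lines x H" using xz by (auto simp: C_def)
    obtain K where K: "vec.subspace K" "z \<subseteq> K" "vec.dim K = 2 * n - 1" "T z = lines z K" using hyp[OF xz(2)] by blast
    have "K = H" by (rule hyperplane_invariant[OF x(1) H(1) x(2) H(3) x(3) xz(2,3) K])
    then show ?thesis using K xz by (simp add: C_def)
  qed
  have CY: "C \<subseteq> Y" "C \<noteq> {}" using x0 H by (auto simp: C_def)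
  define u where "u = perp H"
  have du: "vec.dim u = 1" using dim_perp[OF H(1)] H(3) n_even d3 unfolding u_def by simp
  have su: "vec.subspace u" unfolding u_def by simp
  have u_sub: "u \<subseteq> x \<longleftrightarrow> x \<subseteq> H" if "x \<in> V" for x
  proof
    assume "u \<subseteq> x"
    then have "perp x \<subseteq> perp u" by (rule perp_antimono)
    then show "x \<subseteq> H" using perp_vertex[OF that] perp_perp[OF H(1)] unfolding u_def by simp
  next
    assume "x \<subseteq> H"
    then show "u \<subseteq> x" using perp_antimono[of x H] perp_vertex[OF that] unfolding u_def by simp
  qed
  have iso: "isotropic Q u" using su u_sub[of x0] H(2) vertex_Q[of x0] vertex_facts[OF x0] unfolding isotropic_def by blast
  \<comment> \<open>y may lie in another component. Some x in C is at distance 2w from it with all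
    lines of x + y in \<open>T x\<close>, hence inside H, and these lines cover x + y.\<close>
  have YH: "y \<subseteq> H" if y: "y \<in> Y" for y
  proof -
    obtain x where x: "x \<in> C" "\<delta> x y = 2 * w" "lines x (x + y) \<subseteq> T x"
      by (rule far_in_component[OF CY closed y])
    have xC: "x \<in> Y" "x \<subseteq> H" "T x = lines x H" using x by (auto simp: C_def)
    note xf = vertex_facts[OF xC(1)] and yf = vertex_facts[OF y]
    have s: "vec.subspace (x + y)" using xf yf by (simp add: subspace_plus)
    have xs: "x \<subseteq> x + y" by (rule subset_plus1[OF yf(3)])
    show "y \<subseteq> H"
    proof
      fix v assume v: "v \<in> y"
      show "v \<in> H"
      proof (cases "v \<in> x")
        case True
        then show ?thesis using xC by blast
      next
        case False
        let ?P = "vec.span (insert v x)"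
        have "v \<in> x + y" using v subset_plus2[OF xf(3), of y] by blast
        then have "?P \<in> pts x (x + y)" by (rule point_through(1)[OF xf(2) _ False s xs])
        then have "?P \<subseteq> x + y" "vec.dim ?P = n + 1" by (simp_all add: pts_def)
        moreover have "vec.dim (x + y) = n + 2 * w" using dim_plus[OF xf(2) yf(2)] x by simp
        ultimately obtain L where L: "vec.subspace L" "?P \<subseteq> L" "L \<subseteq> x + y" "vec.dim L = n + 2"
          using exists_between[of ?P "x + y" "n + 2"] s w2 by auto
        have "insert v x \<subseteq> L" using L(2) vec.span_superset[of "insert v x"] by blast
        then have "L \<in> lines x (x + y)" using L by (simp add: lines_def)
        then have "L \<subseteq> H" using x(3) xC(3) by (auto simp: lines_def)
        then show ?thesis using \<open>insert v x \<subseteq> L\<close> by blast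
      qed
    qed
  qed
  have sub1: "Y \<subseteq> {x \<in> X. u \<subseteq> x}"
  proof
    fix y assume y: "y \<in> Y"
    show "y \<in> {x \<in> X. u \<subseteq> x}" using YH[OF y] u_sub[of y] vertex_facts[OF y] by simp
  qed
  \<comment> \<open>A shortest path from a vertex of C to y can be chosen inside x + y, hence inside
    H, and so it never leaves C.\<close>
  have sub2: "y \<in> Y" if "x \<in> C" "y \<in> X" "y \<subseteq> H" "\<delta> x y = 2 * k" for x y k
    using that
  proof (induction k arbitrary: x)
    case 0
    then have "x = y" using \<delta>_eq_0_iff[of x y] CY YX X_sub by auto
    then show ?case using 0 CY by blast
  next
    case (Suc k)
    have x: "x \<in> Y" "x \<subseteq> H" "T x = lines x H" using Suc by (auto simp: C_def)
    have d: "\<delta> x y = Suc (Suc (2 * k))" using Suc by simp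
    obtain z where z: "z \<in> X" "\<delta> x z = 2" "\<delta> z y = 2 * k" "x \<inter> y \<subseteq> z" "z \<subseteq> x + y"
      by (rule closer_X[OF YX[OF x(1)] Suc.prems(2) d])
    have "z \<subseteq> H" by (rule subset_trans[OF z(5) plus_least[OF H(1) x(2) Suc.prems(3)]])
    then have "z \<in> Y" using neighbour_in_hyperplane[OF x(1) H(1) x(2,3) z(1,2)] by simp
    then have "z \<in> C" by (rule closed[OF Suc.prems(1) _ z(2)])
    then show ?case by (rule Suc.IH[OF _ Suc.prems(2,3) z(3)])
  qed
  have sub3: "y \<in> Y" if y: "y \<in> X" "u \<subseteq> y" for y
  proof -
    obtain k where k: "\<delta> x0 y = 2 * k" using parity_X[OF YX[OF x0] y(1)] by (auto elim: evenE)
    have "x0 \<in> C" using x0 H by (simp add: C_def)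
    then show ?thesis using sub2[of x0 y k] y k u_sub[of y] X_sub[OF y(1)] by simp
  qed
  have "Y = {x \<in> X. u \<subseteq> x}" by (intro equalityI sub1 subsetI) (simp add: sub3)
  then show ?thesis using hyp[OF x0] iso du by blast
qed

text \<open>A line L of \<open>T x\<close> has point sum l + m over 1 + l points. Only one point P
  of L can lie on further lines of \<open>T x\<close>; the others contribute 1 each, so
  \<open>\<tau> x P = m = [n - 1]\<close>. Thus \<open>T x\<close> is the full pencil of lines
  through P, and the centre z is the flip of x across P.\<close>

lemma descendent_width_1:
  assumes w: "w = 1"
  shows "\<exists>z \<in> V - X. Y = {x \<in> V. \<delta> z x = 1}"
proof -
  obtain x where x: "x \<in> Y" using Y_ne by blast
  note xf = vertex_facts[OF x]
  have cT: "card (T x) = m"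
  proof -
    have "(1 + l) * card (T x) = (1 + l) * m" using card_T[OF x] w by (simp add: qnum_2)
    then show ?thesis unfolding mult_cancel1 by simp
  qed
  have meet: "\<exists>P\<in>pts x UNIV. P \<subseteq> L \<and> P \<subseteq> M" if L: "L \<in> T x" and M: "M \<in> T x" for L M
  proof -
    obtain y z where yz: "y \<in> Y" "x + y = L" "z \<in> Y" "x + z = M" using L M unfolding T_def by blast
    note yf = vertex_facts[OF yz(1)] and zf = vertex_facts[OF yz(3)]
    have d: "\<delta> x y = 2" "\<delta> x z = 2"
      using line_of[OF xf(1) yf(1)] line_of[OF xf(1) zf(1)] yz L M T_sub by blast+
    have "\<delta> y z \<le> 2" using width_Y[OF yz(1,3)] w by simp
    have "\<delta> y z = 2" if "z \<noteq> y"
    proof -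
      have "\<delta> y z \<noteq> 0" using \<delta>_eq_0_iff[OF yf(2) zf(2)] that by blast
      moreover have "even (\<delta> y z)" by (rule parity_X[OF yf(1) zf(1)])
      ultimately show ?thesis using \<open>\<delta> y z \<le> 2\<close> by presburger
    qed
    then have "\<delta> y z = 2 \<or> z = y" by blast
    then have "card {P \<in> pts x (x + y). P \<subseteq> x + z} \<noteq> 0"
      using card_common_pts[OF xf(1) yf(1) d(1) zf(1) d(2)] by auto
    then have "{P \<in> pts x (x + y). P \<subseteq> x + z} \<noteq> {}" by force
    then show ?thesis using yz by (auto simp: pts_def)
  qed
  have m1: "1 < m" using m_gt by simp
  have "T x \<noteq> {}" using cT m1 by auto
  then obtain L where L: "L \<in> T x" by blast
  have LU: "L \<in> lines x UNIV" using L T_sub by blast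
  have Lf: "vec.subspace L" "x \<subseteq> L" "vec.dim L = n + 2" using LU by (auto simp: lines_def)
  have cL: "card (pts x L) = 1 + l" using card_pts_line[OF xf(2) LU] card_field by simp
  have sumL: "(\<Sum>P\<in>pts x L. \<tau> x P) = l + m" using sum_\<tau>_line[OF x LU] L w m1 by (simp add: qnum_2)
  have t1: "1 \<le> \<tau> x P" if "P \<in> pts x L" for P using \<tau>_pos[OF L, of P] that by (auto simp: pts_def)
  text \<open>If two points of \<open>L\<close> were on further lines of \<open>T x\<close>, then all lines of \<open>T x\<close> that meet
    \<open>L\<close> would be in one plane.\<close>
  have plane: "\<tau> x P \<le> 1 + l"
    if P: "P \<in> pts x L" and P2: "P2 \<in> pts x L" "P2 \<noteq> P" and M2: "M2 \<in> T x" "M2 \<noteq> L" "P2 \<subseteq> M2" for P P2 M2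
  proof -
    have Pf: "vec.subspace P" "x \<subseteq> P" "P \<subseteq> L" "vec.dim P = n + 1" "P \<in> pts x UNIV" using P by (auto simp: pts_def)
    have P2f: "vec.subspace P2" "x \<subseteq> P2" "P2 \<subseteq> L" "vec.dim P2 = n + 1" "P2 \<in> pts x UNIV" using P2 by (auto simp: pts_def)
    have M2f: "vec.subspace M2" "x \<subseteq> M2" "vec.dim M2 = n + 2" "M2 \<in> lines x UNIV"
      using M2 T_sub[of x] by (auto simp: lines_def)
    let ?S = "L + M2"
    have sS: "vec.subspace ?S" using Lf M2f by (simp add: subspace_plus)
    have LS: "L \<subseteq> ?S" "M2 \<subseteq> ?S" using Lf M2f by (simp_all add: subset_plus1 subset_plus2)
    have uniq: "N = N'" if "N \<in> lines x UNIV" "N' \<in> lines x UNIV" "A \<in> pts x UNIV" "A' \<in> pts x UNIV" "A \<noteq> A'"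
      "A \<subseteq> N" "A' \<subseteq> N" "A \<subseteq> N'" "A' \<subseteq> N'" for N N' A A'
      using line_plus(2)[OF that(3,4,5) _ xf(2) that(1)] line_plus(2)[OF that(3,4,5) _ xf(2) that(2)] that by simp
    have "P2 \<subseteq> L \<inter> M2" using P2f M2 by blast
    from vec.dim_subset[OF this] have "n + 1 \<le> vec.dim (L \<inter> M2)" using P2f by simp
    then have dS: "vec.dim ?S \<le> n + 3" using dim_plus_Int[OF Lf(1) M2f(1)] Lf M2f by simp
    have "M \<subseteq> ?S" if M: "M \<in> T x" "P \<subseteq> M" for M
    proof (cases "M = L")
      case True
      then show ?thesis using LS by simp
    next
      case False
      have MU: "M \<in> lines x UNIV" using M T_sub by blast
      obtain A where A: "A \<in> pts x UNIV" "A \<subseteq> M" "A \<subseteq> M2" using meet[OF M(1) M2(1)] by blast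
      have "A \<noteq> P"
      proof
        assume "A = P"
        then have "P \<subseteq> M2" using A by simp
        then have "M2 = L" using uniq[OF M2f(4) LU Pf(5) P2f(5)] P2 M2 Pf P2f by blast
        then show False using M2 by blast
      qed
      then have "M = P + A" using line_plus(2)[OF Pf(5) A(1) _ _ xf(2) MU] M A by auto
      moreover have "P + A \<subseteq> ?S" using Pf(3) LS A(3) sS by (intro plus_least) auto
      ultimately show ?thesis by simp
    qed
    then have "{M \<in> T x. P \<subseteq> M} \<subseteq> {M \<in> lines x ?S. P \<subseteq> M}" using T_sub[of x] by (auto simp: lines_def)
    then have "\<tau> x P \<le> card {M \<in> lines x ?S. P \<subseteq> M}" unfolding \<tau>_def by (intro card_mono) auto
    also have "\<dots> = qnum l (vec.dim ?S - (n + 1))"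
      using card_lines_through[of P x ?S] sS Pf LS card_field by (auto simp: pts_def)
    also have "\<dots> \<le> qnum l 2" using dS l2 by (simp add: qnum_le_iff)
    finally show ?thesis by (simp add: qnum_2)
  qed
  have other: "\<exists>M. M \<in> T x \<and> M \<noteq> L \<and> P \<subseteq> M" if P: "P \<in> pts x L" "1 < \<tau> x P" for P
  proof (rule ccontr)
    assume "\<not> ?thesis"
    then have "{M \<in> T x. P \<subseteq> M} \<subseteq> {L}" by blast
    then have "\<tau> x P \<le> card {L}" unfolding \<tau>_def by (intro card_mono) auto
    then show False using P by simp
  qed
  \<comment> \<open>With two such points every \<open>\<tau> x\<close> on L would be at most 1 + l,
    and l + m \<le> (1 + l)^2 contradicts m \<ge> [4].\<close>
  have single: "P = P'" if P: "P \<in> pts x L" "1 < \<tau> x P" and P': "P' \<in> pts x L" "1 < \<tau> x P'" for P P'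
  proof (rule ccontr)
    assume ne: "P \<noteq> P'"
    have "\<tau> x A \<le> 1 + l" if A: "A \<in> pts x L" for A
    proof (cases "A = P")
      case True
      then show ?thesis using other[OF P'] plane[OF A P'(1)] ne by blast
    next
      case False
      then show ?thesis using other[OF P] plane[OF A P(1)] by blast
    qed
    then have "(\<Sum>A\<in>pts x L. \<tau> x A) \<le> (\<Sum>A\<in>pts x L. 1 + l)" by (intro sum_mono)
    then have "l + m \<le> (1 + l) * (1 + l)" unfolding sumL using cL by simp
    moreover have "qnum l 4 \<le> m" unfolding m_eq using l2 n_even d3 by (simp add: qnum_le_iff)
    moreover have "qnum l 4 = 1 + l + l * l + l * l * l" by (simp add: qnum_def eval_nat_numeral algebra_simps)
    moreover have "2 * (l * l) \<le> l * l * l" using l2 by (simp add: mult_le_mono1)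
    moreover have "2 * l \<le> l * l" using l2 by (simp add: mult_le_mono1)
    ultimately show False using l2 by (simp add: algebra_simps)
  qed
  obtain P where P: "P \<in> pts x L" "1 < \<tau> x P"
  proof (rule ccontr)
    assume "\<not> thesis"
    then have "\<tau> x P \<le> 1" if "P \<in> pts x L" for P using that \<open>\<And>P. P \<in> pts x L \<Longrightarrow> 1 < \<tau> x P \<Longrightarrow> thesis\<close> by force
    then have "(\<Sum>P\<in>pts x L. \<tau> x P) \<le> (\<Sum>P\<in>pts x L. 1)" by (intro sum_mono)
    then show False unfolding sumL using cL m1 by simp
  qed
  have "(\<Sum>A\<in>pts x L - {P}. \<tau> x A) = (\<Sum>A\<in>pts x L - {P}. 1)"
  proof (intro sum.cong refl)
    fix A assume "A \<in> pts x L - {P}"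
    then show "\<tau> x A = 1" using single[OF P, of A] t1[of A] by force
  qed
  then have "(\<Sum>A\<in>pts x L. \<tau> x A) = \<tau> x P + l" using P(1) cL by (simp add: sum.remove)
  then have tP: "\<tau> x P = m" using sumL by simp
  have Pf: "vec.subspace P" "x \<subseteq> P" "vec.dim P = n + 1" "P \<in> pts x UNIV" using P by (auto simp: pts_def)
  have "{M \<in> T x. P \<subseteq> M} = T x"
    by (rule card_subset_eq) (use tP cT in \<open>auto simp: \<tau>_def\<close>)
  then have TP: "M \<in> T x \<Longrightarrow> P \<subseteq> M" for M by blast
  have "{M \<in> T x. P \<subseteq> M} = {M \<in> lines x UNIV. P \<subseteq> M}"
  proof (rule card_subset_eq)
    show "card {M \<in> T x. P \<subseteq> M} = card {M \<in> lines x UNIV. P \<subseteq> M}"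
      using tP card_lines_through[OF Pf(4)] m_eq by (simp add: \<tau>_def card_field)
  qed (use T_sub in auto)
  then have PT: "M \<in> lines x UNIV \<Longrightarrow> P \<subseteq> M \<Longrightarrow> M \<in> T x" for M by blast
  obtain z where z: "z \<in> V" "x + z = P" "\<delta> x z = 1" using flip_exists[OF xf(2) Pf(1-3)] by blast
  have zX: "z \<notin> X" using parity[OF xf(2) z(1)] z xf by simp
  have zP: "z \<subseteq> P" using z subset_plus2[OF xf(3), of z] by blast
  have Yz: "\<delta> z y = 1" if y: "y \<in> Y" for y
  proof (cases "y = x")
    case True
    then show ?thesis using z \<delta>_commute[of x z] by simp
  next
    case False
    note yf = vertex_facts[OF y]
    have "\<delta> x y \<noteq> 0" "even (\<delta> x y)" "\<delta> x y \<le> 2"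
      using \<delta>_eq_0_iff[OF xf(2) yf(2)] parity_X[OF xf(1) yf(1)] width_Y[OF x y] False w by auto
    then have d: "\<delta> x y = 2" by presburger
    have "x + y \<in> lines x UNIV" using line_of[OF xf(1) yf(1)] d by blast
    then have "x + y \<in> T x" using y unfolding T_def by blast
    then have PL: "P \<subseteq> x + y" by (rule TP)
    have "z \<subseteq> x + y" using zP PL by blast
    then have "z + y \<subseteq> x + y"
      using subset_plus2[OF xf(3), of y] subspace_plus[OF xf(3) yf(3)] by (intro plus_least) auto
    from vec.dim_subset[OF this] have "\<delta> z y \<le> 2" using dim_plus[OF z(1) yf(2)] dim_plus[OF xf(2) yf(2)] d by simp
    moreover have "odd (\<delta> z y)" using parity[OF z(1) yf(2)] zX yf by simp
    ultimately show ?thesis by presburger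
  qed
  have zY: "y \<in> Y" if y: "y \<in> V" "\<delta> z y = 1" for y
  proof (cases "y = x")
    case True
    then show ?thesis using x by simp
  next
    case False
    have yX: "y \<in> X" using parity[OF z(1) y(1)] y zX by simp
    have "\<delta> x y \<le> 2" using \<delta>_triangle[OF xf(2) z(1) y(1)] z y by simp
    moreover have "\<delta> x y \<noteq> 0" "even (\<delta> x y)" using \<delta>_eq_0_iff[OF xf(2) y(1)] parity_X[OF xf(1) yX] False by auto
    ultimately have d: "\<delta> x y = 2" by presburger
    have L: "x + y \<in> lines x UNIV" using line_of[OF xf(1) yX] d by blast
    have sz: "vec.subspace (x + z)" "vec.subspace (z + y)" using xf z y by (auto intro: subspace_plus)
    have "z \<subseteq> (x + z) \<inter> (z + y)" using subset_plus2[OF xf(3), of z] subset_plus1[of y z] y by auto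
    from vec.dim_subset[OF this] have "n \<le> vec.dim ((x + z) \<inter> (z + y))" using z by simp
    then have "vec.dim ((x + z) + (z + y)) \<le> n + 2"
      using dim_plus_Int[OF sz] dim_plus[OF xf(2) z(1)] dim_plus[OF z(1) y(1)] z y by simp
    moreover have "x + y \<subseteq> (x + z) + (z + y)"
      using z y by (intro set_plus_mono2 subset_plus1 subset_plus2) auto
    moreover have "vec.dim (x + y) = n + 2" using dim_plus[OF xf(2) y(1)] d by simp
    moreover have "vec.subspace (x + y)" using xf y by (simp add: subspace_plus)
    ultimately have "x + y = (x + z) + (z + y)" using subspace_plus[OF sz] by (intro subspace_eqI) simp_all
    then have "P \<subseteq> x + y" using subset_plus1[OF sz(2), of "x + z"] z by simp
    then have "x + y \<in> T x" by (rule PT[OF L])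
    then show ?thesis by (rule T_full[OF x yX])
  qed
  have "Y = {y \<in> V. \<delta> z y = 1}" using Yz zY vertex_facts(2) by (intro equalityI subsetI) simp_all
  then show ?thesis using z zX by blast
qed

end

section \<open>From the hypotheses on the graph to the locales, and the two cases of the
  width\<close>

theorem mainTheorem17:
  fixes Q :: "'a::{field,finite} ^ 'm \<Rightarrow> 'a"
    and d n l :: nat
    and X Y :: "('a ^ 'm) set set"
    and R :: "(('a ^ 'm) set \<times> ('a ^ 'm) set) set"
    and E :: "nat \<Rightarrow> ('a ^ 'm) set cmatrix"
  assumes "d \<ge> 3" and "n = 2 * d \<or> n = 2 * d + 1"
    and "CARD('a) = l"
    and "polar_space_D n Q"
    and "bipartite_half (dp_vertices Q) (dp_adj Q) X"
    and "R = halved_adj (dp_adj Q) X"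
    and "standard_ordering X R (of_nat (l ^ 2)) E"
    and "nontrivial_descendent X R E Y"
  shows "n = 2 * d \<and>
    ((width X R Y = 1 \<and>
        (\<exists>z \<in> dp_vertices Q - X. Y = {x \<in> dp_vertices Q. (z, x) \<in> dp_adj Q})) \<or>
     (width X R Y = d - 1 \<and>
        (\<exists>u. isotropic Q u \<and> vec.dim u = 1 \<and> Y = {x \<in> X. u \<subseteq> x})))"
proof -
  have drX: "distance_regular X R"
    using assms(7) unfolding standard_ordering_def Q_polynomial_def by blast
  then have Xne: "X \<noteq> {}" by (simp add: distance_regular_def connected_graph_def)
  interpret half_polar Q n X by standard (rule assms(4), rule assms(5), rule Xne)
  have D: "gdiam X R = d" unfolding assms(6) gdiam_R using assms(2) by auto
  have l0: "0 < l" using card_field_ge_2[where 'a='a] assms(3) by simp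
  interpret S: std_ordering X R E "l ^ 2"
    by standard (use drX assms(7) l0 D assms(1) in auto)
  define w where "w = width X R Y"
  have desc: "Y \<noteq> {}" "Y \<subseteq> X" "w + dual_width X R E Y = d" "w \<noteq> 0" "w \<noteq> d"
    using assms(8) unfolding nontrivial_descendent_def descendent_def w_def D by auto
  have w: "1 \<le> w" "w < d" using desc by simp_all
  have finY: "finite Y" using desc(2) S.finite_X finite_subset by blast
  \<comment> \<open>The form of the distance-k matrix counts ordered pairs of \<open>Y\<close> at
    distance k, so no cancellation can hide such a pair.\<close>
  have wid: "gdist R x y \<le> w" if xy: "x \<in> Y" "y \<in> Y" for x y
  proof -
    have XX: "x \<in> X" "y \<in> X" using xy desc by auto
    define k where "k = gdist R x y"
    have "char_form X (dist_matrix X R k) Y = (\<Sum>a\<in>Y. \<Sum>b\<in>Y. dist_matrix X R k a b)"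
      by (rule char_form_subset[OF S.finite_X desc(2)])
    also have "\<dots> = (\<Sum>a\<in>Y. \<Sum>b\<in>Y. of_bool (gdist R a b = k))"
      by (intro sum.cong refl) (use desc(2) in \<open>auto simp: dist_matrix_def\<close>)
    also have "\<dots> = of_nat (\<Sum>a\<in>Y. card (Y \<inter> {b. gdist R a b = k}))" using finY by simp
    finally have "char_form X (dist_matrix X R k) Y = of_nat (\<Sum>a\<in>Y. card (Y \<inter> {b. gdist R a b = k}))" .
    moreover have "(\<Sum>a\<in>Y. card (Y \<inter> {b. gdist R a b = k})) \<noteq> 0"
    proof -
      have "y \<in> Y \<inter> {b. gdist R x b = k}" using xy k_def by simp
      then have "card (Y \<inter> {b. gdist R x b = k}) \<noteq> 0" using finY by auto
      moreover have "card (Y \<inter> {b. gdist R x b = k}) \<le> (\<Sum>a\<in>Y. card (Y \<inter> {b. gdist R a b = k}))"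
        by (rule member_le_sum) (use xy finY in auto)
      ultimately show ?thesis by linarith
    qed
    ultimately have "char_form X (dist_matrix X R (gdist R x y)) Y \<noteq> 0" unfolding k_def by (simp del: of_nat_sum)
    then have "gdist R x y \<in> {i \<in> {0..gdiam X R}. char_form X (dist_matrix X R i) Y \<noteq> 0}"
      using S.dst_le_D[OF XX] by simp
    then show ?thesis unfolding w_def width_def by (intro Max_ge) simp_all
  qed
  have dual: "char_form X (E j) Y = 0" if j: "gdiam X R - w < j" "j \<le> gdiam X R" for j
  proof (rule ccontr)
    assume "char_form X (E j) Y \<noteq> 0"
    then have "j \<in> {i \<in> {0..gdiam X R}. char_form X (E i) Y \<noteq> 0}" using j by simp
    then have "j \<le> dual_width X R E Y" unfolding dual_width_def by (intro Max_ge) simp_all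
    then show False using j desc D by simp
  qed
  have gd: "gdist R x y = \<delta> x y div 2" if "x \<in> X" "y \<in> X" for x y
    using gdist_R[OF that] unfolding assms(6) by simp
  have nb: "{z. z \<in> Z \<and> (x, z) \<in> R} = {z. z \<in> Z \<and> \<delta> x z = 2}" if "x \<in> X" "Z \<subseteq> X" for x Z
    using that R_iff unfolding assms(6) by blast
  interpret H: half_descendent Q n X l d w S.\<sigma> Y
  proof
    show "CARD('a) = l" "3 \<le> d" "n = 2 * d \<or> n = 2 * d + 1" "Y \<subseteq> X" "Y \<noteq> {}" "1 \<le> w" "w < d"
      using assms desc w by simp_all
    show "\<delta> x y \<le> 2 * w" if xy: "x \<in> Y" "y \<in> Y" for x y
      using wid[OF xy] gdist_R[OF subsetD[OF desc(2) xy(1)] subsetD[OF desc(2) xy(2)]] unfolding assms(6) by simp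
    show "S.\<sigma> 0 = 1" by (rule S.\<sigma>_0)
    show "(\<Sum>z | z \<in> X \<and> \<delta> x z = 2. S.\<sigma> (\<delta> y z div 2)) = - real (qnum (l ^ 2) d) * S.\<sigma> (\<delta> y x div 2)"
      if xy: "x \<in> X" "y \<in> X" for x y
    proof -
      have "(\<Sum>z | z \<in> X \<and> \<delta> x z = 2. S.\<sigma> (\<delta> y z div 2)) = (\<Sum>z | z \<in> X \<and> (x, z) \<in> R. S.\<sigma> (gdist R y z))"
        unfolding nb[OF xy(1) subset_refl] by (intro sum.cong refl) (use gd xy in auto)
      then show ?thesis using S.\<sigma>_neighbour_sum_X[OF xy] gd[OF xy(2,1)] unfolding D by simp
    qed
    show "(\<Sum>z | z \<in> Y \<and> \<delta> x z = 2. S.\<sigma> (\<delta> y z div 2)) = - real (qnum (l ^ 2) w) * S.\<sigma> (\<delta> y x div 2)"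
      if xy: "x \<in> Y" "y \<in> X" for x y
    proof -
      have xX: "x \<in> X" using xy desc by blast
      have "(\<Sum>z | z \<in> Y \<and> \<delta> x z = 2. S.\<sigma> (\<delta> y z div 2)) = (\<Sum>z | z \<in> Y \<and> (x, z) \<in> R. S.\<sigma> (gdist R y z))"
        unfolding nb[OF xX desc(2)] by (intro sum.cong refl) (use gd xy desc(2) in auto)
      moreover have "w \<le> gdiam X R" using w D by simp
      ultimately show ?thesis
        using S.\<sigma>_neighbour_sum[OF desc(2) wid w(1) _ dual xy] gd[OF xy(2) xX] by simp
    qed
    show "(\<Sum>x\<in>C. S.\<sigma> (\<delta> y x div 2)) = 0"
      if C: "C \<subseteq> X" "(\<Sum>x\<in>C. \<Sum>y\<in>C. S.\<sigma> (\<delta> x y div 2)) = 0" "y \<in> X" for C y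
    proof -
      have "(\<Sum>x\<in>C. \<Sum>y\<in>C. S.\<sigma> (gdist R x y)) = (\<Sum>x\<in>C. \<Sum>y\<in>C. S.\<sigma> (\<delta> x y div 2))"
        by (intro sum.cong refl arg_cong[of _ _ S.\<sigma>] gd) (use C in auto)
      then have "(\<Sum>x\<in>C. S.\<sigma> (gdist R y x)) = 0" using S.\<sigma>_clique[OF C(1) _ C(3)] C(2) by simp
      moreover have "(\<Sum>x\<in>C. S.\<sigma> (gdist R y x)) = (\<Sum>x\<in>C. S.\<sigma> (\<delta> y x div 2))"
        by (intro sum.cong refl arg_cong[of _ _ S.\<sigma>] gd) (use C in auto)
      ultimately show ?thesis by simp
    qed
  qed
  show ?thesis
  proof (cases "w = 1")
    case True
    have "{x \<in> dp_vertices Q. (z, x) \<in> dp_adj Q} = {x \<in> dp_vertices Q. \<delta> z x = 1}" if "z \<in> dp_vertices Q" for z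
      using that dp_adj_iff by blast
    then show ?thesis using H.descendent_width_1[OF True] H.n_even True unfolding w_def by auto
  next
    case False
    then have "2 \<le> w" using w by simp
    then show ?thesis using H.descendent_width_ge_2 H.n_even unfolding w_def by simp
  qed
qed

end
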